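(* Let $\Phi\colon\mathbb{R}^n\to\mathbb{R}$ be a continuous function of the form $\Phi(\mathbf{x})=\min_{j\in\{1,\dots,m\}}\Phi_j(\mathbf{x})$, where $\Phi_1,\dots,\Phi_m\colon\mathbb{R}^n\to\mathbb{R}$ are convex functions and, for each $j$, there are constants $C_j,\delta_j\ge0$ such that $|\Phi_j(\mathbf{x})-\Phi_j(\mathbf{y})|\le C_j\|\mathbf{x}-\mathbf{y}\|(1+\|\mathbf{x}\|^{\delta_j}+\|\mathbf{y}\|^{\delta_j})$ for all $\mathbf{x},\mathbf{y}\in\mathbb{R}^n$. Assume $\Phi$ is bounded below by an affine function. Let $U\colon\mathbb{R}^n\to(-\infty,0]$ be a piecewise affine concave function, $\mathbf{u}_0\in\mathbb{R}^n$ a vector such that $\mathbf{x}\mapsto U(\mathbf{x}+\mathbf{u}_0)$ is 1-homogeneous, and $P$ an invertible $n\times n$ matrix whose column vectors $\mathbf{u}_1,\dots,\mathbf{u}_n$ satisfy $$\{\mathbf{x}\in\mathbb{R}^n\colon U(\mathbf{x}+\mathbf{u}_0)\ge-1\}=\mathrm{co}\left(\bigcup_{j=1}^n\left\{\frac1{a_j}\mathbf{u}_j,-\frac1{b_j}\mathbf{u}_j\right\}\right)$$ for some $a_1,\dots,a_n,b_1,\dots,b_n>0$. Let $M=PP^T$. For $\mathbf{x}\in\mathbb{R}^n$, $t\ge0$ define $$V(\mathbf{x},t)=\min_{j\in\{1,\dots,m\}}V_{\Phi_j}(\mathbf{x},t),$$ and, for $t>0$ and $s\in[0,t]$, $\boldsymbol\gamma(s;\mathbf{x},t)=\boldsymbol\gamma_{\Phi_r}(s;\mathbf{x},t)$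 with $r\in\arg\min_{j\in\{1,\dots,m\}}V_{\Phi_j}(\mathbf{x},t)$ (any choice), where $V_{\Phi_j}$ and $\boldsymbol\gamma_{\Phi_j}$ are defined in the context. Then: (a) $V$ is the unique viscosity solution, in the set $$\mathcal{G}=\{W\in C(\mathbb{R}^n\times[0,+\infty))\colon\|W\|_R<\infty\ \forall R>0;\ \exists\boldsymbol\alpha\in\mathbb{R}^n\text{ s.t. }\forall T>0\ \exists C_T\in\mathbb{R}\text{ s.t. }W(\mathbf{x},t)-\langle\boldsymbol\alpha,\mathbf{x}\rangle\ge C_T\ \forall\mathbf{x}\in\mathbb{R}^n,\forall t\in[0,T]\},$$ where $\|W\|_R=\sup\{|W(\mathbf{x},t)|+\|\mathbf{q}\|\colon(\mathbf{x},t)\in B_R(\mathbb{R}^n)\times[0,R],\ \mathbf{q}\in D_{\mathbf{x}}^-W(\mathbf{x},t)\}$, to the Hamilton-Jacobi PDE $$\frac{\partial V}{\partial t}(\mathbf{x},t)+\frac12\|\nabla_{\mathbf{x}}V(\mathbf{x},t)\|_M^2+U(\mathbf{x})=0\ \ (\mathbf{x}\in\mathbb{R}^n,\ t\in(0,+\infty)),\qquad V(\mathbf{x},0)=\Phi(\mathbf{x})\ \ (\mathbf{x}\in\mathbb{R}^n).$$ (b) For every $\mathbf{x}\in\mathbb{R}^n$ and $t>0$, the trajectory $s\mapsto\boldsymbol\gamma(s;\mathbf{x},t)$ is an optimal trajectory of the optimal control problem $$\inf\left\{\int_0^t\left(\frac12\|\dot{\mathbf{x}}(s)\|_{M^{-1}}^2-U(\mathbf{x}(s))\right)ds+\Phi(\mathbf{x}(0))\colon\mathbf{x}(t)=\mathbf{x}\right\},$$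 the infimum being over Lipschitz functions $\mathbf{x}(\cdot)\colon[0,t]\to\mathbb{R}^n$. Moreover, the optimal value of this problem equals $V(\mathbf{x},t)$.
   Context: Explicit function. For $a,b>0$, $x,p\in\mathbb{R}$, $t\ge0$, define $V(x,t;p,a,b)$ as follows. If $p\ge0$, then $V(x,t;p,a,b)=f_i(x,t;p,a,b)$ whenever $(x,t,p)\in\Omega_i$, $i=1,\dots,5$, where (the regions depend on $a,b$, are subsets of $\mathbb{R}\times[0,+\infty)\times[0,+\infty)$, and partition it) $\Omega_1=\{x\ge pt+\frac a2t^2\}$; $\Omega_2=\{x<0,\ t<\frac pb\}\cup\{x<-\frac b2(t-\frac pb)^2,\ t\ge\frac pb\}$; $\Omega_3=\{0\le x<pt+\frac a2t^2,\ t<\frac pb\}\cup\{\frac a2(t-\frac pb)^2\le x<pt+\frac a2t^2,\ t\ge\frac pb\}$; $\Omega_4=\{0\le x<\frac a2(t-\frac pb)^2,\ t\ge\frac pb\}$; $\Omega_5=\{-\frac b2(t-\frac pb)^2\le x<0,\ t\ge\frac pb\}$; and $f_1=-\frac{a^2}{6}t^3-\frac a2pt^2+atx-\frac12p^2t+px$; $f_2=-\frac{b^2}{6}t^3+\frac b2pt^2-\frac12p^2t+px-btx$; $f_3=\frac{a+b}{3(a+2b)^2}\left((bt-p)^3+((bt-p)^2+2x(a+2b))^{3/2}\right)-\frac{b}{a+2b}(bt-p)x-\frac{b^2}{6}t^3+\frac b2pt^2-\frac12p^2t$; $f_4=\frac{a^2}{3}\left(\frac{2x}{a}\right)^{3/2}-\frac{p^3}{6b}$;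 $f_5=\frac{b^2}{3}\left(\frac{-2x}{b}\right)^{3/2}-\frac{p^3}{6b}$. If $p<0$, then $V(x,t;p,a,b)=V(-x,t;-p,b,a)$ (the right-hand side being given by the case $-p>0$ with $a$ and $b$ exchanged). Explicit trajectory. For $a,b>0$, $x,p\in\mathbb{R}$, $t>0$, $s\in[0,t]$, define $\gamma(s;x,t,p,a,b)$ as follows. If $p\ge0$: - $(x,t,p)\in\Omega_1$: $\gamma=x-p(t-s)-\frac a2(t^2-s^2)$. - $(x,t,p)\in\Omega_2$: $\gamma=x-p(t-s)+\frac b2(t^2-s^2)$. - $(x,t,p)\in\Omega_3$: with $\tau=\frac{(a+b)t+p-\sqrt{(bt-p)^2+2(2b+a)x}}{2b+a}\in[0,t]$, $\gamma=-p(\tau-s)+\frac b2(\tau^2-s^2)$ for $s\in[0,\tau)$ and $\gamma=(p-b\tau)(s-\tau)+\frac a2(s-\tau)^2$ for $s\in[\tau,t]$. - $(x,t,p)\in\Omega_4$: $\gamma=-\frac1{2b}(p-bs)^2$ for $s\in[0,\frac pb)$; $\gamma=0$ for $s\in[\frac pb,t-\sqrt{2x/a})$; $\gamma=\frac a2\left(s-t+\sqrt{2x/a}\right)^2$ for $s\in[t-\sqrt{2x/a},t]$. - $(x,t,p)\in\Omega_5$: $\gamma=-\frac1{2b}(p-bs)^2$ for $s\in[0,\frac pb)$; $\gamma=0$ for $s\in[\frac pb,t-\sqrt{2|x|/b})$; $\gamma=-\frac b2\left(s-t+\sqrt{2|x|/b}\right)^2$ for $s\in[t-\sqrt{2|x|/b},t]$.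 If $p<0$: $\gamma(s;x,t,p,a,b)=-\gamma(s;-x,t,-p,b,a)$. Functions attached to a convex $\Psi\colon\mathbb{R}^n\to\mathbb{R}$ (given $P,\mathbf{u}_0,a_i,b_i$). Put $\tilde\Psi(\mathbf{y})=\Psi(P\mathbf{y}+\mathbf{u}_0)$ and $$V_\Psi(\mathbf{x},t)=\sup_{\mathbf{p}\in\mathbb{R}^n}\left\{\sum_{i=1}^nV\left((P^{-1}\mathbf{x}-P^{-1}\mathbf{u}_0)_i,t;p_i,a_i,b_i\right)-\tilde\Psi^*(\mathbf{p})\right\}.$$ For $t>0$ the maximizer $\mathbf{p}^*=(p_1^*,\dots,p_n^* )$ exists and is unique; with $\mathbf{y}=P^{-1}(\mathbf{x}-\mathbf{u}_0)$ put $$\boldsymbol\gamma_\Psi(s;\mathbf{x},t)=P\left(\gamma(s;y_1,t,p_1^*,a_1,b_1),\dots,\gamma(s;y_n,t,p_n^*,a_n,b_n)\right)^T+\mathbf{u}_0,\quad s\in[0,t].$$ Other notation. The Legendre-Fenchel transform is $g^*(\mathbf{p})=\sup_{\mathbf{x}}\{\langle\mathbf{p},\mathbf{x}\rangle-g(\mathbf{x})\}\in\mathbb{R}\cup\{+\infty\}$. $\|\cdot\|$ and $\langle\cdot,\cdot\rangle$ are the Euclidean norm and inner product; $\|\mathbf{v}\|_M=\sqrt{\langle\mathbf{v},M\mathbf{v}\rangle}$ and $\|\mathbf{v}\|_{M^{-1}}=\sqrt{\langle\mathbf{v},M^{-1}\mathbf{v}\rangle}$. $\mathrm{co}\,E$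 is the convex hull of $E$. A function $g$ is 1-homogeneous if $g(\lambda\mathbf{x})=\lambda g(\mathbf{x})$ for all $\lambda\geq 0$. $(\mathbf{v})_i$ is the $i$-th component of $\mathbf{v}$. $B_R(\mathbb{R}^n)$ is the closed ball with center $\mathbf{0}$ and radius $R$. $D_{\mathbf{x}}^-W(\mathbf{x},t)$ is the (Fréchet/viscosity) subdifferential of $\mathbf{y}\mapsto W(\mathbf{y},t)$ at $\mathbf{y}=\mathbf{x}$. "Viscosity solution" has the standard (Crandall-Lions) meaning, together with the initial condition. An optimal trajectory is an admissible trajectory attaining the infimum. *)

theory Defs
  imports "HOL-Analysis.Analysis"
begin

definition Omega1 :: "real \<Rightarrow> real \<Rightarrow> (real \<times> real \<times> real) set" where
  "Omega1 a b = {(x, t, p). 0 \<le> t \<and> 0 \<le> p \<and> x \<ge> p * t + a/2 * t^2}"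

definition Omega2 :: "real \<Rightarrow> real \<Rightarrow> (real \<times> real \<times> real) set" where
  "Omega2 a b = {(x, t, p). 0 \<le> t \<and> 0 \<le> p \<and>
     ((x < 0 \<and> t < p/b) \<or> (x < - (b/2) * (t - p/b)^2 \<and> t \<ge> p/b))}"

definition Omega3 :: "real \<Rightarrow> real \<Rightarrow> (real \<times> real \<times> real) set" where
  "Omega3 a b = {(x, t, p). 0 \<le> t \<and> 0 \<le> p \<and>
     ((0 \<le> x \<and> x < p * t + a/2 * t^2 \<and> t < p/b) \<or>
      (a/2 * (t - p/b)^2 \<le> x \<and> x < p * t + a/2 * t^2 \<and> t \<ge> p/b))}"

definition Omega4 :: "real \<Rightarrow> real \<Rightarrow> (real \<times> real \<times> real) set" where
  "Omega4 a b = {(x, t, p). 0 \<le> t \<and> 0 \<le> p \<and>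
     0 \<le> x \<and> x < a/2 * (t - p/b)^2 \<and> t \<ge> p/b}"

definition Omega5 :: "real \<Rightarrow> real \<Rightarrow> (real \<times> real \<times> real) set" where
  "Omega5 a b = {(x, t, p). 0 \<le> t \<and> 0 \<le> p \<and>
     - (b/2) * (t - p/b)^2 \<le> x \<and> x < 0 \<and> t \<ge> p/b}"

text \<open>The following two lemmas make the case distinctions below independent of their order.\<close>

lemma Omega_cover:
  assumes "0 < a" "0 < b"
  shows "Omega1 a b \<union> Omega2 a b \<union> Omega3 a b \<union> Omega4 a b \<union> Omega5 a b
         = UNIV \<times> {0..} \<times> {0..}"
  by (auto simp: Omega1_def Omega2_def Omega3_def Omega4_def Omega5_def)

lemma Omega_disjoint:
  assumes "0 < a" "0 < b"
  shows "disjoint_family_on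
    (\<lambda>i. [Omega1 a b, Omega2 a b, Omega3 a b, Omega4 a b, Omega5 a b] ! i) {..<5}"
proof -
  have *: "p * t + a/2 * t^2 \<ge> a/2 * (t - p/b)^2" if "0 \<le> p" "p / b \<le> t" for p t :: real
  proof -
    have "0 \<le> p / b" using that assms by simp
    hence "0 \<le> t" using that by linarith
    have "(t - p/b)^2 \<le> t^2"
      using \<open>0 \<le> p / b\<close> that by (intro power_mono) auto
    hence "a/2 * (t - p/b)^2 \<le> a/2 * t^2" using assms by (intro mult_left_mono) auto
    moreover have "0 \<le> p * t" using that \<open>0 \<le> t\<close> by simp
    ultimately show ?thesis by linarith
  qed
  have ge0: "p * t + a/2 * t^2 \<ge> 0" if "0 \<le> p" "0 \<le> t" for p t :: real
    using that assms by simp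
  have ge0a: "0 \<le> a/2 * s^2" and ge0b: "0 \<le> b/2 * s^2" for s :: real
    using assms by simp_all
  have disj: "A \<inter> B = {}" if "\<And>x t p. (x, t, p) \<in> A \<Longrightarrow> (x, t, p) \<in> B \<Longrightarrow> False"
    for A B :: "(real \<times> real \<times> real) set"
    using that by auto
  have 12: "Omega1 a b \<inter> Omega2 a b = {}"
  proof (rule disj)
    fix x t p assume "(x, t, p) \<in> Omega1 a b" "(x, t, p) \<in> Omega2 a b"
    thus False using *[of p t] ge0[of p t] ge0a[of "t - p/b"] ge0b[of "t - p/b"]
      unfolding Omega1_def Omega2_def mem_Collect_eq prod.case by linarith
  qed
  have 13: "Omega1 a b \<inter> Omega3 a b = {}"
  proof (rule disj)
    fix x t p assume "(x, t, p) \<in> Omega1 a b" "(x, t, p) \<in> Omega3 a b"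
    thus False using *[of p t] ge0[of p t] ge0a[of "t - p/b"] ge0b[of "t - p/b"]
      unfolding Omega1_def Omega3_def mem_Collect_eq prod.case by linarith
  qed
  have 14: "Omega1 a b \<inter> Omega4 a b = {}"
  proof (rule disj)
    fix x t p assume "(x, t, p) \<in> Omega1 a b" "(x, t, p) \<in> Omega4 a b"
    thus False using *[of p t] ge0[of p t] ge0a[of "t - p/b"] ge0b[of "t - p/b"]
      unfolding Omega1_def Omega4_def mem_Collect_eq prod.case by linarith
  qed
  have 15: "Omega1 a b \<inter> Omega5 a b = {}"
  proof (rule disj)
    fix x t p assume "(x, t, p) \<in> Omega1 a b" "(x, t, p) \<in> Omega5 a b"
    thus False using *[of p t] ge0[of p t] ge0a[of "t - p/b"] ge0b[of "t - p/b"]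
      unfolding Omega1_def Omega5_def mem_Collect_eq prod.case by linarith
  qed
  have 23: "Omega2 a b \<inter> Omega3 a b = {}"
  proof (rule disj)
    fix x t p assume "(x, t, p) \<in> Omega2 a b" "(x, t, p) \<in> Omega3 a b"
    thus False using *[of p t] ge0[of p t] ge0a[of "t - p/b"] ge0b[of "t - p/b"]
      unfolding Omega2_def Omega3_def mem_Collect_eq prod.case by linarith
  qed
  have 24: "Omega2 a b \<inter> Omega4 a b = {}"
  proof (rule disj)
    fix x t p assume "(x, t, p) \<in> Omega2 a b" "(x, t, p) \<in> Omega4 a b"
    thus False using *[of p t] ge0[of p t] ge0a[of "t - p/b"] ge0b[of "t - p/b"]
      unfolding Omega2_def Omega4_def mem_Collect_eq prod.case by linarith
  qed
  have 25: "Omega2 a b \<inter> Omega5 a b = {}"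
  proof (rule disj)
    fix x t p assume "(x, t, p) \<in> Omega2 a b" "(x, t, p) \<in> Omega5 a b"
    thus False using *[of p t] ge0[of p t] ge0a[of "t - p/b"] ge0b[of "t - p/b"]
      unfolding Omega2_def Omega5_def mem_Collect_eq prod.case by linarith
  qed
  have 34: "Omega3 a b \<inter> Omega4 a b = {}"
  proof (rule disj)
    fix x t p assume "(x, t, p) \<in> Omega3 a b" "(x, t, p) \<in> Omega4 a b"
    thus False using *[of p t] ge0[of p t] ge0a[of "t - p/b"] ge0b[of "t - p/b"]
      unfolding Omega3_def Omega4_def mem_Collect_eq prod.case by linarith
  qed
  have 35: "Omega3 a b \<inter> Omega5 a b = {}"
  proof (rule disj)
    fix x t p assume "(x, t, p) \<in> Omega3 a b" "(x, t, p) \<in> Omega5 a b"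
    thus False using *[of p t] ge0[of p t] ge0a[of "t - p/b"] ge0b[of "t - p/b"]
      unfolding Omega3_def Omega5_def mem_Collect_eq prod.case by linarith
  qed
  have 45: "Omega4 a b \<inter> Omega5 a b = {}"
  proof (rule disj)
    fix x t p assume "(x, t, p) \<in> Omega4 a b" "(x, t, p) \<in> Omega5 a b"
    thus False using *[of p t] ge0[of p t] ge0a[of "t - p/b"] ge0b[of "t - p/b"]
      unfolding Omega4_def Omega5_def mem_Collect_eq prod.case by linarith
  qed
  note d = 12 13 14 15 23 24 25 34 35 45
  have five: "{..<5} = {0, 1, 2, 3, 4::nat}" by auto
  show ?thesis
    unfolding disjoint_family_on_def five
    using d by (simp add: Int_commute)
qed

definition f1 :: "real \<Rightarrow> real \<Rightarrow> real \<Rightarrow> real \<Rightarrow> real \<Rightarrow> real" where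
  "f1 x t p a b = - (a^2/6) * t^3 - a/2 * p * t^2 + a * t * x - 1/2 * p^2 * t + p * x"

definition f2 :: "real \<Rightarrow> real \<Rightarrow> real \<Rightarrow> real \<Rightarrow> real \<Rightarrow> real" where
  "f2 x t p a b = - (b^2/6) * t^3 + b/2 * p * t^2 - 1/2 * p^2 * t + p * x - b * t * x"

definition f3 :: "real \<Rightarrow> real \<Rightarrow> real \<Rightarrow> real \<Rightarrow> real \<Rightarrow> real" where
  "f3 x t p a b =
     (a + b) / (3 * (a + 2*b)^2) *
       ((b * t - p)^3 + ((b * t - p)^2 + 2 * x * (a + 2*b)) powr (3/2))
     - b / (a + 2*b) * (b * t - p) * x - b^2/6 * t^3 + b/2 * p * t^2 - 1/2 * p^2 * t"

definition f4 :: "real \<Rightarrow> real \<Rightarrow> real \<Rightarrow> real \<Rightarrow> real \<Rightarrow> real" where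
  "f4 x t p a b = a^2/3 * (2 * x / a) powr (3/2) - p^3 / (6*b)"

definition f5 :: "real \<Rightarrow> real \<Rightarrow> real \<Rightarrow> real \<Rightarrow> real \<Rightarrow> real" where
  "f5 x t p a b = b^2/3 * (- 2 * x / b) powr (3/2) - p^3 / (6*b)"

definition V1_nonneg :: "real \<Rightarrow> real \<Rightarrow> real \<Rightarrow> real \<Rightarrow> real \<Rightarrow> real" where
  "V1_nonneg x t p a b =
    (if (x, t, p) \<in> Omega1 a b then f1 x t p a b
     else if (x, t, p) \<in> Omega2 a b then f2 x t p a b
     else if (x, t, p) \<in> Omega3 a b then f3 x t p a b
     else if (x, t, p) \<in> Omega4 a b then f4 x t p a b
     else f5 x t p a b)"

definition V1 :: "real \<Rightarrow> real \<Rightarrow> real \<Rightarrow> real \<Rightarrow> real \<Rightarrow> real" where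
  "V1 x t p a b = (if p \<ge> 0 then V1_nonneg x t p a b else V1_nonneg (- x) t (- p) b a)"

definition gamma1_nonneg :: "real \<Rightarrow> real \<Rightarrow> real \<Rightarrow> real \<Rightarrow> real \<Rightarrow> real \<Rightarrow> real" where
  "gamma1_nonneg s x t p a b =
    (if (x, t, p) \<in> Omega1 a b then x - p * (t - s) - a/2 * (t^2 - s^2)
     else if (x, t, p) \<in> Omega2 a b then x - p * (t - s) + b/2 * (t^2 - s^2)
     else if (x, t, p) \<in> Omega3 a b then
       (let \<tau> = ((a + b) * t + p - sqrt ((b * t - p)^2 + 2 * (2*b + a) * x)) / (2*b + a)
        in if s < \<tau> then - p * (\<tau> - s) + b/2 * (\<tau>^2 - s^2)
           else (p - b * \<tau>) * (s - \<tau>) + a/2 * (s - \<tau>)^2)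
     else if (x, t, p) \<in> Omega4 a b then
       (if s < p/b then - (1 / (2*b)) * (p - b * s)^2
        else if s < t - sqrt (2 * x / a) then 0
        else a/2 * (s - t + sqrt (2 * x / a))^2)
     else
       (if s < p/b then - (1 / (2*b)) * (p - b * s)^2
        else if s < t - sqrt (2 * \<bar>x\<bar> / b) then 0
        else - (b/2) * (s - t + sqrt (2 * \<bar>x\<bar> / b))^2))"

definition gamma1 :: "real \<Rightarrow> real \<Rightarrow> real \<Rightarrow> real \<Rightarrow> real \<Rightarrow> real \<Rightarrow> real" where
  "gamma1 s x t p a b =
    (if p \<ge> 0 then gamma1_nonneg s x t p a b else - gamma1_nonneg s (- x) t (- p) b a)"

definition legendre :: "('a::real_inner \<Rightarrow> real) \<Rightarrow> 'a \<Rightarrow> ereal" where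
  "legendre g p = (SUP x. ereal (p \<bullet> x - g x))"

definition Psi_tilde :: "real^'n^'n \<Rightarrow> real^'n \<Rightarrow> (real^'n \<Rightarrow> real) \<Rightarrow> real^'n \<Rightarrow> real" where
  "Psi_tilde P u0 \<Psi> y = \<Psi> (P *v y + u0)"

text \<open>The Legendre transform of a real-valued function never takes the value \<open>-\<infinity>\<close>, so the
  difference below is never of the form \<open>\<infinity> - \<infinity>\<close>. The supremum is taken in the extended reals.\<close>

definition V_objective :: "real^'n^'n \<Rightarrow> real^'n \<Rightarrow> real^'n \<Rightarrow> real^'n \<Rightarrow> (real^'n \<Rightarrow> real) \<Rightarrow>
    real^'n \<Rightarrow> real \<Rightarrow> real^'n \<Rightarrow> ereal" where
  "V_objective P u0 a b \<Psi> x t p =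
     ereal (\<Sum>i\<in>UNIV. V1 ((matrix_inv P *v x - matrix_inv P *v u0) $ i) t (p $ i) (a $ i) (b $ i))
     - legendre (Psi_tilde P u0 \<Psi>) p"

definition V_Psi :: "real^'n^'n \<Rightarrow> real^'n \<Rightarrow> real^'n \<Rightarrow> real^'n \<Rightarrow> (real^'n \<Rightarrow> real) \<Rightarrow>
    real^'n \<Rightarrow> real \<Rightarrow> ereal" where
  "V_Psi P u0 a b \<Psi> x t = (SUP p. V_objective P u0 a b \<Psi> x t p)"

definition p_star :: "real^'n^'n \<Rightarrow> real^'n \<Rightarrow> real^'n \<Rightarrow> real^'n \<Rightarrow> (real^'n \<Rightarrow> real) \<Rightarrow>
    real^'n \<Rightarrow> real \<Rightarrow> real^'n" where
  "p_star P u0 a b \<Psi> x t = (THE p. V_objective P u0 a b \<Psi> x t p = V_Psi P u0 a b \<Psi> x t)"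

definition gamma_Psi :: "real^'n^'n \<Rightarrow> real^'n \<Rightarrow> real^'n \<Rightarrow> real^'n \<Rightarrow> (real^'n \<Rightarrow> real) \<Rightarrow>
    real \<Rightarrow> real^'n \<Rightarrow> real \<Rightarrow> real^'n" where
  "gamma_Psi P u0 a b \<Psi> s x t =
     P *v (\<chi> i. gamma1 s ((matrix_inv P *v (x - u0)) $ i) t
                    (p_star P u0 a b \<Psi> x t $ i) (a $ i) (b $ i)) + u0"

definition piecewise_affine :: "('a::euclidean_space \<Rightarrow> real) \<Rightarrow> bool" where
  "piecewise_affine f \<longleftrightarrow>
     (\<exists>\<S>. finite \<S> \<and> \<Union>\<S> = UNIV \<and>
        (\<forall>S\<in>\<S>. polyhedron S \<and> (\<exists>c d. \<forall>x\<in>S. f x = c \<bullet> x + d)))"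

definition one_homogeneous :: "('a::real_vector \<Rightarrow> real) \<Rightarrow> bool" where
  "one_homogeneous g \<longleftrightarrow> (\<forall>l\<ge>0. \<forall>x. g (l *\<^sub>R x) = l * g x)"

text \<open>Here \<open>0 powr 0 = 0\<close>, whereas the usual convention is \<open>1\<close>; as the constant \<open>C\<close> is
  existentially quantified, this makes no difference.\<close>

definition poly_growth_lipschitz :: "('a::real_normed_vector \<Rightarrow> real) \<Rightarrow> bool" where
  "poly_growth_lipschitz g \<longleftrightarrow>
     (\<exists>C\<ge>0. \<exists>\<delta>\<ge>0. \<forall>x y.
        \<bar>g x - g y\<bar> \<le> C * norm (x - y) * (1 + norm x powr \<delta> + norm y powr \<delta>))"

definition matrix_norm :: "real^'n^'n \<Rightarrow> real^'n \<Rightarrow> real" where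
  "matrix_norm M v = sqrt (v \<bullet> (M *v v))"

text \<open>A function of \<open>(x, t)\<close> with \<open>t \<ge> 0\<close> is a total curried function whose values at negative
  times are never used.\<close>

definition C1_test :: "('a::euclidean_space \<times> real \<Rightarrow> real) \<Rightarrow> ('a \<times> real \<Rightarrow> 'a \<times> real) \<Rightarrow> bool"
  where
  "C1_test \<phi> D\<phi> \<longleftrightarrow>
     (\<forall>z\<in>UNIV \<times> {0<..}. GDERIV \<phi> z :> D\<phi> z) \<and> continuous_on (UNIV \<times> {0<..}) D\<phi>"

definition viscosity_subsolution ::
    "('a::euclidean_space \<Rightarrow> 'a \<Rightarrow> real) \<Rightarrow> ('a \<Rightarrow> real \<Rightarrow> real) \<Rightarrow> bool" where
  "viscosity_subsolution H W \<longleftrightarrow>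
     (\<forall>\<phi> D\<phi> x t. C1_test \<phi> D\<phi> \<and> 0 < t \<and>
        (\<forall>\<^sub>F (y, s) in nhds (x, t). W y s - \<phi> (y, s) \<le> W x t - \<phi> (x, t))
        \<longrightarrow> snd (D\<phi> (x, t)) + H x (fst (D\<phi> (x, t))) \<le> 0)"

definition viscosity_supersolution ::
    "('a::euclidean_space \<Rightarrow> 'a \<Rightarrow> real) \<Rightarrow> ('a \<Rightarrow> real \<Rightarrow> real) \<Rightarrow> bool" where
  "viscosity_supersolution H W \<longleftrightarrow>
     (\<forall>\<phi> D\<phi> x t. C1_test \<phi> D\<phi> \<and> 0 < t \<and>
        (\<forall>\<^sub>F (y, s) in nhds (x, t). W y s - \<phi> (y, s) \<ge> W x t - \<phi> (x, t))
        \<longrightarrow> snd (D\<phi> (x, t)) + H x (fst (D\<phi> (x, t))) \<ge> 0)"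

definition viscosity_solution_ivp ::
    "('a::euclidean_space \<Rightarrow> 'a \<Rightarrow> real) \<Rightarrow> ('a \<Rightarrow> real) \<Rightarrow> ('a \<Rightarrow> real \<Rightarrow> real) \<Rightarrow> bool" where
  "viscosity_solution_ivp H \<Phi> W \<longleftrightarrow>
     continuous_on (UNIV \<times> {0..}) (\<lambda>(x, t). W x t) \<and>
     viscosity_subsolution H W \<and> viscosity_supersolution H W \<and>
     (\<forall>x. W x 0 = \<Phi> x)"

definition frechet_subdifferential :: "('a::euclidean_space \<Rightarrow> real) \<Rightarrow> 'a \<Rightarrow> 'a set" where
  "frechet_subdifferential f x =
     {q. 0 \<le> Liminf (at x) (\<lambda>y. ereal ((f y - f x - q \<bullet> (y - x)) / norm (y - x)))}"

definition local_norm :: "real \<Rightarrow> ('a::euclidean_space \<Rightarrow> real \<Rightarrow> real) \<Rightarrow> ereal" where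
  "local_norm R W =
     Sup {ereal (\<bar>W x t\<bar> + norm q) | x t q.
            x \<in> cball 0 R \<and> t \<in> {0..R} \<and> q \<in> frechet_subdifferential (\<lambda>y. W y t) x}"

definition class_G :: "('a::euclidean_space \<Rightarrow> real \<Rightarrow> real) set" where
  "class_G =
     {W. continuous_on (UNIV \<times> {0..}) (\<lambda>(x, t). W x t) \<and>
         (\<forall>R>0. local_norm R W < \<infinity>) \<and>
         (\<exists>\<alpha>. \<forall>T>0. \<exists>C. \<forall>x. \<forall>t\<in>{0..T}. W x t - \<alpha> \<bullet> x \<ge> C)}"

definition admissible :: "'a::euclidean_space \<Rightarrow> real \<Rightarrow> (real \<Rightarrow> 'a) set" where
  "admissible x t = {X. (\<exists>L. L-lipschitz_on {0..t} X) \<and> X t = x}"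

text \<open>A Lipschitz curve is differentiable almost everywhere with bounded derivative, so the
  integrand is bounded and measurable up to a null set, on which its value is immaterial.\<close>

definition control_cost :: "real^'n^'n \<Rightarrow> (real^'n \<Rightarrow> real) \<Rightarrow> (real^'n \<Rightarrow> real) \<Rightarrow> real \<Rightarrow>
    (real \<Rightarrow> real^'n) \<Rightarrow> real" where
  "control_cost M U \<Phi> t X =
     integral {0..t} (\<lambda>s. 1/2 * (matrix_norm (matrix_inv M)
                            (vector_derivative X (at s within {0..t})))^2 - U (X s))
     + \<Phi> (X 0)"

definition optimal_value :: "real^'n^'n \<Rightarrow> (real^'n \<Rightarrow> real) \<Rightarrow> (real^'n \<Rightarrow> real) \<Rightarrow>
    real^'n \<Rightarrow> real \<Rightarrow> ereal" where
  "optimal_value M U \<Phi> x t = (INF X\<in>admissible x t. ereal (control_cost M U \<Phi> t X))"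

definition optimal_trajectory :: "real^'n^'n \<Rightarrow> (real^'n \<Rightarrow> real) \<Rightarrow> (real^'n \<Rightarrow> real) \<Rightarrow>
    real^'n \<Rightarrow> real \<Rightarrow> (real \<Rightarrow> real^'n) \<Rightarrow> bool" where
  "optimal_trajectory M U \<Phi> x t X \<longleftrightarrow>
     X \<in> admissible x t \<and> ereal (control_cost M U \<Phi> t X) = optimal_value M U \<Phi> x t"

end

theory Submission
  imports Defs
begin

text \<open>In the coordinates \<open>y = P\<^sup>-\<^sup>1(x - u\<^sub>0)\<close> the running cost splits into the one-dimensional costs
  \<open>v\<^sup>2/2 + g(y)\<close> with \<open>g(y) = a max(y, 0) + b max(-y, 0)\<close>. If \<open>w\<close> has slopes in \<open>[-b, a]\<close>, the subdifferential
  of \<open>g\<close> at \<open>0\<close>, then \<open>w(t) y - 1/2 \<integral>\<^sub>0\<^sup>t w\<^sup>2\<close> is a subsolution that is affine in \<open>y\<close>, hence a lower bound for the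
  cost with initial cost \<open>w(0) y\<close>; the bound is attained exactly when \<open>w\<close> is the velocity of the curve and
  \<open>w' y = g(y)\<close> along it, which is how the explicit trajectories arise. A convex initial cost \<open>\<Psi>\<close> is dealt with by
  minimising over the starting point, where the velocity of the optimal curve is a subgradient of \<open>\<Psi>\<close>: this is
  the unique maximising \<open>p\<close>. The minimum over the finitely many \<open>\<Psi> = \<Phi>\<^sub>j\<close> is the value function, and it inherits
  regularity and the viscosity property from the dynamic programming principle along \<open>C\<^sup>1\<close> optimal curves.

  For uniqueness, a subsolution is dominated by the cost of the optimal curves. A supersolution dominates the
  soft minima of the affine subsolutions above, which are \<open>C\<^sup>1\<close> once \<open>w\<close> is smoothed and have bounded gradient, so that
  an affine lower bound suffices for comparison; their supremum is the value function.\<close>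

section \<open>Lipschitz curves\<close>

text \<open>The infimum runs over all Lipschitz curves, so the lower bound needs the fundamental
  theorem of calculus for curves that are differentiable only almost everywhere; it comes from the
  Radon-Nikodym theorem. The formulas \<open>f1\<close> to \<open>f5\<close> are verified as the
  values w(t) x - 1/2 \<integral> w^2 of explicit extremals, not as solutions of the PDE. In each
  coordinate the starting point of the extremal is a decreasing bijective function of its initial
  velocity. Hence the least cost from z to x is convex in z, and its sum with a convex initial cost
  has a minimiser at which the supremum over p is attained without a gap. A minimum over j does not
  commute with a supremum over p, so the lower estimate of a competing solution W combines one
  certificate for each j. The class \<open>class_G\<close> bounds W from below only: the upper
  estimate of W is therefore local, in a thin compact tube around a single curve, whereas the lower
  estimate is global and uses functions of linear growth, which a small quadratic perturbation
  dominates.\<close>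

lemma lipschitz_shift_bij:
  fixes f :: "real \<Rightarrow> real"
  assumes f: "L-lipschitz_on UNIV f"
  shows "bij (\<lambda>x. f x + (L + 1) * x)" "strict_mono (\<lambda>x. f x + (L + 1) * x)"
    "continuous_on UNIV (\<lambda>x. f x + (L + 1) * x)"
proof -
  let ?G = "\<lambda>x. f x + (L + 1) * x"
  have lip: "\<bar>f x - f y\<bar> \<le> L * \<bar>x - y\<bar>" for x y
    using lipschitz_onD[OF f, of x y] by (simp add: dist_real_def)
  \<comment> \<open>The slopes of \<open>f\<close> are at least -L, so those of the shifted map are
    at least 1. This gives strict monotonicity and, by the intermediate value theorem,
    surjectivity.\<close>
  have gr: "?G y - ?G x \<ge> y - x" if "x \<le> y" for x y
  proof -
    have "\<bar>f x - f y\<bar> \<le> L * (y - x)" using lip[of x y] that by simp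
    then have "f x - f y \<le> L * (y - x)" by linarith
    moreover have "(L + 1) * y - (L + 1) * x = L * (y - x) + (y - x)" by algebra
    ultimately show ?thesis by linarith
  qed
  show sm: "strict_mono ?G"
  proof (rule strict_monoI)
    fix x y :: real assume "x < y"
    then show "?G x < ?G y" using gr[of x y] by linarith
  qed
  show c: "continuous_on UNIV ?G"
    by (intro continuous_intros lipschitz_on_continuous_on[OF f])
  have "surj ?G"
  proof (unfold surj_def, intro allI)
    fix y
    let ?r = "\<bar>y - ?G 0\<bar>"
    have "?G (- ?r) \<le> y" "y \<le> ?G ?r"
      using gr[of "- ?r" 0] gr[of 0 ?r] by (simp_all del: mult_zero_right)
    then obtain x where "?G x = y"
      using IVT'[of ?G "- ?r" y ?r] continuous_on_subset[OF c subset_UNIV] by force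
    then show "\<exists>x. y = ?G x" by auto
  qed
  then show "bij ?G"
    using strict_mono_imp_inj_on[OF sm] by (simp add: bij_def)
qed

text \<open>The map \<open>x \<mapsto> f x + (L + 1) x\<close> is a bi-Lipschitz increasing bijection, so the image of Lebesgue measure
  under its inverse is absolutely continuous.\<close>

lemma lipschitz_shift_density:
  fixes f :: "real \<Rightarrow> real"
  assumes f: "L-lipschitz_on UNIV f"
  obtains h where "\<And>c d. c \<le> d \<Longrightarrow> (h has_integral (f d - f c)) {c..d}"
proof -
  let ?G = "\<lambda>x. f x + (L + 1) * x"
  have L0: "0 \<le> L" using f lipschitz_on_nonneg by blast
  note bG = lipschitz_shift_bij[OF f]
  define I where "I = inv ?G"
  have IG: "I (?G x) = x" "?G (I y) = y" for x y
    unfolding I_def by (rule inv_f_f[OF bij_is_inj[OF bG(1)]], rule surj_f_inv_f[OF bij_is_surj[OF bG(1)]])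
  have mI: "mono I"
  proof (rule monoI, rule ccontr)
    fix x y :: real assume "x \<le> y" "\<not> I x \<le> I y"
    then have "?G (I y) < ?G (I x)" using strict_monoD[OF bG(2), of "I y" "I x"] by simp
    then show False using IG(2) \<open>x \<le> y\<close> by simp
  qed
  have I_meas[measurable]: "I \<in> borel_measurable borel"
    by (rule borel_measurable_mono[OF mI])
  \<comment> \<open>\<open>N\<close> is the Stieltjes measure of the shifted map: the preimage of
    \<open>{c..d}\<close> under its inverse is the interval between the shifted values at c and
    d.\<close>
  define N where "N = distr lborel borel I"
  have vim: "I -` A = ?G ` A" for A :: "real set"
    using IG by (auto simp: image_iff) metis+
  have ac: "absolutely_continuous lborel N"
    unfolding absolutely_continuous_def
  proof
    fix A :: "real set" assume A: "A \<in> null_sets lborel"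
    then have "negligible A" by (simp add: negligible_iff_null_sets null_sets_completionI)
    then have "negligible (?G ` A)"
    proof (rule negligible_locally_Lipschitz_image[rotated])
      fix x assume "x \<in> A"
      have "\<bar>?G y - ?G x\<bar> \<le> (2 * L + 1) * \<bar>y - x\<bar>" for y
      proof -
        have "\<bar>?G y - ?G x\<bar> = \<bar>(f y - f x) + (L + 1) * (y - x)\<bar>"
          by (simp add: right_diff_distrib)
        also have "\<dots> \<le> \<bar>f y - f x\<bar> + \<bar>(L + 1) * (y - x)\<bar>" by (rule abs_triangle_ineq)
        also have "\<dots> \<le> L * \<bar>y - x\<bar> + (L + 1) * \<bar>y - x\<bar>"
          using lipschitz_onD[OF f, of y x] L0 by (simp add: dist_real_def abs_mult)
        also have "\<dots> = (2 * L + 1) * \<bar>y - x\<bar>" by algebra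
        finally show ?thesis .
      qed
      then show "\<exists>T B. open T \<and> x \<in> T \<and> (\<forall>y\<in>A \<inter> T. norm (?G y - ?G x) \<le> B * norm (y - x))"
        by (intro exI[of _ UNIV] exI[of _ "2 * L + 1"]) auto
    qed simp
    then have "I -` A \<in> null_sets lebesgue"
      by (simp add: vim negligible_iff_null_sets)
    moreover have "I -` A \<in> sets lborel"
      using measurable_sets[OF I_meas, of A] A by auto
    ultimately have "emeasure lborel (I -` A) = 0"
      using null_sets_completion_iff null_setsD1 by blast
    then show "A \<in> null_sets N"
      using A unfolding N_def null_sets_def by (simp add: emeasure_distr)
  qed
  obtain h' where h'[measurable]: "h' \<in> borel_measurable lborel" and dens: "density lborel h' = N"
    using sigma_finite_measure.Radon_Nikodym[OF sigma_finite_lborel ac] by (auto simp: N_def)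
  have nn: "(\<integral>\<^sup>+x. h' x * indicator {c..d} x \<partial>lborel) = ennreal (?G d - ?G c)" if "c \<le> d" for c d
  proof -
    have "(\<integral>\<^sup>+x. h' x * indicator {c..d} x \<partial>lborel) = emeasure N {c..d}"
      by (subst dens[symmetric], subst emeasure_density) auto
    also have "\<dots> = emeasure lborel (I -` {c..d})"
      unfolding N_def by (subst emeasure_distr) auto
    also have "I -` {c..d} = {?G c..?G d}"
    proof -
      have "c \<le> I y \<longleftrightarrow> ?G c \<le> y" "I y \<le> d \<longleftrightarrow> y \<le> ?G d" for y
        using strict_mono_less_eq[OF bG(2), of c "I y"] strict_mono_less_eq[OF bG(2), of "I y" d]
        by (simp_all add: IG)
      then show ?thesis by auto
    qed
    also have "emeasure lborel {?G c..?G d} = ennreal (?G d - ?G c)"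
      using strict_mono_less_eq[OF bG(2), of c d] that by simp
    finally show ?thesis .
  qed
  define h where "h x = enn2real (h' x) - (L + 1)" for x
  show thesis
  proof (rule that[of h])
    fix c d :: real assume cd: "c \<le> d"
    \<comment> \<open>The \<open>ennreal\<close>-valued density has a finite integral over
      \<open>{c..d}\<close>, hence is finite almost everywhere there and may be replaced by a
      real-valued one. Subtracting L + 1 undoes the shift.\<close>
    have "AE x in lborel. h' x * indicator {c..d} x \<noteq> \<infinity>"
      by (rule nn_integral_PInf_AE) (use nn[OF cd] in auto)
    then have "(\<integral>\<^sup>+x. ennreal (enn2real (h' x) * indicator {c..d} x) \<partial>lborel)
        = (\<integral>\<^sup>+x. h' x * indicator {c..d} x \<partial>lborel)"
      by (intro nn_integral_cong_AE) (auto simp: indicator_def less_top)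
    then have "((\<lambda>x. enn2real (h' x) * indicator {c..d} x) has_integral (?G d - ?G c)) UNIV"
      using strict_mono_less_eq[OF bG(2), of c d] cd
      by (intro nn_integral_has_integral) (auto simp: nn[OF cd])
    then have "((\<lambda>x. enn2real (h' x)) has_integral (?G d - ?G c)) {c..d}"
      by (subst has_integral_restrict_UNIV[symmetric])
        (auto elim!: has_integral_eq[rotated] simp: indicator_def if_distrib cong: if_cong)
    from has_integral_diff[OF this has_integral_const_real[of "L + 1" c d]]
    show "(h has_integral (f d - f c)) {c..d}"
      using cd unfolding h_def by (simp add: algebra_simps)
  qed
qed

text \<open>The library provides right derivatives of indefinite integrals; reflection gives the left ones.\<close>

lemma has_integral_imp_deriv_ae:
  fixes f h :: "real \<Rightarrow> real"
  assumes h: "\<And>c d. c \<le> d \<Longrightarrow> (h has_integral (f d - f c)) {c..d}"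
  obtains N where "negligible N" "\<And>x. x \<notin> N \<Longrightarrow> (f has_real_derivative h x) (at x)"
proof -
  have int: "h integrable_on cbox c d" for c d
  proof (cases "c \<le> d")
    case True then show ?thesis using h[of c d] by (auto simp: integrable_on_def)
  next
    case False then have "cbox c d = {}" by simp then show ?thesis by (metis integrable_on_empty)
  qed
  have int': "(\<lambda>x. h (- x)) integrable_on cbox c d" for c d
    using int[of "-d" "-c"] by (simp add: integrable_on_def) (metis has_integral_reflect_real minus_minus)
  have intv: "integral {c..c + e} h = f (c + e) - f c" if "e > 0" for c e
    using h[of c "c+e"] that by (simp add: integral_unique)
  have intv': "integral {c..c + e} (\<lambda>x. h (- x)) = f (- c) - f (- c - e)" if "e > 0" for c e
  proof -
    have "((\<lambda>x. h (- x)) has_integral (f (- c) - f (- c - e))) {c..c + e}"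
      using h[of "- c - e" "- c"] that has_integral_reflect_real[of h "f (- c) - f (- c - e)" "- c" "- c - e"]
      by (simp add: algebra_simps)
    then show ?thesis by (simp add: integral_unique)
  qed
  obtain N1 where N1: "negligible N1" "\<And>x e. \<lbrakk>x \<notin> N1; 0 < e\<rbrakk> \<Longrightarrow>
      \<exists>d>0. \<forall>k. 0 < k \<and> k < d \<longrightarrow> norm(integral (cbox x (x + k *\<^sub>R One)) h /\<^sub>R k ^ DIM(real) - h x) < e"
    using integrable_ccontinuous_explicit[of h, OF int] by blast
  obtain N2 where N2: "negligible N2" "\<And>x e. \<lbrakk>x \<notin> N2; 0 < e\<rbrakk> \<Longrightarrow>
      \<exists>d>0. \<forall>k. 0 < k \<and> k < d \<longrightarrow> norm(integral (cbox x (x + k *\<^sub>R One)) (\<lambda>x. h (- x)) /\<^sub>R k ^ DIM(real) - h (- x)) < e"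
    using integrable_ccontinuous_explicit[of "\<lambda>x. h (- x)", OF int'] by blast
  have neg: "negligible (N1 \<union> uminus ` N2)"
    using N1(1) negligible_differentiable_image_negligible[OF order_refl N2(1), of uminus]
    by (auto intro: differentiable_on_minus differentiable_on_ident)
  show thesis
  proof (rule that[OF neg])
    fix x assume "x \<notin> N1 \<union> uminus ` N2"
    then have x: "x \<notin> N1" "- x \<notin> N2" by (auto simp: image_iff)
    have "((\<lambda>y. (f (x + y) - f x) / y) \<longlongrightarrow> h x) (at 0)"
      unfolding LIM_def
    proof (intro allI impI)
      fix e :: real assume e: "e > 0"
      obtain d1 where d1: "d1 > 0" "\<And>k. 0 < k \<Longrightarrow> k < d1 \<Longrightarrow> \<bar>(f (x + k) - f x) / k - h x\<bar> < e"
        using N1(2)[OF x(1) e] by (auto simp: intv divide_simps)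
      obtain d2 where d2: "d2 > 0" "\<And>k. 0 < k \<Longrightarrow> k < d2 \<Longrightarrow> \<bar>(f x - f (x - k)) / k - h x\<bar> < e"
        using N2(2)[OF x(2) e] by (auto simp: intv'[of _ "- x", simplified] divide_simps)
      have "\<bar>(f (x + y) - f x) / y - h x\<bar> < e" if "y \<noteq> 0" "\<bar>y\<bar> < min d1 d2" for y
      proof (cases "y > 0")
        case True then show ?thesis using d1(2)[of y] that by simp
      next
        case False
        have "(f (x + y) - f x) / y = (f x - f (x - (- y))) / (- y)"
          using that by (simp add: field_simps)
        with False show ?thesis using d2(2)[of "- y"] that by simp
      qed
      then show "\<exists>s>0. \<forall>y. y \<noteq> 0 \<and> dist y 0 < s \<longrightarrow> dist ((f (x + y) - f x) / y) (h x) < e"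
        using d1(1) d2(1) by (intro exI[of _ "min d1 d2"]) (auto simp: dist_real_def)
    qed
    then show "(f has_real_derivative h x) (at x)" by (simp add: DERIV_def)
  qed
qed

text \<open>Projection onto an interval is 1-Lipschitz, so composing with it extends a function to
  the whole line, where the density results above apply, without increasing its Lipschitz
  constant.\<close>

lemma lipschitz_clamp:
  fixes f :: "real \<Rightarrow> 'a::metric_space"
  assumes "L-lipschitz_on {c..d} f" "c \<le> d"
  shows "L-lipschitz_on UNIV (\<lambda>x. f (max c (min d x)))"
proof (rule lipschitz_onI)
  fix x y :: real
  have "dist (f (max c (min d x))) (f (max c (min d y))) \<le> L * dist (max c (min d x)) (max c (min d y))"
    using assms by (intro lipschitz_onD[OF assms(1)]) auto
  also have "\<dots> \<le> L * dist x y"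
    using lipschitz_on_nonneg[OF assms(1)] by (intro mult_left_mono) (auto simp: dist_real_def)
  finally show "dist (f (max c (min d x))) (f (max c (min d y))) \<le> L * dist x y" .
qed (rule lipschitz_on_nonneg[OF assms(1)])

text \<open>The fundamental theorem of calculus for Lipschitz functions: the Radon-Nikodym density
  is at once the integrand and the derivative almost everywhere. It is bounded by L because the
  difference quotients are.\<close>

lemma lipschitz_real_density:
  fixes f :: "real \<Rightarrow> real"
  assumes f: "L-lipschitz_on {c..d} f" and cd: "c \<le> d"
  obtains h N where "\<And>x y. c \<le> x \<Longrightarrow> x \<le> y \<Longrightarrow> y \<le> d \<Longrightarrow> (h has_integral (f y - f x)) {x..y}"
    "negligible N" "\<And>x. x \<in> {c..d} - N \<Longrightarrow> (f has_real_derivative h x) (at x within {c..d})"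
    "\<And>x. x \<in> {c..d} - N \<Longrightarrow> \<bar>h x\<bar> \<le> L"
proof -
  let ?f = "\<lambda>x. f (max c (min d x))"
  note lip = lipschitz_clamp[OF f cd]
  obtain h where h: "\<And>x y. x \<le> y \<Longrightarrow> (h has_integral (?f y - ?f x)) {x..y}"
    using lipschitz_shift_density[OF lip] by blast
  obtain N where N: "negligible N" "\<And>x. x \<notin> N \<Longrightarrow> (?f has_real_derivative h x) (at x)"
    using has_integral_imp_deriv_ae[OF h] by blast
  have N': "negligible (N \<union> {c, d})" using N(1) by simp
  show thesis
  proof (rule that[of h "N \<union> {c, d}"])
    fix x y assume "c \<le> x" "x \<le> y" "y \<le> d"
    then show "(h has_integral (f y - f x)) {x..y}" using h[of x y] by simp
  next
    fix x assume x: "x \<in> {c..d} - (N \<union> {c, d})"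
    have "(?f has_real_derivative h x) (at x within {c..d})"
      using N(2)[of x] x by (simp add: has_field_derivative_at_within)
    then show "(f has_real_derivative h x) (at x within {c..d})"
      by (rule has_field_derivative_transform_within[where d = 1]) (use x in \<open>auto intro!: arg_cong[where f = f]\<close>)
    have d: "((\<lambda>y. (?f (x + y) - ?f x) / y) \<longlongrightarrow> h x) (at 0)"
      using N(2)[of x] x by (simp add: DERIV_def)
    have "\<bar>(?f (x + y) - ?f x) / y\<bar> \<le> L" if "y \<noteq> 0" for y
      using lipschitz_onD[OF lip, of "x + y" x] that by (simp add: dist_real_def abs_divide field_simps)
    then show "\<bar>h x\<bar> \<le> L"
      by (intro tendsto_upperbound[OF tendsto_rabs[OF d]]) (auto simp: eventually_at_filter)
  qed (rule N')
qed

text \<open>The velocity is an argument of its own, prescribed only off a null set, so any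
  representative may be used. The Lipschitz condition excludes curves of Cantor type, which do not
  equal the integral of their derivative.\<close>

definition ac_curve :: "real \<Rightarrow> (real \<Rightarrow> 'a::euclidean_space) \<Rightarrow> (real \<Rightarrow> 'a) \<Rightarrow> bool" where
  "ac_curve t X v \<longleftrightarrow> (\<exists>L. L-lipschitz_on {0..t} X) \<and>
     (\<exists>N. negligible N \<and> (\<forall>s\<in>{0..t} - N. (X has_vector_derivative v s) (at s within {0..t})))"

lemma ac_curveI:
  assumes "L-lipschitz_on {0..t} X" "negligible N"
    "\<And>s. s \<in> {0..t} \<Longrightarrow> s \<notin> N \<Longrightarrow> (X has_vector_derivative v s) (at s within {0..t})"
  shows "ac_curve t X v"
  using assms unfolding ac_curve_def by blast

lemma ac_curve_continuous: "ac_curve t X v \<Longrightarrow> continuous_on {0..t} X"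
  unfolding ac_curve_def using lipschitz_on_continuous_on by blast

lemma ac_curve_linear:
  assumes "ac_curve t X v" "bounded_linear f"
  shows "ac_curve t (\<lambda>s. f (X s)) (\<lambda>s. f (v s))"
proof -
  obtain L N where L: "L-lipschitz_on {0..t} X" and N: "negligible N"
    "\<And>s. s \<in> {0..t} - N \<Longrightarrow> (X has_vector_derivative v s) (at s within {0..t})"
    using assms(1) unfolding ac_curve_def by blast
  obtain C where C: "C-lipschitz_on (X ` {0..t}) f"
    using bounded_linear.lipschitz_boundE[OF assms(2)] by blast
  show ?thesis
    by (rule ac_curveI[OF lipschitz_on_compose2[OF L C] N(1)])
      (use N(2) bounded_linear.has_vector_derivative[OF assms(2)] in blast)
qed

lemma ac_curve_add:
  assumes "ac_curve t X u" "ac_curve t Y v"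
  shows "ac_curve t (\<lambda>s. X s + Y s) (\<lambda>s. u s + v s)"
proof -
  obtain L N where L: "L-lipschitz_on {0..t} X" and N: "negligible N"
    "\<And>s. s \<in> {0..t} - N \<Longrightarrow> (X has_vector_derivative u s) (at s within {0..t})"
    using assms(1) unfolding ac_curve_def by blast
  obtain L' N' where L': "L'-lipschitz_on {0..t} Y" and N': "negligible N'"
    "\<And>s. s \<in> {0..t} - N' \<Longrightarrow> (Y has_vector_derivative v s) (at s within {0..t})"
    using assms(2) unfolding ac_curve_def by blast
  show ?thesis
    by (rule ac_curveI[OF lipschitz_on_add[OF L L'], of "N \<union> N'"])
      (use N N' in \<open>auto intro!: has_vector_derivative_add\<close>)
qed

lemma ac_curve_const: "ac_curve t (\<lambda>s. c) (\<lambda>s. 0)"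
  by (rule ac_curveI[of 0 _ _ "{}"]) (auto simp: lipschitz_on_def)

lemma ac_curve_diff:
  assumes "ac_curve t X u" "ac_curve t Y v"
  shows "ac_curve t (\<lambda>s. X s - Y s) (\<lambda>s. u s - v s)"
  using ac_curve_add[OF assms(1) ac_curve_linear[OF assms(2), of uminus]]
  by (simp add: bounded_linear_minus[OF bounded_linear_ident])

lemma ac_curve_sum:
  assumes "\<And>i. i \<in> I \<Longrightarrow> ac_curve t (X i) (u i)" 
  shows "ac_curve t (\<lambda>s. \<Sum>i\<in>I. X i s) (\<lambda>s. \<Sum>i\<in>I. u i s)"
  using assms by (induction I rule: infinite_finite_induct) (auto intro: ac_curve_add ac_curve_const)

lemma ac_curve_mult:
  fixes X Y :: "real \<Rightarrow> real"
  assumes X: "ac_curve t X u" and Y: "ac_curve t Y v"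
  shows "ac_curve t (\<lambda>s. X s * Y s) (\<lambda>s. u s * Y s + X s * v s)"
proof -
  obtain L N where L: "L-lipschitz_on {0..t} X" and N: "negligible N"
    "\<And>s. s \<in> {0..t} - N \<Longrightarrow> (X has_vector_derivative u s) (at s within {0..t})"
    using assms(1) unfolding ac_curve_def by blast
  obtain L' N' where L': "L'-lipschitz_on {0..t} Y" and N': "negligible N'"
    "\<And>s. s \<in> {0..t} - N' \<Longrightarrow> (Y has_vector_derivative v s) (at s within {0..t})"
    using assms(2) unfolding ac_curve_def by blast
  have "bounded (X ` {0..t})" "bounded (Y ` {0..t})"
    using compact_continuous_image[OF ac_curve_continuous[OF X]]
      compact_continuous_image[OF ac_curve_continuous[OF Y]] compact_imp_bounded by blast+
  then obtain A B where A: "A > 0" "\<And>s. s \<in> {0..t} \<Longrightarrow> \<bar>X s\<bar> \<le> A"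
    and B: "B > 0" "\<And>s. s \<in> {0..t} \<Longrightarrow> \<bar>Y s\<bar> \<le> B"
    unfolding bounded_pos by auto
  have "(A * L' + B * L)-lipschitz_on {0..t} (\<lambda>s. X s * Y s)"
  proof (rule lipschitz_onI)
    fix r s assume rs: "r \<in> {0..t}" "s \<in> {0..t}"
    have "\<bar>X r * Y r - X s * Y s\<bar> = \<bar>X r * (Y r - Y s) + Y s * (X r - X s)\<bar>"
      by (simp add: algebra_simps)
    also have "\<dots> \<le> \<bar>X r\<bar> * \<bar>Y r - Y s\<bar> + \<bar>Y s\<bar> * \<bar>X r - X s\<bar>"
      using abs_triangle_ineq[of "X r * (Y r - Y s)" "Y s * (X r - X s)"] by (simp add: abs_mult)
    also have "\<dots> \<le> A * (L' * \<bar>r - s\<bar>) + B * (L * \<bar>r - s\<bar>)"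
      using A B rs lipschitz_onD[OF L rs] lipschitz_onD[OF L' rs] 
      by (intro add_mono mult_mono) (auto simp: dist_real_def)
    finally show "dist (X r * Y r) (X s * Y s) \<le> (A * L' + B * L) * dist r s"
      by (simp add: dist_real_def algebra_simps)
  qed (use A B lipschitz_on_nonneg[OF L] lipschitz_on_nonneg[OF L'] in auto)
  then show ?thesis
  proof (rule ac_curveI[where N = "N \<union> N'"])
    fix s assume "s \<in> {0..t}" "s \<notin> N \<union> N'"
    then show "((\<lambda>s. X s * Y s) has_vector_derivative u s * Y s + X s * v s) (at s within {0..t})"
      using has_vector_derivative_mult[OF N(2)[of s] N'(2)[of s]] by (simp add: add.commute)
  qed (use N N' in auto)
qed

text \<open>The given velocity agrees almost everywhere with the density of the curve, as
  derivatives within a nondegenerate interval are unique; this is why t = 0 is a separate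
  case.\<close>

lemma has_vector_derivative_has_integral_ae:
  fixes X :: "real \<Rightarrow> real"
  assumes X: "ac_curve t X v" and t: "0 \<le> t"
  shows "(v has_integral (X t - X 0)) {0..t}"
    and "\<exists>B N. negligible N \<and> (\<forall>s\<in>{0..t} - N. \<bar>v s\<bar> \<le> B)"
proof -
  obtain L N where L: "L-lipschitz_on {0..t} X" and N: "negligible N"
    "\<And>s. s \<in> {0..t} - N \<Longrightarrow> (X has_vector_derivative v s) (at s within {0..t})"
    using assms(1) unfolding ac_curve_def by blast
  obtain h N' where h: "\<And>x y. 0 \<le> x \<Longrightarrow> x \<le> y \<Longrightarrow> y \<le> t \<Longrightarrow> (h has_integral (X y - X x)) {x..y}"
    "negligible N'" "\<And>x. x \<in> {0..t} - N' \<Longrightarrow> (X has_real_derivative h x) (at x within {0..t})"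
    "\<And>x. x \<in> {0..t} - N' \<Longrightarrow> \<bar>h x\<bar> \<le> L"
    using lipschitz_real_density[OF L t] by blast
  have "(v has_integral (X t - X 0)) {0..t} \<and> (\<exists>B N. negligible N \<and> (\<forall>s\<in>{0..t} - N. \<bar>v s\<bar> \<le> B))"
  proof (cases "t = 0")
    case True then show ?thesis using has_integral_refl(2)[of v 0]
      by (auto intro!: exI[of _ "\<bar>v 0\<bar>"] exI[of _ "{}"])
  next
    case False
    have eq: "v s = h s" if "s \<in> {0..t} - (N \<union> N')" for s
      using vector_derivative_unique_within_closed_interval[of 0 t s X "v s" "h s"] N(2)[of s] h(3)[of s] that t False
      by (simp add: has_real_derivative_iff_has_vector_derivative)
    have "negligible (N \<union> N')" using N h by simp
    moreover have "(v has_integral (X t - X 0)) {0..t}"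
      by (rule has_integral_spike[OF \<open>negligible (N \<union> N')\<close> _ h(1)[of 0 t]]) (use eq t in auto)
    ultimately show ?thesis using eq h(4) by (intro conjI exI[of _ L] exI[of _ "N \<union> N'"]) auto
  qed
  then show "(v has_integral (X t - X 0)) {0..t}"
    "\<exists>B N. negligible N \<and> (\<forall>s\<in>{0..t} - N. \<bar>v s\<bar> \<le> B)" by auto
qed

text \<open>The velocity is bounded only off a null set. Once it is set to 0 there it is bounded and
  absolutely integrable, and so is its product with itself.\<close>

lemma ac_curve_square_integrable:
  fixes X :: "real \<Rightarrow> real"
  assumes X: "ac_curve t X v" and t: "0 \<le> t"
  shows "(\<lambda>s. (v s)\<^sup>2) integrable_on {0..t}"
proof -
  obtain B N where N: "negligible N" "\<And>s. s \<in> {0..t} - N \<Longrightarrow> \<bar>v s\<bar> \<le> B"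
    using has_vector_derivative_has_integral_ae(2)[OF X t] by blast
  define v1 where "v1 s = (if s \<in> N then 0 else v s)" for s
  have v1: "\<bar>v1 s\<bar> \<le> \<bar>B\<bar>" if "s \<in> {0..t}" for s
    using N(2)[of s] that by (auto simp: v1_def)
  have "v integrable_on {0..t}"
    using has_vector_derivative_has_integral_ae(1)[OF X t] by blast
  then have i1: "v1 integrable_on {0..t}"
    by (rule integrable_spike[OF _ N(1)]) (auto simp: v1_def)
  have abs: "v1 absolutely_integrable_on {0..t}"
    by (rule absolutely_integrable_integrable_bound[OF _ i1, of "\<lambda>_. \<bar>B\<bar>"]) (use v1 in auto)
  have "(\<lambda>s. v1 s * v1 s) absolutely_integrable_on {0..t}"
  proof (rule absolutely_integrable_bounded_measurable_product_real[OF _ _ _ abs])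
    show "v1 \<in> borel_measurable (lebesgue_on {0..t})" by (rule integrable_imp_measurable[OF i1])
    show "bounded (v1 ` {0..t})" unfolding bounded_iff using v1 by (intro exI[of _ "\<bar>B\<bar>"]) auto
  qed simp
  then have "(\<lambda>s. v1 s * v1 s) integrable_on {0..t}" by (rule set_lebesgue_integral_eq_integral(1))
  then show ?thesis
    by (rule integrable_spike[OF _ N(1)]) (auto simp: v1_def power2_eq_square)
qed

lemma lipschitz_imp_ac_curve:
  fixes X :: "real \<Rightarrow> 'a::euclidean_space"
  assumes L: "L-lipschitz_on {0..t} X" and t: "0 \<le> t"
  obtains v where "ac_curve t X v"
proof -
  have "\<exists>v. ac_curve t (\<lambda>s. X s \<bullet> b) v" if "b \<in> Basis" for b
  proof -
    have "L-lipschitz_on {0..t} (\<lambda>s. X s \<bullet> b)"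
    proof (rule lipschitz_onI)
      fix r s assume rs: "r \<in> {0..t}" "s \<in> {0..t}"
      have "\<bar>(X r - X s) \<bullet> b\<bar> \<le> norm (X r - X s)" using Basis_le_norm[OF that] .
      also have "\<dots> \<le> L * dist r s" using lipschitz_onD[OF L rs] by (simp add: dist_norm)
      finally show "dist (X r \<bullet> b) (X s \<bullet> b) \<le> L * dist r s" by (simp add: dist_real_def inner_diff_left)
    qed (rule lipschitz_on_nonneg[OF L])
    from lipschitz_real_density[OF this t] show ?thesis
      using ac_curveI[OF \<open>L-lipschitz_on {0..t} (\<lambda>s. X s \<bullet> b)\<close>]
      by (metis Diff_iff has_real_derivative_iff_has_vector_derivative)
  qed
  then obtain v where v: "\<And>b. b \<in> Basis \<Longrightarrow> ac_curve t (\<lambda>s. X s \<bullet> b) (v b)" by metis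
  have "ac_curve t (\<lambda>s. \<Sum>b\<in>Basis. (X s \<bullet> b) *\<^sub>R b) (\<lambda>s. \<Sum>b\<in>Basis. v b s *\<^sub>R b)"
    by (intro ac_curve_sum ac_curve_linear[OF v, where f = "\<lambda>r. r *\<^sub>R _"] bounded_linear_scaleR_left) auto
  then show thesis using that by (simp add: euclidean_representation)
qed

section \<open>One-dimensional extremals\<close>

lemma mean_le: "u \<le> v \<Longrightarrow> v \<le> p \<Longrightarrow> (v + u) / 2 \<le> (p::real)"
  by simp

text \<open>The explicit trajectories are quadratic pieces whose values and velocities agree at the
  junctions, so the glued curves are differentiable there too.\<close>

lemma DERIV_glue:
  fixes f g f' g' :: "real \<Rightarrow> real"
  assumes f: "\<And>s. (f has_real_derivative f' s) (at s)" and g: "\<And>s. (g has_real_derivative g' s) (at s)"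
    and c: "f c = g c" "f' c = g' c"
  shows "((\<lambda>s. if s < c then f s else g s) has_real_derivative (if s < c then f' s else g' s)) (at s)"
proof -
  consider "s < c" | "s > c" | "s = c" by linarith
  then show ?thesis
  proof cases
    case 1
    have "((\<lambda>s. if s < c then f s else g s) has_real_derivative f' s) (at s)"
      by (rule has_field_derivative_transform_within_open[OF f, of "{..<c}"]) (use 1 in auto)
    then show ?thesis using 1 by simp
  next
    case 2
    have "((\<lambda>s. if s < c then f s else g s) has_real_derivative g' s) (at s)"
      by (rule has_field_derivative_transform_within_open[OF g, of "{c<..}"]) (use 2 in auto)
    then show ?thesis using 2 by simp
  next
    case 3
    have "((\<lambda>s. if s < c then f s else g s) has_real_derivative g' c) (at c)"
      unfolding DERIV_def LIM_def
    proof (intro allI impI)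
      fix e :: real assume "e > 0"
      then obtain d1 d2 where d: "d1 > 0" "d2 > 0"
        "\<And>h. h \<noteq> 0 \<Longrightarrow> \<bar>h\<bar> < d1 \<Longrightarrow> \<bar>(f (c + h) - f c) / h - f' c\<bar> < e"
        "\<And>h. h \<noteq> 0 \<Longrightarrow> \<bar>h\<bar> < d2 \<Longrightarrow> \<bar>(g (c + h) - g c) / h - g' c\<bar> < e"
        using f[of c] g[of c] unfolding DERIV_def LIM_def dist_real_def by (metis diff_zero)
      show "\<exists>s>0. \<forall>h. h \<noteq> 0 \<and> dist h 0 < s \<longrightarrow> dist (((if c + h < c then f (c + h) else g (c + h)) - (if c < c then f c else g c)) / h) (g' c) < e"
        using d c by (intro exI[of _ "min d1 d2"]) (auto simp: dist_real_def)
    qed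
    then show ?thesis using 3 by simp
  qed
qed

text \<open>The condition m <= w' <= M in terms of increments: it makes sense at the kinks of
  \<open>w\<close> and survives gluing.\<close>

definition slopes_in :: "real \<Rightarrow> real \<Rightarrow> (real \<Rightarrow> real) \<Rightarrow> bool" where
  "slopes_in m M w \<longleftrightarrow> (\<forall>r s. r \<le> s \<longrightarrow> m * (s - r) \<le> w s - w r \<and> w s - w r \<le> M * (s - r))"

lemma slopes_in_affine: "m \<le> k \<Longrightarrow> k \<le> M \<Longrightarrow> slopes_in m M (\<lambda>s. c + k * s)"
  unfolding slopes_in_def by (auto simp flip: right_diff_distrib intro!: mult_right_mono)

lemma slopes_in_glue:
  assumes f: "slopes_in m M f" and g: "slopes_in m M g" and c: "f c = g c"
  shows "slopes_in m M (\<lambda>s. if s < c then f s else g s)"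
  unfolding slopes_in_def
proof (intro allI impI)
  fix r s :: real assume rs: "r \<le> s"
  have *: "m * (s - r) = m * (s - c) + m * (c - r)" "M * (s - r) = M * (s - c) + M * (c - r)"
    by algebra+
  show "m * (s - r) \<le> (if s < c then f s else g s) - (if r < c then f r else g r) \<and>
     (if s < c then f s else g s) - (if r < c then f r else g r) \<le> M * (s - r)"
  proof (cases "r < c \<and> c \<le> s")
    case True
    then have "m * (c - r) \<le> f c - f r \<and> f c - f r \<le> M * (c - r)"
      "m * (s - c) \<le> g s - g c \<and> g s - g c \<le> M * (s - c)"
      using f g unfolding slopes_in_def by auto
    then show ?thesis using True c unfolding * by simp
  next
    case False
    then show ?thesis using f g rs unfolding slopes_in_def by auto
  qed
qed

definition gcost :: "real \<Rightarrow> real \<Rightarrow> real \<Rightarrow> real" where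
  "gcost a b y = a * max y 0 + b * max (- y) 0"

text \<open>\<open>w\<close> is both velocity and momentum. The momentum equation, that w' is a
  subgradient of the running cost, is written as w' \<gamma> = g(\<gamma>) with slopes in [-b, a];
  where \<gamma> = 0 this leaves w' free in [-b, a], so a trajectory may rest at the kink. The
  finite set contains the kinks of \<open>w\<close>.\<close>

definition extremal :: "real \<Rightarrow> real \<Rightarrow> real \<Rightarrow> real \<Rightarrow> real \<Rightarrow> (real \<Rightarrow> real) \<Rightarrow> (real \<Rightarrow> real) \<Rightarrow> bool" where
  "extremal a b x t p \<gamma> w \<longleftrightarrow> w 0 = p \<and> \<gamma> t = x \<and> slopes_in (- b) a w \<and>
     (\<forall>s. (\<gamma> has_real_derivative w s) (at s)) \<and>
     (\<exists>N. finite N \<and> (\<forall>s\<in>{0..t} - N. \<exists>z. (w has_real_derivative z) (at s) \<and> z * \<gamma> s = gcost a b (\<gamma> s)))"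

lemma extremalI:
  assumes "w 0 = p" "\<gamma> t = x" "slopes_in (- b) a w" "\<And>s. (\<gamma> has_real_derivative w s) (at s)"
    "finite N" "\<And>s. 0 \<le> s \<Longrightarrow> s \<le> t \<Longrightarrow> s \<notin> N \<Longrightarrow> \<exists>z. (w has_real_derivative z) (at s) \<and> z * \<gamma> s = gcost a b (\<gamma> s)"
  shows "extremal a b x t p \<gamma> w"
  using assms unfolding extremal_def by (metis DiffE atLeastAtMost_iff)

section \<open>Extremals in the five regions\<close>

lemma gcost_pos: "0 \<le> y \<Longrightarrow> gcost a b y = a * y"
  and gcost_neg: "y \<le> 0 \<Longrightarrow> gcost a b y = - b * y"
  by (auto simp: gcost_def max_def)

lemma powr_three_halves: "0 \<le> y \<Longrightarrow> y powr (3/2) = sqrt y ^ 3" for y :: real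
  by (cases "y = 0") (simp_all add: powr_half_sqrt[symmetric] powr_powr flip: powr_realpow)

text \<open>\<open>C\<close> is a primitive of the squared velocity in closed form; w(t) x - C(t)/2
  can then be compared with the explicit formulas by algebra.\<close>

definition extremal_data :: "real \<Rightarrow> real \<Rightarrow> real \<Rightarrow> real \<Rightarrow> real \<Rightarrow> (real \<Rightarrow> real) \<Rightarrow> (real \<Rightarrow> real) \<Rightarrow> (real \<Rightarrow> real) \<Rightarrow> bool" where
  "extremal_data a b x t p \<gamma> w C \<longleftrightarrow> extremal a b x t p \<gamma> w \<and>
     (\<forall>s. (C has_real_derivative (w s)\<^sup>2) (at s)) \<and> C 0 = 0"

text \<open>In this region the curve satisfies \<gamma>(s) >= p s + a s^2 / 2 >= 0, so it never
  leaves the half-line where the acceleration is a.\<close>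

lemma extremal_Omega1:
  assumes "0 < a" "0 < b" "0 < t" "0 \<le> p" "p * t + a/2 * t^2 \<le> x"
  shows "extremal_data a b x t p (\<lambda>s. x - p * (t - s) - a/2 * (t^2 - s^2)) (\<lambda>s. p + a * s)
     (\<lambda>s. p\<^sup>2 * s + p * a * s^2 + a^2 * s^3 / 3)"
  unfolding extremal_data_def
proof (intro conjI allI extremalI[where N = "{}"])
  fix s :: real assume "0 \<le> s" "s \<le> t"
  then have "0 \<le> p * s + a/2 * s^2" using assms by simp
  then have "0 \<le> x - p * (t - s) - a/2 * (t^2 - s^2)" using assms by (simp add: algebra_simps)
  then show "\<exists>z. ((\<lambda>s. p + a * s) has_real_derivative z) (at s) \<and>
      z * (x - p * (t - s) - a/2 * (t^2 - s^2)) = gcost a b (x - p * (t - s) - a/2 * (t^2 - s^2))"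
    by (intro exI[of _ a]) (auto intro!: derivative_eq_intros simp: gcost_pos)
next
  show "slopes_in (- b) a (\<lambda>s. p + a * s)" by (rule slopes_in_affine) (use assms in auto)
qed (use assms in \<open>auto intro!: derivative_eq_intros simp: field_simps power2_eq_square power3_eq_cube\<close>)

lemma extremal_Omega2:
  assumes "0 < a" "0 < b" "0 < t" "0 \<le> p"
    "x < 0 \<and> t < p/b \<or> x < - (b/2) * (t - p/b)^2 \<and> t \<ge> p/b"
  shows "extremal_data a b x t p (\<lambda>s. x - p * (t - s) + b/2 * (t^2 - s^2)) (\<lambda>s. p + (- b) * s)
     (\<lambda>s. p\<^sup>2 * s - p * b * s^2 + b^2 * s^3 / 3)"
  unfolding extremal_data_def
proof (intro conjI allI extremalI[where N = "{}"])
  fix s :: real assume s: "0 \<le> s" "s \<le> t"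
  have "x - p * (t - s) + b/2 * (t^2 - s^2) \<le> 0"
  proof (cases "t < p / b")
    \<comment> \<open>Before time p/b the velocity p - b s is positive, so the curve increases
      towards its negative endpoint x.\<close>
    case True
    then have "b * t < p" using assms by (simp add: field_simps)
    moreover have "b * s \<le> b * t" using s assms by (intro mult_left_mono) auto
    moreover have eq: "b/2 * (t + s) = (b * t + b * s) / 2" by algebra
    ultimately have "b/2 * (t + s) \<le> p" unfolding eq by (intro mean_le) auto
    then have "(t - s) * (b/2 * (t + s)) \<le> (t - s) * p" using s by (intro mult_left_mono) auto
    moreover have "x < 0" using assms(5) True by auto
    moreover have "x - p * (t - s) + b/2 * (t^2 - s^2) = x - (t - s) * p + (t - s) * (b/2 * (t + s))"
    proof -
      have "t^2 - s^2 = (t - s) * (t + s)" by algebra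
      then show ?thesis by (simp add: mult_ac)
    qed
    ultimately show ?thesis by linarith
  next
    case False
    then have "x < - (b/2) * (t - p/b)^2" using assms(5) by auto
    \<comment> \<open>Completing the square: the curve is a concave parabola with apex at time p/b,
      and the region is exactly where the apex has negative height.\<close>
    moreover have "x - p * (t - s) + b/2 * (t^2 - s^2) = x + b/2 * (t - p/b)^2 - b/2 * (s - p/b)^2"
      using assms by (simp add: field_simps power2_eq_square)
    moreover have "0 \<le> b/2 * (s - p/b)^2" using assms by simp
    ultimately show ?thesis by linarith
  qed
  then show "\<exists>z. ((\<lambda>s. p + (- b) * s) has_real_derivative z) (at s) \<and>
      z * (x - p * (t - s) + b/2 * (t^2 - s^2)) = gcost a b (x - p * (t - s) + b/2 * (t^2 - s^2))"
    by (intro exI[of _ "- b"]) (auto intro!: derivative_eq_intros simp: gcost_neg)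
next
  show "slopes_in (- b) a (\<lambda>s. p + (- b) * s)" by (rule slopes_in_affine) (use assms in auto)
qed (use assms in \<open>auto intro!: derivative_eq_intros simp: field_simps power2_eq_square power3_eq_cube\<close>)

text \<open>The curve crosses 0 upwards at time \<open>\<tau>\<close> with velocity p - b \<tau> >=
  0: the acceleration is -b before the crossing and a after it.\<close>

lemma extremal_Omega3:
  assumes "0 < a" "0 < b" "0 < t" "0 \<le> p" "0 \<le> \<tau>" "\<tau> \<le> t" "b * \<tau> \<le> p"
    and x: "x = (p - b * \<tau>) * (t - \<tau>) + a/2 * (t - \<tau>)^2"
    and "0 < \<tau>"
  shows "extremal_data a b x t p
     (\<lambda>s. if s < \<tau> then - p * (\<tau> - s) + b/2 * (\<tau>^2 - s^2) else (p - b * \<tau>) * (s - \<tau>) + a/2 * (s - \<tau>)^2)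
     (\<lambda>s. if s < \<tau> then p + (- b) * s else (p - b * \<tau> - a * \<tau>) + a * s)
     (\<lambda>s. if s < \<tau> then (p^3 - (p - b * s)^3) / (3 * b)
        else (p^3 - (p - b * \<tau>)^3) / (3 * b) + ((p - b * \<tau> + a * (s - \<tau>))^3 - (p - b * \<tau>)^3) / (3 * a))"
  (is "extremal_data a b x t p ?\<gamma> ?w ?C")
  unfolding extremal_data_def
proof (intro conjI allI extremalI[where N = "{\<tau>}"])
  show "slopes_in (- b) a ?w"
    by (intro slopes_in_glue slopes_in_affine) (use assms in auto)
  fix s
  show "(?\<gamma> has_real_derivative ?w s) (at s)"
    by (rule DERIV_glue) (auto intro!: derivative_eq_intros simp: field_simps)
  have "(?C has_real_derivative (if s < \<tau> then (p + (- b) * s)\<^sup>2 else ((p - b * \<tau> - a * \<tau>) + a * s)\<^sup>2)) (at s)"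
    using assms by (intro DERIV_glue)
      (auto intro!: derivative_eq_intros simp: field_simps power2_eq_square power3_eq_cube)
  then show "(?C has_real_derivative (?w s)\<^sup>2) (at s)" by (simp add: if_distrib[of "\<lambda>r. r\<^sup>2"])
  assume s: "0 \<le> s" "s \<le> t" "s \<notin> {\<tau>}"
  show "\<exists>z. (?w has_real_derivative z) (at s) \<and> z * ?\<gamma> s = gcost a b (?\<gamma> s)"
  proof (cases "s < \<tau>")
    case True
    have "b * s \<le> b * \<tau>" using True assms by (intro mult_left_mono) auto
    moreover have eq: "b/2 * (\<tau> + s) = (b * \<tau> + b * s) / 2" by algebra
    ultimately have "b/2 * (\<tau> + s) \<le> p" unfolding eq using assms(7) by (intro mean_le) auto
    then have "(\<tau> - s) * (b/2 * (\<tau> + s)) \<le> (\<tau> - s) * p"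
      using True by (intro mult_left_mono) auto
    moreover have "?\<gamma> s = (\<tau> - s) * (b/2 * (\<tau> + s)) - (\<tau> - s) * p"
      using True by (simp add: power2_eq_square field_simps)
    ultimately have "?\<gamma> s \<le> 0" by linarith
    moreover have "(?w has_real_derivative - b) (at s)"
      by (rule has_field_derivative_transform_within_open[where S = "{..<\<tau>}" and f = "\<lambda>s. p + (- b) * s"])
        (use True in \<open>auto intro!: derivative_eq_intros\<close>)
    ultimately show ?thesis by (intro exI[of _ "- b"] conjI gcost_neg[symmetric])
  next
    case False
    have "?\<gamma> s \<ge> 0" using assms False by simp
    moreover have "(?w has_real_derivative a) (at s)"
      by (rule has_field_derivative_transform_within_open[where S = "{\<tau><..}" and f = "\<lambda>s. (p - b * \<tau> - a * \<tau>) + a * s"])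
        (use False s in \<open>auto intro!: derivative_eq_intros\<close>)
    ultimately show ?thesis by (intro exI[of _ "a"] conjI gcost_pos[symmetric])
  qed
qed (use assms in auto)

text \<open>Both regions at once. The curve comes to rest at 0 at time p/b, stays there until
  \<open>\<sigma>\<close>, and leaves with acceleration \<open>\<kappa>\<close>, which is a upwards
  and -b downwards. While it rests, the slope 0 of \<open>w\<close> is admissible since it lies in
  [-b, a].\<close>

lemma extremal_Omega45:
  assumes "0 < a" "0 < b" "0 < t" "0 \<le> p" "p / b \<le> \<sigma>" "\<sigma> \<le> t" "\<kappa> = a \<or> \<kappa> = - b" "p / b < t"
    and x: "x = \<kappa>/2 * (t - \<sigma>)^2"
  shows "extremal_data a b x t p
     (\<lambda>s. if s < p/b then - (1 / (2*b)) * (p - b * s)^2 else if s < \<sigma> then 0 else \<kappa>/2 * (s - \<sigma>)^2)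
     (\<lambda>s. if s < p/b then p + (- b) * s else if s < \<sigma> then 0 + 0 * s else - \<kappa> * \<sigma> + \<kappa> * s)
     (\<lambda>s. if s < p/b then (p^3 - (p - b * s)^3) / (3 * b)
        else if s < \<sigma> then p^3 / (3 * b) else p^3 / (3 * b) + \<kappa>^2 * (s - \<sigma>)^3 / 3)"
  (is "extremal_data a b x t p ?\<gamma> ?w ?C")
  unfolding extremal_data_def
proof (intro conjI allI extremalI[where N = "{p/b, \<sigma>}"])
  show "slopes_in (- b) a ?w"
    by (intro slopes_in_glue slopes_in_affine) (use assms in auto)
  fix s
  show "(?\<gamma> has_real_derivative ?w s) (at s)"
    using assms by (intro DERIV_glue) (auto intro!: derivative_eq_intros simp: field_simps)
  have "(?C has_real_derivative (if s < p/b then (p + (- b) * s)\<^sup>2 else if s < \<sigma> then 0 else (- \<kappa> * \<sigma> + \<kappa> * s)\<^sup>2)) (at s)"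
    using assms(1-6,8) by (intro DERIV_glue)
      (auto intro!: derivative_eq_intros simp: field_simps power2_eq_square power3_eq_cube)
  then show "(?C has_real_derivative (?w s)\<^sup>2) (at s)" by (simp add: if_distrib[of "\<lambda>r. r\<^sup>2"] cong: if_cong)
  assume s: "0 \<le> s" "s \<le> t" "s \<notin> {p/b, \<sigma>}"
  consider "s < p/b" | "p/b < s" "s < \<sigma>" | "\<sigma> < s" using s by force
  then show "\<exists>z. (?w has_real_derivative z) (at s) \<and> z * ?\<gamma> s = gcost a b (?\<gamma> s)"
  proof cases
    case 1
    have "?\<gamma> s \<le> 0" using 1 assms by simp
    moreover have "(?w has_real_derivative - b) (at s)"
      by (rule has_field_derivative_transform_within_open[where S = "{..<p/b}" and f = "\<lambda>s. p + (- b) * s"])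
        (use 1 in \<open>auto intro!: derivative_eq_intros\<close>)
    ultimately show ?thesis by (intro exI[of _ "- b"] conjI gcost_neg[symmetric])
  next
    case 2
    have "(?w has_real_derivative 0) (at s)"
      by (rule has_field_derivative_transform_within_open[where S = "{p/b<..<\<sigma>}" and f = "\<lambda>s. 0"])
        (use 2 in \<open>auto intro!: derivative_eq_intros\<close>)
    then show ?thesis using 2 by (intro exI[of _ 0]) (auto simp: gcost_def)
  next
    case 3
    have "(?w has_real_derivative \<kappa>) (at s)"
      by (rule has_field_derivative_transform_within_open[where S = "{\<sigma><..}" and f = "\<lambda>s. - \<kappa> * \<sigma> + \<kappa> * s"])
        (use 3 assms in \<open>auto intro!: derivative_eq_intros\<close>)
    moreover have "?\<gamma> s = \<kappa>/2 * (s - \<sigma>)^2" using 3 assms by auto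
    moreover have "\<kappa> * (\<kappa>/2 * (s - \<sigma>)^2) = gcost a b (\<kappa>/2 * (s - \<sigma>)^2)"
      using assms(1,2,7) by (auto simp: gcost_pos gcost_neg)
    ultimately show ?thesis by (intro exI[of _ \<kappa>]) presburger
  qed
next
  have "0 \<le> p / b" using assms by simp
  then have "0 \<le> \<sigma>" using assms(5) by linarith
  then show "?w 0 = p" "?C 0 = 0" using assms(1-6) by (auto simp: not_less divide_le_0_iff)
  show "?\<gamma> t = x" using assms by auto
qed simp


text \<open>\<open>R\<close> is the square root in the formula, \<open>d\<close> = b t - p,
  \<open>q\<close> the velocity at the crossing and \<open>v\<close> the final velocity. All
  quantities are polynomial in d, R and t up to constant denominators, so the claim becomes a
  polynomial identity.\<close>

lemma f3_identity:
  fixes a b d R p t :: real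
  assumes "0 < a" "0 < b" and x: "x = (R^2 - d^2) / (2 * (a + 2 * b))" and p: "p = b * t - d"
    and q: "q = (b * R - (a + b) * d) / (a + 2 * b)" and v: "v = ((a + b) * R - b * d) / (a + 2 * b)"
  shows "(a + b) / (3 * (a + 2*b)^2) * (d^3 + R^3) - b / (a + 2*b) * d * x - b^2/6 * t^3 + b/2 * p * t^2 - 1/2 * p^2 * t
    = v * x - ((p^3 - q^3) / (3 * b) + (v^3 - q^3) / (3 * a)) / 2"
proof -
  \<comment> \<open>As an atom, k lets the denominators be cleared before the relation k = a + 2 b
    is used.\<close>
  define k where "k = a + 2 * b"
  have k: "k > 0" "b = (k - a) / 2" using assms unfolding k_def by auto
  have 1: "b^2/6 * t^3 - b/2 * p * t^2 + 1/2 * p^2 * t = (p^3 + d^3) / (6 * b)"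
    using assms(2) unfolding p by (simp add: field_simps power2_eq_square power3_eq_cube)
  have x': "x = (R^2 - d^2) / (2 * k)" using x k_def by simp
  have 2: "(a + b) / (3 * k^2) * (d^3 + R^3) - d^3 / (6 * b) - (a + b) * R / k * x = q^3 / (6 * b) - (v^3 - q^3) / (6 * a)"
    using assms(1,2) k(1) unfolding q v x' k_def[symmetric]
    apply (simp add: divide_simps)
    using k_def by algebra
  have 3: "v * x = (a + b) * R / k * x - b / k * d * x"
    unfolding v k_def[symmetric] using k(1) by (simp add: divide_simps) (simp add: algebra_simps)
  have 4: "((p^3 - q^3) / (3 * b) + (v^3 - q^3) / (3 * a)) / 2 = (p^3 + d^3) / (6 * b) - d^3 / (6 * b) - q^3 / (6 * b) + (v^3 - q^3) / (6 * a)"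
    by (simp add: add_divide_distrib diff_divide_distrib)
  show ?thesis using 1 2 3 4 unfolding k_def by linarith
qed

lemma extremal_exists_nonneg:
  assumes ab: "0 < a" "0 < b" and tp: "0 < t" "0 \<le> p"
  shows "\<exists>\<gamma> w C. extremal_data a b x t p \<gamma> w C \<and> (\<forall>s. gamma1_nonneg s x t p a b = \<gamma> s) \<and>
     V1_nonneg x t p a b = w t * x - C t / 2"
proof -
  consider (1) "(x, t, p) \<in> Omega1 a b" | (2) "(x, t, p) \<notin> Omega1 a b" "(x, t, p) \<in> Omega2 a b"
    | (3) "(x, t, p) \<notin> Omega1 a b" "(x, t, p) \<notin> Omega2 a b" "(x, t, p) \<in> Omega3 a b"
    | (4) "(x, t, p) \<notin> Omega1 a b" "(x, t, p) \<notin> Omega2 a b" "(x, t, p) \<notin> Omega3 a b" "(x, t, p) \<in> Omega4 a b"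
    | (5) "(x, t, p) \<notin> Omega1 a b" "(x, t, p) \<notin> Omega2 a b" "(x, t, p) \<notin> Omega3 a b" "(x, t, p) \<notin> Omega4 a b"
      "(x, t, p) \<in> Omega5 a b"
  proof -
    have "(x, t, p) \<in> UNIV \<times> {0..} \<times> {0..}" using tp by simp
    then have "(x, t, p) \<in> Omega1 a b \<union> Omega2 a b \<union> Omega3 a b \<union> Omega4 a b \<union> Omega5 a b"
      unfolding Omega_cover[OF ab] .
    then show thesis using 1 2 3 4 5 by blast
  qed
  then show ?thesis
  proof cases
    case 1
    then have "p * t + a/2 * t^2 \<le> x" by (simp add: Omega1_def)
    note E = extremal_Omega1[OF ab tp this]
    show ?thesis
      by (intro exI conjI allI, rule E)
        (use 1 in \<open>auto simp: gamma1_nonneg_def V1_nonneg_def f1_def field_simps power2_eq_square power3_eq_cube\<close>)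
  next
    case 2
    then have "x < 0 \<and> t < p/b \<or> x < - (b/2) * (t - p/b)^2 \<and> t \<ge> p/b" by (simp add: Omega2_def)
    note E = extremal_Omega2[OF ab tp this]
    show ?thesis
      by (intro exI conjI allI, rule E)
        (use 2 in \<open>auto simp: gamma1_nonneg_def V1_nonneg_def f2_def field_simps power2_eq_square power3_eq_cube\<close>)
  next
    case 3
    define d where "d = b * t - p"
    define R where "R = sqrt (d^2 + 2 * (2*b + a) * x)"
    \<comment> \<open>The condition that the glued curve ends at x is a quadratic equation for the
      crossing time; this is its smaller root.\<close>
    define \<tau> where "\<tau> = ((a + b) * t + p - R) / (2*b + a)"
    have k: "2*b + a > 0" using ab by simp
    have x: "0 \<le> x" "x < p * t + a/2 * t^2" 
    proof -
      have "0 \<le> a/2 * (t - p/b)\<^sup>2" using ab by simp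
      then show "0 \<le> x" using 3(3) unfolding Omega3_def mem_Collect_eq prod.case by linarith
    qed (use 3(3) in \<open>auto simp: Omega3_def\<close>)
    have R2: "R^2 = d^2 + 2 * (2*b + a) * x" and R0: "R \<ge> 0"
      unfolding R_def using x ab by auto
    have Rd: "\<bar>d\<bar> \<le> R" unfolding R_def
      by (rule real_le_rsqrt) (use x ab in auto)
    have k\<tau>: "(2*b + a) * \<tau> = (a + b) * t + p - R" unfolding \<tau>_def using k by simp
    \<comment> \<open>The crossing time vanishes on the boundary with \<open>Omega1\<close>: the
      difference of the squares is a positive multiple of the distance of x below that
      boundary.\<close>
    have "R^2 < ((a + b) * t + p)^2"
    proof -
      have "((a + b) * t + p)^2 - R^2 = 2 * (2*b + a) * (p * t + a/2 * t^2 - x)"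
        unfolding R2 d_def by (simp add: power2_eq_square algebra_simps)
      also have "\<dots> > 0" using k x by (intro mult_pos_pos) auto
      finally show ?thesis by simp
    qed
    then have "R < (a + b) * t + p"
      by (rule power2_less_imp_less) (use ab tp in auto)
    then have \<tau>0: "0 < \<tau>" unfolding \<tau>_def using k by simp
    have "(2*b + a) * \<tau> \<le> (2*b + a) * t" unfolding k\<tau> using Rd d_def by (simp add: algebra_simps)
    then have \<tau>t: "\<tau> \<le> t" using k by simp
    have kq: "(2*b + a) * (p - b * \<tau>) = b * R - (a + b) * d"
      using k\<tau> unfolding d_def by algebra
    \<comment> \<open>The difference of the two sides is a positive multiple of the crossing
      velocity. For d > 0 the inequality is, after squaring, the bound on x that separates this
      region from \<open>Omega4\<close>.\<close>
    have "(a + b) * d \<le> b * R"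
    proof (cases "d \<le> 0")
      case True
      then have "(a + b) * d \<le> 0" using ab by (simp add: mult_le_0_iff)
      also have "0 \<le> b * R" using ab R0 by simp
      finally show ?thesis .
    next
      case False
      then have "p / b \<le> t" using ab unfolding d_def by (simp add: field_simps)
      then have "a/2 * (t - p/b)^2 \<le> x" using 3(3) unfolding Omega3_def by auto
      moreover have "a * (b * y)^2 \<le> 2 * b^2 * x" if "a/2 * y^2 \<le> x" for y
        using mult_left_mono[OF that, of "2 * b^2"] by (simp add: power_mult_distrib mult_ac)
      ultimately have le: "a * (b * (t - p/b))^2 \<le> 2 * b^2 * x" by blast
      have e: "b * (t - p/b) = d" unfolding d_def using ab by (simp add: field_simps)
      have "(2*b + a) * (a * d^2) \<le> (2*b + a) * (2 * b^2 * x)"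
        using k le[unfolded e] by (intro mult_left_mono) auto
      then have "((a + b) * d)^2 \<le> (b * R)^2"
        unfolding power_mult_distrib R2 by (simp add: power2_eq_square algebra_simps)
      then show ?thesis by (rule power2_le_imp_le) (use ab R0 in auto)
    qed
    then have "0 \<le> (2*b + a) * (p - b * \<tau>)" unfolding kq by simp
    then have q0: "b * \<tau> \<le> p" using k by (simp add: zero_le_mult_iff)
    have "(2*b + a) * (2 * ((p - b * \<tau>) * (t - \<tau>) + a/2 * (t - \<tau>)^2)) = (2*b + a) * (2 * x)"
    proof -
      have "(2*b + a) * (2 * ((p - b * \<tau>) * (t - \<tau>) + a/2 * (t - \<tau>)^2))
         = ((2*b + a) * \<tau>)^2 - 2 * ((a + b) * t + p) * ((2*b + a) * \<tau>) + (2*b + a) * (2 * p * t + a * t^2)"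
        by (simp add: power2_eq_square algebra_simps)
      also have "\<dots> = R^2 - ((a + b) * t + p)^2 + (2*b + a) * (2 * p * t + a * t^2)"
        unfolding k\<tau> by algebra
      also have "\<dots> = (2*b + a) * (2 * x)" unfolding R2 d_def by (simp add: power2_eq_square algebra_simps)
      finally show ?thesis .
    qed
    then have xe: "x = (p - b * \<tau>) * (t - \<tau>) + a/2 * (t - \<tau>)^2" using k by simp
    note E = extremal_Omega3[OF ab tp less_imp_le[OF \<tau>0] \<tau>t q0 xe \<tau>0]
    have ga: "gamma1_nonneg s x t p a b = (if s < \<tau> then - p * (\<tau> - s) + b/2 * (\<tau>^2 - s^2) else (p - b * \<tau>) * (s - \<tau>) + a/2 * (s - \<tau>)^2)" for s
      using 3 by (simp add: gamma1_nonneg_def Let_def \<tau>_def R_def d_def)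
    have kv: "(2*b + a) * (p - b * \<tau> + a * (t - \<tau>)) = (a + b) * R - b * d"
      using k\<tau> unfolding d_def by algebra
    have "V1_nonneg x t p a b = f3 x t p a b" using 3 by (simp add: V1_nonneg_def)
    also have "\<dots> = (p - b * \<tau> + a * (t - \<tau>)) * x - 
        ((p^3 - (p - b * \<tau>)^3) / (3 * b) + ((p - b * \<tau> + a * (t - \<tau>))^3 - (p - b * \<tau>)^3) / (3 * a)) / 2"
    proof -
      have R3: "((b * t - p)^2 + 2 * x * (a + 2*b)) powr (3/2) = R^3"
        unfolding R_def d_def using x ab by (subst powr_three_halves) (auto simp: algebra_simps)
      show ?thesis unfolding f3_def R3 unfolding d_def[symmetric]
      proof (rule f3_identity[OF ab])
        show "x = (R^2 - d^2) / (2 * (a + 2 * b))" unfolding R2 using k by (simp add: field_simps)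
        show "p = b * t - d" by (simp add: d_def)
        show "p - b * \<tau> = (b * R - (a + b) * d) / (a + 2 * b)" using kq k by (simp add: field_simps)
        show "p - b * \<tau> + a * (t - \<tau>) = ((a + b) * R - b * d) / (a + 2 * b)" using kv k by (simp add: field_simps)
      qed
    qed
    finally have v: "V1_nonneg x t p a b = \<dots>" .
    have w: "p - b * \<tau> - a * \<tau> + a * t = p - b * \<tau> + a * (t - \<tau>)" by algebra
    show ?thesis
      by (intro exI conjI allI, rule E, rule ga) (use \<tau>t v w in simp)
  next
    case 4
    then have x: "0 \<le> x" "x < a/2 * (t - p/b)^2" "p/b \<le> t" by (auto simp: Omega4_def)
    \<comment> \<open>The time needed to reach x from rest at 0 with acceleration a; the curve
      departs at t - r. In the last region b takes the place of a.\<close>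
    define r where "r = sqrt (2 * x / a)"
    have r2: "a/2 * r^2 = x" unfolding r_def using x ab by simp
    have r0: "0 \<le> r" unfolding r_def using x ab by simp
    have "r^2 < (t - p/b)^2" using x(2) ab unfolding r2[symmetric] by simp
    then have r: "r < t - p/b" by (rule power2_less_imp_less) (use x in auto)
    have E: "extremal_data a b x t p
       (\<lambda>s. if s < p/b then - (1 / (2*b)) * (p - b * s)^2 else if s < t - r then 0 else a/2 * (s - (t - r))^2)
       (\<lambda>s. if s < p/b then p + (- b) * s else if s < t - r then 0 + 0 * s else - a * (t - r) + a * s)
       (\<lambda>s. if s < p/b then (p^3 - (p - b * s)^3) / (3 * b)
          else if s < t - r then p^3 / (3 * b) else p^3 / (3 * b) + a^2 * (s - (t - r))^3 / 3)"
      by (rule extremal_Omega45[OF ab tp]) (use r r0 r2 in auto)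
    have "V1_nonneg x t p a b = f4 x t p a b" using 4 by (simp add: V1_nonneg_def)
    also have "\<dots> = a^2 / 3 * r^3 - p^3 / (6 * b)"
      unfolding f4_def r_def using x ab by (subst powr_three_halves) auto
    also have "\<dots> = a * r * x - (p^3 / (3 * b) + a^2 * r^3 / 3) / 2"
      unfolding r2[symmetric] using ab by (simp add: field_simps power2_eq_square power3_eq_cube)
    finally have v: "V1_nonneg x t p a b = \<dots>" .
    show ?thesis
      by (intro exI conjI allI, rule E) (use 4 r r0 v x in \<open>auto simp: gamma1_nonneg_def r_def algebra_simps\<close>)
  next
    case 5
    then have x: "x < 0" "- (b/2) * (t - p/b)^2 \<le> x" "p/b \<le> t" by (auto simp: Omega5_def)
    define r where "r = sqrt (2 * \<bar>x\<bar> / b)"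
    have "r^2 = 2 * \<bar>x\<bar> / b" unfolding r_def using ab by (intro real_sqrt_pow2) simp
    then have r2: "- b/2 * r^2 = x" using x ab by simp
    have r0: "0 < r" unfolding r_def using x ab by (simp add: divide_neg_pos)
    have "r^2 \<le> (t - p/b)^2" using x(2) ab unfolding r2[symmetric] by simp
    then have r: "r \<le> t - p/b" by (rule power2_le_imp_le) (use x in auto)
    have E: "extremal_data a b x t p
       (\<lambda>s. if s < p/b then - (1 / (2*b)) * (p - b * s)^2 else if s < t - r then 0 else (- b)/2 * (s - (t - r))^2)
       (\<lambda>s. if s < p/b then p + (- b) * s else if s < t - r then 0 + 0 * s else - (- b) * (t - r) + (- b) * s)
       (\<lambda>s. if s < p/b then (p^3 - (p - b * s)^3) / (3 * b)
          else if s < t - r then p^3 / (3 * b) else p^3 / (3 * b) + (- b)^2 * (s - (t - r))^3 / 3)"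
      by (rule extremal_Omega45[OF ab tp]) (use r r0 r2 in auto)
    have "V1_nonneg x t p a b = f5 x t p a b" using 5 by (simp add: V1_nonneg_def)
    also have "\<dots> = b^2 / 3 * r^3 - p^3 / (6 * b)"
      unfolding f5_def r_def using x ab by (subst powr_three_halves) (auto simp: divide_nonpos_pos)
    also have "\<dots> = - b * r * x - (p^3 / (3 * b) + b^2 * r^3 / 3) / 2"
      unfolding r2[symmetric] using ab by (simp add: field_simps power2_eq_square power3_eq_cube)
    finally have v: "V1_nonneg x t p a b = \<dots>" .
    show ?thesis
      by (intro exI conjI allI, rule E) (use 5 r r0 v x in \<open>auto simp: gamma1_nonneg_def r_def algebra_simps\<close>)
  qed
qed


lemma extremal_data_reflect:
  assumes "extremal_data b a (- x) t (- p) \<gamma> w C"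
  shows "extremal_data a b x t p (\<lambda>s. - \<gamma> s) (\<lambda>s. - w s) C"
proof -
  have w: "w 0 = - p" "\<gamma> t = - x" "slopes_in (- a) b w" "\<And>s. (\<gamma> has_real_derivative w s) (at s)"
    and C: "\<And>s. (C has_real_derivative (w s)\<^sup>2) (at s)" "C 0 = 0"
    using assms unfolding extremal_data_def extremal_def by auto
  obtain N where N: "finite N" "\<And>s. s \<in> {0..t} - N \<Longrightarrow> \<exists>z. (w has_real_derivative z) (at s) \<and> z * \<gamma> s = gcost b a (\<gamma> s)"
    using assms unfolding extremal_data_def extremal_def by blast
  have "extremal a b x t p (\<lambda>s. - \<gamma> s) (\<lambda>s. - w s)"
  proof (rule extremalI[OF _ _ _ _ N(1)])
    show "slopes_in (- b) a (\<lambda>s. - w s)"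
      unfolding slopes_in_def
    proof (intro allI impI)
      fix r s :: real assume "r \<le> s"
      then have "- a * (s - r) \<le> w s - w r \<and> w s - w r \<le> b * (s - r)"
        using w(3) unfolding slopes_in_def by blast
      then show "- b * (s - r) \<le> - w s - - w r \<and> - w s - - w r \<le> a * (s - r)" by simp
    qed
    fix s assume "0 \<le> s" "s \<le> t" "s \<notin> N"
    then obtain z where "(w has_real_derivative z) (at s)" "z * \<gamma> s = gcost b a (\<gamma> s)"
      using N(2)[of s] by auto
    then show "\<exists>z. ((\<lambda>s. - w s) has_real_derivative z) (at s) \<and> z * - \<gamma> s = gcost a b (- \<gamma> s)"
      by (intro exI[of _ "- z"]) (auto intro!: derivative_eq_intros simp: gcost_def)
  qed (use w in \<open>auto intro!: derivative_eq_intros\<close>)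
  then show ?thesis using C unfolding extremal_data_def by simp
qed

lemma extremal_exists:
  assumes ab: "0 < a" "0 < b" and t: "0 < t"
  obtains \<gamma> w C where "extremal_data a b x t p \<gamma> w C" "\<And>s. gamma1 s x t p a b = \<gamma> s"
     "V1 x t p a b = w t * x - C t / 2"
proof (cases "0 \<le> p")
  case True
  then show thesis using extremal_exists_nonneg[OF ab t True, of x] that by (auto simp: gamma1_def V1_def)
next
  case False
  then have "0 \<le> - p" by simp
  from extremal_exists_nonneg[OF ab(2,1) t this, of "- x"] obtain \<gamma> w C where
    "extremal_data b a (- x) t (- p) \<gamma> w C" "\<And>s. gamma1_nonneg s (- x) t (- p) b a = \<gamma> s"
    "V1_nonneg (- x) t (- p) b a = w t * (- x) - C t / 2" by blast
  then show thesis using False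
    by (intro that[OF extremal_data_reflect]) (auto simp: gamma1_def V1_def)
qed

section \<open>Weak duality in one dimension\<close>

lemma slopes_in_lipschitz:
  assumes "slopes_in (- b) a w" "0 \<le> a" "0 \<le> b"
  shows "(a + b)-lipschitz_on S w"
proof (rule lipschitz_onI)
  fix r s :: real
  have *: "\<bar>w s - w r\<bar> \<le> (a + b) * (s - r)" if "r \<le> s" for r s
  proof -
    have "- b * (s - r) \<le> w s - w r" "w s - w r \<le> a * (s - r)" using assms(1) that by (auto simp: slopes_in_def)
    moreover have "0 \<le> b * (s - r)" "0 \<le> a * (s - r)" using assms that by auto
    moreover have "(a + b) * (s - r) = a * (s - r) + b * (s - r)" "- b * (s - r) = - (b * (s - r))" by algebra+
    ultimately show ?thesis by linarith
  qed
  show "dist (w r) (w s) \<le> (a + b) * dist r s"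
    using *[of r s] *[of s r] by (cases "r \<le> s") (auto simp: dist_real_def abs_minus_commute)
qed (use assms in auto)

lemma gcost_ge: "- b \<le> z \<Longrightarrow> z \<le> a \<Longrightarrow> z * y \<le> gcost a b y"
proof -
  assume z: "- b \<le> z" "z \<le> a"
  show ?thesis
  proof (cases "0 \<le> y")
    case True
    then show ?thesis using z by (simp add: gcost_pos mult_right_mono)
  next
    case False
    then have "z * y \<le> - b * y" using z by (intro mult_right_mono_neg) auto
    then show ?thesis using False by (simp add: gcost_neg)
  qed
qed

lemma slopes_in_derivative:
  assumes w: "slopes_in m M w" and d: "(w has_vector_derivative z) (at s within {0..t})"
    and s: "s \<in> {0..t}" "0 < t"
  shows "m \<le> z" "z \<le> M"
proof -
  have "at s within {0..t} \<noteq> bot"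
    using s by (simp add: trivial_limit_within islimpt_Icc)
  moreover have l: "((\<lambda>r. (w r - w s) / (r - s)) \<longlongrightarrow> z) (at s within {0..t})"
    using d by (simp add: has_real_derivative_iff_has_vector_derivative[symmetric] has_field_derivative_iff)
  moreover have "m \<le> (w r - w s) / (r - s) \<and> (w r - w s) / (r - s) \<le> M" if "r \<noteq> s" for r
  proof (cases "s < r")
    case True
    then have "m * (r - s) \<le> w r - w s" "w r - w s \<le> M * (r - s)" using w by (auto simp: slopes_in_def)
    then show ?thesis using True by (simp add: le_divide_eq divide_le_eq)
  next
    case False
    then have "m * (s - r) \<le> w s - w r" "w s - w r \<le> M * (s - r)" using w by (auto simp: slopes_in_def)
    moreover have "(w r - w s) / (r - s) = (w s - w r) / (s - r)" by (metis minus_diff_eq minus_divide_divide)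
    ultimately show ?thesis using False that by (simp add: le_divide_eq divide_le_eq)
  qed
  ultimately show "m \<le> z" "z \<le> M"
    by (auto intro!: tendsto_lowerbound[OF l] tendsto_upperbound[OF l] simp: eventually_at_filter)
qed

lemma continuous_on_gcost [continuous_intros]:
  "continuous_on S f \<Longrightarrow> continuous_on S (\<lambda>s. gcost a b (f s))"
  unfolding gcost_def by (intro continuous_intros)

lemma gcost_nonneg: "0 \<le> a \<Longrightarrow> 0 \<le> b \<Longrightarrow> 0 \<le> gcost a b y"
  by (simp add: gcost_def)

definition cost1 :: "real \<Rightarrow> real \<Rightarrow> real \<Rightarrow> (real \<Rightarrow> real) \<Rightarrow> (real \<Rightarrow> real) \<Rightarrow> real" where
  "cost1 a b t Y v = integral {0..t} (\<lambda>s. 1/2 * (v s)\<^sup>2 + gcost a b (Y s))"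

lemma cost1_integrable:
  assumes "ac_curve t Y v" "0 \<le> t"
  shows "(\<lambda>s. 1/2 * (v s)\<^sup>2 + gcost a b (Y s)) integrable_on {0..t}"
  by (rule integrable_add[OF integrable_cmul[OF ac_curve_square_integrable[OF assms], of "1/2", unfolded real_scaleR_def]
      integrable_continuous_real[OF continuous_on_gcost[OF ac_curve_continuous[OF assms(1)]]]])

lemma C1_imp_ac_curve:
  fixes A :: "real \<Rightarrow> 'a::euclidean_space"
  assumes A: "\<And>s. (A has_vector_derivative w s) (at s)" and cw: "continuous_on {0..t} w"
  shows "ac_curve t A w"
proof -
  obtain B where B: "\<And>s. s \<in> {0..t} \<Longrightarrow> norm (w s) \<le> B" "B > 0"
    using compact_imp_bounded[OF compact_continuous_image[OF cw compact_Icc]] unfolding bounded_pos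
    by (metis imageI)
  have "B-lipschitz_on {0..t} A"
  proof (rule bounded_derivative_imp_lipschitz)
    fix s assume s: "s \<in> {0..t}"
    show "(A has_derivative (\<lambda>h. h *\<^sub>R w s)) (at s within {0..t})"
      using has_vector_derivative_at_within[OF A[of s], of "{0..t}"] by (simp only: has_vector_derivative_def)
    show "onorm (\<lambda>h. h *\<^sub>R w s) \<le> B" using B(1)[OF s]
      by (intro onorm_le) (auto simp: mult.commute[of B] intro!: mult_left_mono)
  qed (use B in auto)
  then show ?thesis
    by (rule ac_curveI[of _ _ _ "{}"]) (auto intro: has_vector_derivative_at_within A)
qed

text \<open>Integrate \<open>(w Y)' = w' Y + w v\<close>, where \<open>w' Y \<le> gcost a b Y\<close> because the slopes of \<open>w\<close> are subgradients of
  \<open>gcost a b\<close> at \<open>0\<close>. The deficit in Young's inequality is kept: it yields the uniqueness of the maximiser.\<close>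

lemma weak_duality:
  assumes Y: "ac_curve t Y v" and w: "slopes_in (- b) a w" and ab: "0 \<le> a" "0 \<le> b" and t: "0 < t"
    and A: "\<And>s. (A has_real_derivative w s) (at s)"
  shows "w t * Y t - 1/2 * integral {0..t} (\<lambda>s. (w s)\<^sup>2) + 1/2 * integral {0..t} (\<lambda>s. (v s - w s)\<^sup>2)
    \<le> cost1 a b t Y v + w 0 * Y 0" (is ?le)
    and "\<lbrakk>finite N; \<And>s. s \<in> {0..t} - N \<Longrightarrow> v s = w s \<and> (\<exists>z. (w has_real_derivative z) (at s) \<and> z * Y s = gcost a b (Y s))\<rbrakk>
      \<Longrightarrow> w t * Y t - 1/2 * integral {0..t} (\<lambda>s. (w s)\<^sup>2) = cost1 a b t Y v + w 0 * Y 0" (is "_ \<Longrightarrow> PROP ?Q \<Longrightarrow> ?eq")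
proof -
  have t0: "0 \<le> t" using t by simp
  obtain z where z: "ac_curve t w z"
    using lipschitz_imp_ac_curve[OF slopes_in_lipschitz[OF w ab] t0] by blast
  obtain N0 where N0: "negligible N0" "\<And>s. s \<in> {0..t} - N0 \<Longrightarrow> (w has_vector_derivative z s) (at s within {0..t})"
    using z unfolding ac_curve_def by blast
  have zb: "- b \<le> z s" "z s \<le> a" if "s \<in> {0..t} - N0" for s
    using slopes_in_derivative[OF w N0(2)[OF that]] that t by auto
  have cw: "continuous_on {0..t} w" by (rule ac_curve_continuous[OF z])
  have "ac_curve t (\<lambda>s. w s * Y s) (\<lambda>s. z s * Y s + w s * v s)" by (rule ac_curve_mult[OF z Y])
  from has_vector_derivative_has_integral_ae(1)[OF this t0]
  have I1: "((\<lambda>s. z s * Y s + w s * v s) has_integral (w t * Y t - w 0 * Y 0)) {0..t}" .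
  have iw: "(\<lambda>s. (w s)\<^sup>2) integrable_on {0..t}" by (intro integrable_continuous_real continuous_intros cw)
  have Alip: "ac_curve t A w"
    using A cw by (intro C1_imp_ac_curve) (auto simp: has_real_derivative_iff_has_vector_derivative)
  have iv: "(\<lambda>s. (v s - w s)\<^sup>2) integrable_on {0..t}"
    by (rule ac_curve_square_integrable[OF ac_curve_diff[OF Y Alip] t0])
  note ic = cost1_integrable[OF Y t0, of a b]
  \<comment> \<open>Expanding the square leaves w v + g(Y), so only z Y <= g(Y) remains to be
    compared with the integrand of the product rule.\<close>
  define F where "F s = 1/2 * (v s)\<^sup>2 + gcost a b (Y s) + 1/2 * (w s)\<^sup>2 - 1/2 * (v s - w s)\<^sup>2" for s
  have IF: "(F has_integral (cost1 a b t Y v + 1/2 * integral {0..t} (\<lambda>s. (w s)\<^sup>2)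
      - 1/2 * integral {0..t} (\<lambda>s. (v s - w s)\<^sup>2))) {0..t}"
    unfolding F_def cost1_def
    by (intro has_integral_add has_integral_diff has_integral_mult_right integrable_integral ic iw iv)
  have F: "F s = w s * v s + gcost a b (Y s)" for s
    unfolding F_def by (simp add: power2_eq_square algebra_simps)
  \<comment> \<open>On the null set where \<open>z\<close> need not be the derivative of
    \<open>w\<close>, the integrand is replaced by the one it is compared with; the inequality then
    holds at every time.\<close>
  define F' where "F' s = (if s \<in> N0 then z s * Y s + w s * v s else F s)" for s
  have IF': "(F' has_integral (cost1 a b t Y v + 1/2 * integral {0..t} (\<lambda>s. (w s)\<^sup>2)
      - 1/2 * integral {0..t} (\<lambda>s. (v s - w s)\<^sup>2))) {0..t}"
    by (rule has_integral_spike[OF N0(1) _ IF]) (auto simp: F'_def)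
  have "w t * Y t - w 0 * Y 0 \<le> cost1 a b t Y v + 1/2 * integral {0..t} (\<lambda>s. (w s)\<^sup>2)
      - 1/2 * integral {0..t} (\<lambda>s. (v s - w s)\<^sup>2)"
    by (rule has_integral_le[OF I1 IF']) (use zb in \<open>auto simp: F'_def F intro!: gcost_ge\<close>)
  then show ?le by simp
  show ?eq if fin: "finite N" and Q: "PROP ?Q"
  proof -
    have eq: "v s = w s" "z s * Y s = gcost a b (Y s)" if s: "s \<in> {0..t} - (N \<union> N0)" for s
    proof -
      obtain y where y: "(w has_real_derivative y) (at s)" "y * Y s = gcost a b (Y s)" and "v s = w s"
        using Q[of s] s by auto
      then show "v s = w s" by simp
      have "y = z s"
        using vector_derivative_unique_within_closed_interval[of 0 t s w y "z s"] N0(2)[of s] s t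
          has_field_derivative_at_within[OF y(1), of "{0..t}"]
        by (simp add: has_real_derivative_iff_has_vector_derivative)
      then show "z s * Y s = gcost a b (Y s)" using y by simp
    qed
    have neg: "negligible (N \<union> N0)" using N0(1) fin by (simp add: negligible_finite)
    have "((\<lambda>s. 1/2 * (v s)\<^sup>2 + gcost a b (Y s) + 1/2 * (w s)\<^sup>2) has_integral (w t * Y t - w 0 * Y 0)) {0..t}"
      by (rule has_integral_spike[OF neg _ I1]) (use eq in \<open>auto simp: power2_eq_square\<close>)
    moreover have "((\<lambda>s. 1/2 * (v s)\<^sup>2 + gcost a b (Y s) + 1/2 * (w s)\<^sup>2) has_integral
        (cost1 a b t Y v + 1/2 * integral {0..t} (\<lambda>s. (w s)\<^sup>2))) {0..t}"
      unfolding cost1_def by (intro has_integral_add has_integral_mult_right integrable_integral ic iw)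
    ultimately have "w t * Y t - w 0 * Y 0 = cost1 a b t Y v + 1/2 * integral {0..t} (\<lambda>s. (w s)\<^sup>2)"
      by (rule has_integral_unique)
    then show ?thesis by simp
  qed
qed


lemma slopes_in_continuous: "slopes_in (- b) a w \<Longrightarrow> 0 \<le> a \<Longrightarrow> 0 \<le> b \<Longrightarrow> continuous_on S w"
  using slopes_in_lipschitz lipschitz_on_continuous_on by blast

lemma extremal_ac_curve:
  assumes "extremal a b x t p \<gamma> w" "0 \<le> a" "0 \<le> b"
  shows "ac_curve t \<gamma> w"
  using assms unfolding extremal_def
  by (intro C1_imp_ac_curve slopes_in_continuous[of b a]) (auto simp: has_real_derivative_iff_has_vector_derivative)

text \<open>The two expressions for \<open>V1\<close> are the dual value of the momentum and the
  primal cost of the curve; their equality is strong duality for the linear initial cost p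
  y.\<close>

definition optimal_extremal :: "real \<Rightarrow> real \<Rightarrow> real \<Rightarrow> real \<Rightarrow> real \<Rightarrow> (real \<Rightarrow> real) \<Rightarrow> (real \<Rightarrow> real) \<Rightarrow> bool" where
  "optimal_extremal a b x t p \<gamma> w \<longleftrightarrow> extremal a b x t p \<gamma> w \<and> (\<forall>s. gamma1 s x t p a b = \<gamma> s) \<and>
     V1 x t p a b = w t * x - 1/2 * integral {0..t} (\<lambda>s. (w s)\<^sup>2) \<and>
     V1 x t p a b = cost1 a b t \<gamma> w + p * \<gamma> 0"

lemma optimal_extremal_exists:
  assumes ab: "0 < a" "0 < b" and t: "0 < t"
  shows "\<exists>\<gamma> w. optimal_extremal a b x t p \<gamma> w"
proof -
  obtain \<gamma> w C where E: "extremal_data a b x t p \<gamma> w C" "\<And>s. gamma1 s x t p a b = \<gamma> s"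
     "V1 x t p a b = w t * x - C t / 2"
    using extremal_exists[OF ab t, of x p] by blast
  have ex: "extremal a b x t p \<gamma> w" using E(1) by (simp add: extremal_data_def)
  have "((\<lambda>s. (w s)\<^sup>2) has_integral (C t - C 0)) {0..t}"
    using E(1) t by (intro fundamental_theorem_of_calculus)
      (auto simp: extremal_data_def has_real_derivative_iff_has_vector_derivative[symmetric] intro: has_field_derivative_at_within)
  then have V: "V1 x t p a b = w t * x - 1/2 * integral {0..t} (\<lambda>s. (w s)\<^sup>2)"
    using E by (simp add: integral_unique extremal_data_def)
  obtain N where N: "finite N" "\<And>s. s \<in> {0..t} - N \<Longrightarrow> \<exists>z. (w has_real_derivative z) (at s) \<and> z * \<gamma> s = gcost a b (\<gamma> s)"
    and w: "w 0 = p" "\<gamma> t = x" "slopes_in (- b) a w" "\<And>s. (\<gamma> has_real_derivative w s) (at s)"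
    using ex unfolding extremal_def by auto
  have "w t * \<gamma> t - 1/2 * integral {0..t} (\<lambda>s. (w s)\<^sup>2) = cost1 a b t \<gamma> w + w 0 * \<gamma> 0"
    by (rule weak_duality(2)[OF extremal_ac_curve[OF ex] w(3) _ _ t w(4) N(1)]) (use N(2) ab in auto)
  then have "V1 x t p a b = cost1 a b t \<gamma> w + p * \<gamma> 0" using V w by simp
  then show ?thesis unfolding optimal_extremal_def using ex E(2) V by blast
qed

section \<open>The starting point as a function of the initial velocity\<close>

lemma integral_square_zero:
  fixes f :: "real \<Rightarrow> real"
  assumes "continuous_on {0..t} f" "0 < t" "integral {0..t} (\<lambda>s. (f s)\<^sup>2) \<le> 0"
  shows "f 0 = 0"
proof -
  have "continuous_on {0..t} (\<lambda>s. (f s)\<^sup>2)" by (intro continuous_intros assms)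
  moreover from this have "0 \<le> integral {0..t} (\<lambda>s. (f s)\<^sup>2)"
    by (intro integral_nonneg integrable_continuous_real) auto
  ultimately have "((\<lambda>s. (f s)\<^sup>2) has_integral 0) (cbox 0 t)"
    using assms(3) integrable_continuous_real by (metis cbox_interval integrable_integral order_antisym)
  then have "(f 0)\<^sup>2 = 0"
    using has_integral_0_cbox_imp_0[of 0 t "\<lambda>s. (f s)\<^sup>2" 0] \<open>continuous_on {0..t} (\<lambda>s. (f s)\<^sup>2)\<close> assms(2) by auto
  then show ?thesis by simp
qed

text \<open>Cauchy-Schwarz in time, by integrating the square of f minus its mean.\<close>

lemma integral_square_ge:
  fixes f :: "real \<Rightarrow> real"
  assumes i2: "(\<lambda>s. (f s)\<^sup>2) integrable_on {r..t}" and i1: "(f has_integral I) {r..t}" and t: "r < t"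
  shows "I\<^sup>2 / (t - r) \<le> integral {r..t} (\<lambda>s. (f s)\<^sup>2)"
proof -
  define c where "c = I / (t - r)"
  have "((\<lambda>s. (f s)\<^sup>2 - 2 * c * f s + c\<^sup>2) has_integral (integral {r..t} (\<lambda>s. (f s)\<^sup>2) - 2 * c * I + c\<^sup>2 * (t - r))) {r..t}"
    using has_integral_const_real[of "c\<^sup>2" r t] t
    by (intro has_integral_add has_integral_diff has_integral_mult_right integrable_integral i2 i1) (simp add: mult.commute)
  then have "0 \<le> integral {r..t} (\<lambda>s. (f s)\<^sup>2) - 2 * c * I + c\<^sup>2 * (t - r)"
  proof (rule has_integral_nonneg)
    fix s show "0 \<le> (f s)\<^sup>2 - 2 * c * f s + c\<^sup>2"
      using zero_le_power2[of "f s - c"] by (simp add: power2_diff algebra_simps)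
  qed
  moreover have "2 * c * I - c\<^sup>2 * (t - r) = I\<^sup>2 / (t - r)"
  proof -
    have "c * (t - r) = I" unfolding c_def using t by simp
    then have "c\<^sup>2 * (t - r) = c * I" by (simp add: power2_eq_square)
    moreover have "c * I = I\<^sup>2 / (t - r)" unfolding c_def by (simp add: power2_eq_square)
    ultimately show ?thesis by simp
  qed
  ultimately show ?thesis by linarith
qed

text \<open>\<open>k z\<close> is the least cost of going from z to x in time t, and
  \<open>\<pi> z\<close> the initial velocity of the curve that achieves it. As a function of p,
  \<open>V1\<close> is the minimum over z of k(z) + p z, and p = \<pi>(z) characterises the pairs
  that realise it. The quadratic lower bound provides coercivity.\<close>

definition endpoint_duality :: "real \<Rightarrow> real \<Rightarrow> real \<Rightarrow> real \<Rightarrow> (real \<Rightarrow> real) \<Rightarrow> (real \<Rightarrow> real) \<Rightarrow> bool" where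
  "endpoint_duality a b x t \<pi> k \<longleftrightarrow> continuous_on UNIV \<pi> \<and> (\<forall>z. (x - z)\<^sup>2 / (2 * t) \<le> k z) \<and>
     (\<forall>z p. V1 x t p a b \<le> k z + p * z) \<and> (\<forall>z p. V1 x t p a b = k z + p * z \<longleftrightarrow> p = \<pi> z) \<and>
     (\<forall>z. \<exists>\<gamma> w. optimal_extremal a b x t (\<pi> z) \<gamma> w \<and> \<gamma> 0 = z)"

text \<open>The map \<open>\<Gamma>\<close> from the initial velocity to the starting point is
  continuous, decreasing and onto; \<open>\<pi>\<close> is its inverse and \<open>k\<close> the
  resulting conjugate.\<close>

lemma endpoint_duality_exists:
  assumes ab: "0 < a" "0 < b" and t: "0 < t"
  shows "\<exists>\<pi> k. endpoint_duality a b x t \<pi> k"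
proof -
  define V where "V p = V1 x t p a b" for p
  obtain \<gamma> w where opt: "\<And>p. optimal_extremal a b x t p (\<gamma> p) (w p)"
    using optimal_extremal_exists[OF ab t] by metis
  have ex: "extremal a b x t p (\<gamma> p) (w p)"
    and Vw: "V p = w p t * x - 1/2 * integral {0..t} (\<lambda>s. (w p s)\<^sup>2)"
    and Vc: "V p = cost1 a b t (\<gamma> p) (w p) + p * \<gamma> p 0" for p
    using opt[of p] unfolding optimal_extremal_def V_def by auto
  define \<Gamma> where "\<Gamma> p = \<gamma> p 0" for p
  have ac: "ac_curve t (\<gamma> p) (w p)" for p using extremal_ac_curve[OF ex] ab by simp
  have w0: "w p 0 = p" and \<gamma>t: "\<gamma> p t = x" and sl: "slopes_in (- b) a (w p)"
    and d\<gamma>: "\<And>s. (\<gamma> p has_real_derivative w p s) (at s)" for p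
    using ex[of p] unfolding extremal_def by auto
  have cw: "continuous_on {0..t} (w p)" for p using slopes_in_continuous[OF sl] ab by simp
  have lower: "V p + 1/2 * integral {0..t} (\<lambda>s. (v s - w p s)\<^sup>2) \<le> cost1 a b t Y v + p * Y 0"
    if "ac_curve t Y v" "Y t = x" for Y v p
    using weak_duality(1)[OF that(1) sl _ _ t d\<gamma>, of p] ab that(2) by (simp add: Vw w0)
  \<comment> \<open>The extremal of p is tested against the momentum of p'. So \<Gamma>(p) is a
    supergradient of V at p, with a remainder that measures the distance of the velocities.\<close>
  have strong: "V p' + 1/2 * integral {0..t} (\<lambda>s. (w p s - w p' s)\<^sup>2) \<le> V p + (p' - p) * \<Gamma> p" for p p'
    using lower[OF ac \<gamma>t, of p' p] by (simp add: Vc[of p] \<Gamma>_def algebra_simps)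
  have inonneg: "0 \<le> integral {0..t} (\<lambda>s. (w p s - w p' s)\<^sup>2)" for p p'
    by (intro integral_nonneg integrable_continuous_real continuous_intros cw) auto
  have weak: "V p' \<le> V p + (p' - p) * \<Gamma> p" for p p'
    using strong[of p' p] inonneg[of p p'] by linarith
  have strict: "p' = p" if "V p' = V p + (p' - p) * \<Gamma> p" for p p'
  proof -
    have "integral {0..t} (\<lambda>s. (w p s - w p' s)\<^sup>2) \<le> 0" using strong[of p' p] that by simp
    then have "w p 0 - w p' 0 = 0"
      by (intro integral_square_zero[of t "\<lambda>s. w p s - w p' s"] continuous_intros cw t)
    then show ?thesis by (simp add: w0)
  qed
  \<comment> \<open>The velocities of two extremals with the same endpoint differ by a function with
    integral \<Gamma>(p') - \<Gamma>(p). Cauchy-Schwarz bounds both remainders from below, and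
    adding the two supergradient inequalities gives strong monotonicity.\<close>
  have mono: "(\<Gamma> p - \<Gamma> p')\<^sup>2 / t \<le> (p' - p) * (\<Gamma> p - \<Gamma> p')" for p p'
  proof -
    have "((\<lambda>s. w p s - w p' s) has_integral (\<gamma> p t - \<gamma> p' t - (\<gamma> p 0 - \<gamma> p' 0))) {0..t}"
      by (rule has_vector_derivative_has_integral_ae(1)[OF ac_curve_diff[OF ac ac]]) (use t in simp)
    from integral_square_ge[OF _ this t, simplified]
    have "(\<Gamma> p - \<Gamma> p')\<^sup>2 / t \<le> integral {0..t} (\<lambda>s. (w p s - w p' s)\<^sup>2)"
      by (simp add: \<gamma>t \<Gamma>_def power2_commute integrable_continuous_real continuous_intros cw)
    moreover have "integral {0..t} (\<lambda>s. (w p s - w p' s)\<^sup>2) = integral {0..t} (\<lambda>s. (w p' s - w p s)\<^sup>2)"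
      by (simp add: power2_commute)
    ultimately show ?thesis using strong[of p' p] strong[of p p'] 
      by (simp only: left_diff_distrib right_diff_distrib)
  qed
  have lip: "\<bar>\<Gamma> p - \<Gamma> p'\<bar> \<le> t * \<bar>p - p'\<bar>" for p p'
  proof (cases "\<Gamma> p = \<Gamma> p'")
    case False
    have "\<bar>\<Gamma> p - \<Gamma> p'\<bar> * \<bar>\<Gamma> p - \<Gamma> p'\<bar> \<le> t * ((p' - p) * (\<Gamma> p - \<Gamma> p'))"
      using mono[of p p'] t by (simp add: field_simps power2_eq_square)
    also have "\<dots> \<le> (t * \<bar>p - p'\<bar>) * \<bar>\<Gamma> p - \<Gamma> p'\<bar>"
      using t abs_ge_self[of "(p' - p) * (\<Gamma> p - \<Gamma> p')"] by (simp add: abs_mult abs_minus_commute mult.assoc)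
    finally show ?thesis by (rule mult_right_le_imp_le) (use False in simp)
  qed (use t in simp)
  have cont: "continuous_on UNIV \<Gamma>"
  proof -
    have "t-lipschitz_on UNIV \<Gamma>" using lip t by (intro lipschitz_onI) (auto simp: dist_real_def)
    then show ?thesis by (rule lipschitz_on_continuous_on)
  qed
  define A where "A = (a + b) * (\<bar>x\<bar> + t) * t"
  \<comment> \<open>The straight line of velocity p ending at x bounds V(p) from above, and p
    \<Gamma>(p) <= V(p) - V(0) <= V(p) by concavity and V(0) >= 0. So \<Gamma>(p) passes to the side
    opposite to p at least at the rate t/2.\<close>
  have growth: "p * \<Gamma> p \<le> - p\<^sup>2 * t / 2 + p * x + A * (1 + \<bar>p\<bar>)" for p
  proof -
    have der: "((\<lambda>s. x - p * (t - s)) has_real_derivative p) (at s)" for s by (auto intro!: derivative_eq_intros)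
    have acl: "ac_curve t (\<lambda>s. x - p * (t - s)) (\<lambda>s. p)"
      using der by (intro C1_imp_ac_curve) (auto simp: has_real_derivative_iff_has_vector_derivative intro!: continuous_intros)
    have "cost1 a b t (\<lambda>s. x - p * (t - s)) (\<lambda>s. p) \<le> (p\<^sup>2 / 2 + (a + b) * (\<bar>x\<bar> + \<bar>p\<bar> * t)) * t"
    proof -
      have "integral {0..t} (\<lambda>s. 1/2 * p\<^sup>2 + gcost a b (x - p * (t - s))) \<le> integral {0..t} (\<lambda>s. p\<^sup>2 / 2 + (a + b) * (\<bar>x\<bar> + \<bar>p\<bar> * t))"
      proof (rule integral_le[OF cost1_integrable[OF acl]])
        fix s assume s: "s \<in> {0..t}"
        have "gcost a b y \<le> (a + b) * \<bar>y\<bar>" for y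
          using ab by (cases "0 \<le> y") (auto simp: gcost_pos gcost_neg algebra_simps mult_le_0_iff)
        moreover have "\<bar>x - p * (t - s)\<bar> \<le> \<bar>x\<bar> + \<bar>p\<bar> * t"
        proof -
          have "\<bar>x - p * (t - s)\<bar> \<le> \<bar>x\<bar> + \<bar>p\<bar> * \<bar>t - s\<bar>" using abs_triangle_ineq4[of x "p * (t - s)"] by (simp add: abs_mult)
          also have "\<dots> \<le> \<bar>x\<bar> + \<bar>p\<bar> * t" using s by (intro add_left_mono mult_left_mono) auto
          finally show ?thesis .
        qed
        ultimately have "gcost a b (x - p * (t - s)) \<le> (a + b) * (\<bar>x\<bar> + \<bar>p\<bar> * t)"
          using ab by (meson add_nonneg_nonneg less_imp_le mult_left_mono order_trans)
        then show "1/2 * p\<^sup>2 + gcost a b (x - p * (t - s)) \<le> p\<^sup>2 / 2 + (a + b) * (\<bar>x\<bar> + \<bar>p\<bar> * t)" by simp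
      qed (use t in auto)
      then show ?thesis using t by (simp add: cost1_def mult.commute)
    qed
    moreover have "V p \<le> cost1 a b t (\<lambda>s. x - p * (t - s)) (\<lambda>s. p) + p * (x - p * t)"
    proof -
      have "0 \<le> integral {0..t} (\<lambda>s. (p - w p s)\<^sup>2)"
        by (intro integral_nonneg integrable_continuous_real continuous_intros cw) auto
      then show ?thesis using lower[OF acl, of p] by simp
    qed
    moreover have "V 0 \<le> V p - p * \<Gamma> p" using weak[of 0 p] by simp
    moreover have "0 \<le> V 0"
      unfolding Vc[of 0] cost1_def using cost1_integrable[OF ac, of 0] ab t
      by (auto intro!: integral_nonneg add_nonneg_nonneg gcost_nonneg)
    moreover have "(p\<^sup>2 / 2 + (a + b) * (\<bar>x\<bar> + \<bar>p\<bar> * t)) * t + p * (x - p * t)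
      \<le> - p\<^sup>2 * t / 2 + p * x + A * (1 + \<bar>p\<bar>)"
    proof -
      have "0 \<le> (a + b) * t * (t + \<bar>x\<bar> * \<bar>p\<bar>)" using ab t by simp
      then show ?thesis unfolding A_def by (simp add: algebra_simps power2_eq_square)
    qed
    ultimately show ?thesis by linarith
  qed
  have A0: "0 \<le> A" unfolding A_def using ab t by simp
  have surj: "\<exists>p. \<Gamma> p = z" for z
  proof -
    \<comment> \<open>Chosen so that q t / 2 outweighs x, z and the error term; \<Gamma>(q) and
      \<Gamma>(-q) then enclose z.\<close>
    define q where "q = 1 + (2 / t) * (\<bar>x\<bar> + \<bar>z\<bar> + 2 * A)"
    have q1: "1 \<le> q" unfolding q_def using t A0 by simp
    have qt: "q * t / 2 \<ge> \<bar>x\<bar> + \<bar>z\<bar> + 2 * A" unfolding q_def using t by (simp add: field_simps)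
    have Aq: "A * (1 + q) \<le> q * (2 * A)" using A0 q1 mult_right_mono[of 1 q A] by (simp add: algebra_simps)
    have "q * \<Gamma> q \<le> q * (- (q * t / 2) + x + 2 * A)"
      using growth[of q] Aq q1 by (simp add: algebra_simps power2_eq_square)
    then have "\<Gamma> q \<le> - (q * t / 2) + x + 2 * A" using q1 by simp
    then have 1: "\<Gamma> q \<le> z" using qt by linarith
    have "q * - \<Gamma> (- q) \<le> q * (- (q * t / 2) - x + 2 * A)"
      using growth[of "- q"] Aq q1 by (simp add: algebra_simps power2_eq_square)
    then have "- \<Gamma> (- q) \<le> - (q * t / 2) - x + 2 * A" using q1 by (simp only: mult_le_cancel_left)
    then have 2: "z \<le> \<Gamma> (- q)" using qt by linarith
    have "\<exists>p\<ge>- q. p \<le> q \<and> \<Gamma> p = z"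
      by (rule IVT2'[of \<Gamma> q z "- q", OF 1 2]) (use q1 continuous_on_subset[OF cont] in auto)
    then show ?thesis by blast
  qed
  then obtain \<pi> where \<pi>: "\<And>z. \<Gamma> (\<pi> z) = z" by metis
  have inj: "p = p'" if "\<Gamma> p = \<Gamma> p'" for p p'
  proof -
    have "(p - p') * \<Gamma> p' = - ((p' - p) * \<Gamma> p)" unfolding that by algebra
    then have "V p' = V p + (p' - p) * \<Gamma> p" using weak[of p' p] weak[of p p'] by linarith
    then show ?thesis using strict[of p' p] by simp
  qed
  have \<pi>\<Gamma>: "\<pi> (\<Gamma> p) = p" for p using inj[OF \<pi>] .
  have \<pi>mono: "- \<pi> z \<le> - \<pi> z'" if "z \<le> z'" for z z'
  proof (cases "z = z'")
    case False
    have "0 \<le> (\<pi> z' - \<pi> z) * (z - z')"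
      using mono[of "\<pi> z" "\<pi> z'"] t by (simp add: \<pi>) (meson divide_nonneg_pos order_trans zero_le_power2)
    then show ?thesis using that False by (auto simp: zero_le_mult_iff)
  qed simp
  \<comment> \<open>A monotone map with open image is continuous, and the image is the whole line.
    The sign turns a decreasing map into an increasing one.\<close>
  have "continuous_on UNIV (\<lambda>z. - \<pi> z)"
  proof (rule continuous_onI_mono)
    have "(\<lambda>z. - \<pi> z) ` UNIV = UNIV"
      by (rule surjI[of _ "\<lambda>p. \<Gamma> (- p)"]) (simp add: \<pi>\<Gamma>)
    then show "open ((\<lambda>z. - \<pi> z) ` UNIV)" by simp
  qed (use \<pi>mono in auto)
  then have c\<pi>: "continuous_on UNIV \<pi>" using continuous_on_minus[of UNIV "\<lambda>z. - \<pi> z"] by simp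
  define k where "k z = V (\<pi> z) - \<pi> z * z" for z
  have "endpoint_duality a b x t \<pi> k"
    unfolding endpoint_duality_def
  proof (intro conjI allI c\<pi>)
    fix z
    have kc: "k z = cost1 a b t (\<gamma> (\<pi> z)) (w (\<pi> z))"
      unfolding k_def Vc using \<pi>[of z] by (simp add: \<Gamma>_def)
    show "(x - z)\<^sup>2 / (2 * t) \<le> k z"
    proof -
      have "(w (\<pi> z) has_integral (\<gamma> (\<pi> z) t - \<gamma> (\<pi> z) 0)) {0..t}"
        by (rule has_vector_derivative_has_integral_ae(1)[OF ac]) (use t in simp)
      then have "(x - z)\<^sup>2 / t \<le> integral {0..t} (\<lambda>s. (w (\<pi> z) s)\<^sup>2)"
        using integral_square_ge[OF ac_curve_square_integrable[OF ac]] t \<pi>[of z] by (simp add: \<gamma>t \<Gamma>_def)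
      moreover have "integral {0..t} (\<lambda>s. 1/2 * (w (\<pi> z) s)\<^sup>2) \<le> k z"
        unfolding kc cost1_def using t ab
        by (intro integral_le cost1_integrable[OF ac] integrable_continuous_real continuous_intros cw) (auto simp: gcost_nonneg)
      ultimately show ?thesis by simp
    qed
    show "V1 x t p a b \<le> k z + p * z" for p
      using weak[of p "\<pi> z"] by (simp add: k_def V_def \<pi> algebra_simps)
    show "V1 x t p a b = k z + p * z \<longleftrightarrow> p = \<pi> z" for p
      using strict[of p "\<pi> z"] by (auto simp: k_def V_def \<pi> algebra_simps)
    show "\<exists>\<gamma> w. optimal_extremal a b x t (\<pi> z) \<gamma> w \<and> \<gamma> 0 = z"
      using opt[of "\<pi> z"] \<pi>[of z] unfolding \<Gamma>_def by blast
  qed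
  then show ?thesis by blast
qed

section \<open>Duality in several dimensions\<close>

lemma V1_le_cost1:
  assumes ab: "0 < a" "0 < b" and t: "0 < t" and Y: "ac_curve t Y v" "Y t = x"
  shows "V1 x t p a b \<le> cost1 a b t Y v + p * Y 0"
proof -
  obtain \<gamma> w where E: "extremal a b x t p \<gamma> w"
    "V1 x t p a b = w t * x - 1/2 * integral {0..t} (\<lambda>s. (w s)\<^sup>2)"
    using optimal_extremal_exists[OF ab t, of x p] unfolding optimal_extremal_def by blast
  have w: "w 0 = p" "slopes_in (- b) a w" "\<And>s. (\<gamma> has_real_derivative w s) (at s)"
    using E(1) unfolding extremal_def by auto
  have "0 \<le> integral {0..t} (\<lambda>s. (v s - w s)\<^sup>2)"
    using ac_curve_square_integrable[OF ac_curve_diff[OF Y(1) extremal_ac_curve[OF E(1)]]] ab t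
    by (intro integral_nonneg) auto
  then show ?thesis
    using weak_duality(1)[OF Y(1) w(2) _ _ t w(3)] ab Y(2) E(2) w(1) by simp
qed

definition Gcost :: "real^'n \<Rightarrow> real^'n \<Rightarrow> real^'n \<Rightarrow> real" where
  "Gcost a b y = (\<Sum>i\<in>UNIV. gcost (a $ i) (b $ i) (y $ i))"

definition acost :: "real^'n \<Rightarrow> real^'n \<Rightarrow> real \<Rightarrow> (real \<Rightarrow> real^'n) \<Rightarrow> (real \<Rightarrow> real^'n) \<Rightarrow> real" where
  "acost a b t Y v = integral {0..t} (\<lambda>s. 1/2 * (norm (v s))\<^sup>2 + Gcost a b (Y s))"

lemma norm_sq_vec: "(norm v)\<^sup>2 = (\<Sum>i\<in>UNIV. (v $ i)\<^sup>2)" for v :: "real^'n"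
  unfolding power2_norm_eq_inner inner_vec_def by (simp add: power2_eq_square)

lemma ac_curve_component: "ac_curve t Y v \<Longrightarrow> ac_curve t (\<lambda>s. Y s $ i) (\<lambda>s. v s $ i)"
  for Y :: "real \<Rightarrow> real^'n"
  using ac_curve_linear[of t Y v "\<lambda>x. x $ i"] bounded_linear_vec_nth by blast

lemma acost_eq_sum:
  assumes Y: "ac_curve t Y v" and t: "0 \<le> t"
  shows "acost a b t Y v = (\<Sum>i\<in>UNIV. cost1 (a $ i) (b $ i) t (\<lambda>s. Y s $ i) (\<lambda>s. v s $ i))"
    and "(\<lambda>s. 1/2 * (norm (v s))\<^sup>2 + Gcost a b (Y s)) integrable_on {0..t}"
proof -
  have eq: "(\<lambda>s. 1/2 * (norm (v s))\<^sup>2 + Gcost a b (Y s)) =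
    (\<lambda>s. \<Sum>i\<in>UNIV. 1/2 * (v s $ i)\<^sup>2 + gcost (a $ i) (b $ i) (Y s $ i))"
    by (simp add: norm_sq_vec Gcost_def sum.distrib sum_distrib_left)
  note i = cost1_integrable[OF ac_curve_component[OF Y] t]
  show "acost a b t Y v = (\<Sum>i\<in>UNIV. cost1 (a $ i) (b $ i) t (\<lambda>s. Y s $ i) (\<lambda>s. v s $ i))"
    unfolding acost_def eq cost1_def by (intro integral_sum i) auto
  show "(\<lambda>s. 1/2 * (norm (v s))\<^sup>2 + Gcost a b (Y s)) integrable_on {0..t}"
    unfolding eq by (intro integrable_sum i) auto
qed

lemma V1_sum_le_acost:
  assumes ab: "\<And>i. 0 < a $ i" "\<And>i. 0 < b $ i" and t: "0 < t" and Y: "ac_curve t Y v"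
  shows "(\<Sum>i\<in>UNIV. V1 (Y t $ i) t (p $ i) (a $ i) (b $ i)) \<le> acost a b t Y v + p \<bullet> Y 0"
proof -
  have "(\<Sum>i\<in>UNIV. V1 (Y t $ i) t (p $ i) (a $ i) (b $ i)) \<le>
     (\<Sum>i\<in>UNIV. cost1 (a $ i) (b $ i) t (\<lambda>s. Y s $ i) (\<lambda>s. v s $ i) + p $ i * Y 0 $ i)"
    by (intro sum_mono V1_le_cost1 ab t ac_curve_component[OF Y] refl)
  also have "\<dots> = acost a b t Y v + p \<bullet> Y 0"
    using t by (simp add: acost_eq_sum[OF Y] sum.distrib inner_vec_def)
  finally show ?thesis .
qed

text \<open>An e-subgradient: the point at depth e below the graph is strictly separated from the
  closed epigraph. That this point and the graph point above it lie on different sides shows that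
  the hyperplane is not vertical.\<close>

lemma convex_affine_minorant:
  fixes \<Psi> :: "'a::euclidean_space \<Rightarrow> real"
  assumes c: "convex_on UNIV \<Psi>" and e: "0 < e"
  obtains q where "\<And>z. \<Psi> y - e + q \<bullet> (z - y) \<le> \<Psi> z"
proof -
  have cont: "continuous_on UNIV \<Psi>" using convex_on_continuous[OF open_UNIV c] .
  have "convex (epigraph UNIV \<Psi>)" using c by (simp add: convex_epigraph)
  moreover have "closed (epigraph UNIV \<Psi>)"
  proof -
    have "epigraph UNIV \<Psi> = {x. \<Psi> (fst x) \<le> snd x}" by (auto simp: epigraph_def)
    then show ?thesis
      by (simp add: closed_Collect_le continuous_intros continuous_on_compose2[OF cont])
  qed
  moreover have "(y, \<Psi> y - e) \<notin> epigraph UNIV \<Psi>" using e by (simp add: epigraph_def)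
  ultimately obtain u \<beta> where u: "u \<bullet> (y, \<Psi> y - e) < \<beta>" "\<And>x. x \<in> epigraph UNIV \<Psi> \<Longrightarrow> u \<bullet> x > \<beta>"
    by (metis separating_hyperplane_closed_point)
  obtain q c where qc: "u = (q, c)" by (cases u)
  have lt: "q \<bullet> y + c * (\<Psi> y - e) < q \<bullet> z + c * \<Psi> z" for z
    using u(1) u(2)[of "(z, \<Psi> z)"] unfolding qc by (simp add: inner_prod_def epigraph_def)
  have c0: "0 < c" using lt[of y] e by (simp add: algebra_simps zero_less_mult_iff)
  show thesis
  proof (rule that)
    fix z
    have "c * (\<Psi> y - e + (- (1/c) *\<^sub>R q) \<bullet> (z - y)) \<le> c * \<Psi> z"
      using lt[of z] c0 by (simp add: inner_diff_right algebra_simps)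
    then show "\<Psi> y - e + (- (1/c) *\<^sub>R q) \<bullet> (z - y) \<le> \<Psi> z" using c0 by simp
  qed
qed

lemma coercive_attains_min:
  fixes F :: "'a::euclidean_space \<Rightarrow> real"
  assumes F: "continuous_on UNIV F" and t: "0 < t"
    and lb: "\<And>z. (norm (y - z))\<^sup>2 / (2 * t) + \<beta> + q \<bullet> (z - y) \<le> F z"
  obtains z0 where "\<And>z. F z0 \<le> F z"
proof -
  \<comment> \<open>Outside this radius r the first summand makes the quadratic term at least (|q| +
    1) r, and the second makes the remaining r at least F(y) - \<beta>.\<close>
  define R where "R = 2 * t * (norm q + 1) + \<bar>F y - \<beta>\<bar>"
  have R0: "0 \<le> R" unfolding R_def using t by simp
  obtain z0 where z0: "z0 \<in> cball y R" "\<And>z. z \<in> cball y R \<Longrightarrow> F z0 \<le> F z"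
    using continuous_attains_inf[OF compact_cball _ continuous_on_subset[OF F], of y R] R0 by auto
  show thesis
  proof (rule that)
    fix z
    show "F z0 \<le> F z"
    proof (cases "z \<in> cball y R")
      case False
      define r where "r = norm (y - z)"
      have r: "R < r" using False by (simp add: r_def dist_norm)
      have "r * (norm q + 1) \<le> r * (r / (2 * t))"
      proof (rule mult_left_mono)
        have "2 * t * (norm q + 1) \<le> r" using r unfolding R_def by linarith
        then show "norm q + 1 \<le> r / (2 * t)" using t by (simp add: field_simps)
      qed (use r R0 in auto)
      moreover have "- (norm q * r) \<le> q \<bullet> (z - y)"
        using Cauchy_Schwarz_ineq2[of q "z - y"] by (simp add: r_def norm_minus_commute abs_le_iff)
      moreover have "\<bar>F y - \<beta>\<bar> \<le> r" using r t unfolding R_def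
        by (smt (verit) mult_nonneg_nonneg norm_ge_zero)
      moreover have "r\<^sup>2 / (2 * t) + \<beta> + q \<bullet> (z - y) \<le> F z" using lb[of z] by (simp add: r_def)
      moreover have "r * (norm q + 1) = norm q * r + r" "r * (r / (2 * t)) = r\<^sup>2 / (2 * t)"
        by (simp_all add: algebra_simps power2_eq_square)
      ultimately have "F y \<le> F z" by linarith
      then show ?thesis using z0(2)[of y] R0 by simp
    qed (rule z0(2))
  qed
qed

lemma has_vector_derivative_vec:
  fixes \<gamma> :: "'n::finite \<Rightarrow> real \<Rightarrow> real"
  assumes "\<And>i. (\<gamma> i has_real_derivative w i) (at s)"
  shows "((\<lambda>s. \<chi> i. \<gamma> i s) has_vector_derivative (\<chi> i. w i)) (at s)"
  unfolding has_vector_derivative_def has_derivative_componentwise_within[of "\<lambda>s. \<chi> i. \<gamma> i s"]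
proof
  fix e :: "real^'n" assume "e \<in> Basis"
  then obtain i where "e = axis i 1" by (auto simp: Basis_vec_def)
  then show "((\<lambda>x. (\<chi> i. \<gamma> i x) \<bullet> e) has_derivative (\<lambda>x. (x *\<^sub>R (\<chi> i. w i)) \<bullet> e)) (at s)"
    using assms[of i] by (simp add: inner_axis has_field_derivative_def mult_commute_abs)
qed

text \<open>The starting point minimises the cost k of reaching y plus \<Psi>. There the momentum p
  = \<pi>(z0), minus the gradient of k, must be a subgradient of \<Psi>; with this p the primal and
  dual values coincide.\<close>

lemma saddle_point:
  fixes \<Psi> :: "real^'n \<Rightarrow> real"
  assumes ab: "\<And>i. 0 < a $ i" "\<And>i. 0 < b $ i" and t: "0 < t" and conv: "convex_on UNIV \<Psi>"
  obtains p \<gamma> w where "\<And>z. \<Psi> (\<gamma> 0) + p \<bullet> (z - \<gamma> 0) \<le> \<Psi> z"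
    "\<gamma> t = y" "w 0 = p" "\<And>s. (\<gamma> has_vector_derivative w s) (at s)" "continuous_on UNIV w"
    "\<And>i. slopes_in (- b $ i) (a $ i) (\<lambda>s. w s $ i)"
    "\<And>s i. gamma1 s (y $ i) t (p $ i) (a $ i) (b $ i) = \<gamma> s $ i"
    "(\<Sum>i\<in>UNIV. V1 (y $ i) t (p $ i) (a $ i) (b $ i)) = w t \<bullet> y - 1/2 * integral {0..t} (\<lambda>s. (norm (w s))\<^sup>2)"
    "\<And>p'. (\<Sum>i\<in>UNIV. V1 (y $ i) t (p' $ i) (a $ i) (b $ i)) \<le> acost a b t \<gamma> w + p' \<bullet> \<gamma> 0"
    "\<And>p'. (\<Sum>i\<in>UNIV. V1 (y $ i) t (p' $ i) (a $ i) (b $ i)) = acost a b t \<gamma> w + p' \<bullet> \<gamma> 0 \<longleftrightarrow> p' = p"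
proof -
  have "\<exists>\<pi> k. endpoint_duality (a $ i) (b $ i) (y $ i) t \<pi> k" for i
    by (rule endpoint_duality_exists[OF ab t])
  then obtain \<pi> k where *: "\<And>i. endpoint_duality (a $ i) (b $ i) (y $ i) t (\<pi> i) (k i)" by metis
  have \<pi>: "continuous_on UNIV (\<pi> i)" and k_ge: "(y $ i - z)\<^sup>2 / (2 * t) \<le> k i z"
    and V1_le: "V1 (y $ i) t q (a $ i) (b $ i) \<le> k i z + q * z"
    and V1_eq: "V1 (y $ i) t q (a $ i) (b $ i) = k i z + q * z \<longleftrightarrow> q = \<pi> i z"
    and opt: "\<exists>\<gamma> w. optimal_extremal (a $ i) (b $ i) (y $ i) t (\<pi> i z) \<gamma> w \<and> \<gamma> 0 = z" for i z q
    using *[of i] unfolding endpoint_duality_def by blast+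
  \<comment> \<open>k is a conjugate, so -\<pi>(z) is its subgradient at z: insert p = \<pi>(z) into
    the bound at z' and into the equality at z.\<close>
  have k_sub: "k i z - \<pi> i z * (z' - z) \<le> k i z'" for i z z'
    using V1_le[of i "\<pi> i z" z'] V1_eq[of i "\<pi> i z" z] by (simp add: algebra_simps)
  have k_cont: "continuous_on UNIV (k i)" for i
  proof (rule continuous_at_imp_continuous_on, rule ballI)
    fix z
    have "(\<pi> i \<longlongrightarrow> \<pi> i z) (at z)" using \<pi>[of i] by (simp add: continuous_on_def)
    then have "((\<lambda>z'. k i z - \<pi> i z * (z' - z)) \<longlongrightarrow> k i z - \<pi> i z * (z - z)) (at z)"
      "((\<lambda>z'. k i z + \<pi> i z' * (z - z')) \<longlongrightarrow> k i z + \<pi> i z * (z - z)) (at z)"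
      by (intro tendsto_intros)+
    then have "(k i \<longlongrightarrow> k i z) (at z)"
      by (intro tendsto_sandwich[of "\<lambda>z'. k i z - \<pi> i z * (z' - z)" "k i" _ "\<lambda>z'. k i z + \<pi> i z' * (z - z')"])
        (use k_sub in \<open>auto simp: algebra_simps\<close>)
    then show "isCont (k i) z" by (simp add: isCont_def)
  qed
  define F where "F z = (\<Sum>i\<in>UNIV. k i (z $ i)) + \<Psi> z" for z
  obtain q where q: "\<And>z. \<Psi> y - 1 + q \<bullet> (z - y) \<le> \<Psi> z"
    using convex_affine_minorant[OF conv, of 1 y] by auto
  obtain z0 where z0: "\<And>z. F z0 \<le> F z"
  proof (rule coercive_attains_min[OF _ t])
    show "continuous_on UNIV F" unfolding F_def
      by (intro continuous_intros continuous_on_compose2[OF k_cont] convex_on_continuous[OF open_UNIV conv]) auto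
    fix z
    have "(norm (y - z))\<^sup>2 / (2 * t) \<le> (\<Sum>i\<in>UNIV. k i (z $ i))"
      unfolding norm_sq_vec sum_divide_distrib using k_ge by (intro sum_mono) simp
    then show "(norm (y - z))\<^sup>2 / (2 * t) + (\<Psi> y - 1) + q \<bullet> (z - y) \<le> F z"
      using q[of z] unfolding F_def by linarith
  qed blast
  define p where "p = (\<chi> i. \<pi> i (z0 $ i))"
  \<comment> \<open>First-order condition at the minimiser. It is tested at z0 + h (z - z0):
    convexity bounds \<Psi>, the subgradient at the moved point bounds k, and after division by h
    the continuity of \<pi> permits h to 0.\<close>
  have sub: "\<Psi> z0 + p \<bullet> (z - z0) \<le> \<Psi> z" for z
  proof -
    have ev: "(\<Sum>i\<in>UNIV. \<pi> i ((z0 + h *\<^sub>R (z - z0)) $ i) * (z - z0) $ i) \<le> \<Psi> z - \<Psi> z0" if h: "0 < h" "h < 1" for h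
    proof -
      let ?z = "z0 + h *\<^sub>R (z - z0)"
      have "F z0 \<le> F ?z" by (rule z0)
      moreover have "(\<Sum>i\<in>UNIV. k i (?z $ i)) - (\<Sum>i\<in>UNIV. k i (z0 $ i)) \<le> - h * (\<Sum>i\<in>UNIV. \<pi> i (?z $ i) * (z - z0) $ i)"
        unfolding sum_distrib_left sum_subtractf[symmetric]
      proof (rule sum_mono)
        fix i
        show "k i (?z $ i) - k i (z0 $ i) \<le> - h * (\<pi> i (?z $ i) * (z - z0) $ i)"
          using k_sub[of i "?z $ i" "z0 $ i"] by (simp add: algebra_simps)
      qed
      moreover have "\<Psi> ?z \<le> \<Psi> z0 + h * (\<Psi> z - \<Psi> z0)"
      proof -
        have "\<Psi> ((1 - h) *\<^sub>R z0 + h *\<^sub>R z) \<le> (1 - h) * \<Psi> z0 + h * \<Psi> z"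
          using conv h by (intro convex_onD[OF conv]) auto
        moreover have "(1 - h) *\<^sub>R z0 + h *\<^sub>R z = ?z" by (simp add: algebra_simps)
        ultimately show ?thesis by (simp add: algebra_simps)
      qed
      ultimately have "h * (\<Sum>i\<in>UNIV. \<pi> i (?z $ i) * (z - z0) $ i) \<le> h * (\<Psi> z - \<Psi> z0)"
        unfolding F_def by linarith
      then show ?thesis using h by (simp only: mult_le_cancel_left_pos)
    qed
    have "((\<lambda>h. \<Sum>i\<in>UNIV. \<pi> i ((z0 + h *\<^sub>R (z - z0)) $ i) * (z - z0) $ i) \<longlongrightarrow>
        (\<Sum>i\<in>UNIV. \<pi> i ((z0 + 0 *\<^sub>R (z - z0)) $ i) * (z - z0) $ i)) (at_right 0)"
    proof (intro tendsto_sum tendsto_mult tendsto_const)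
      fix i
      have "isCont (\<pi> i) ((z0 + 0 *\<^sub>R (z - z0)) $ i)" using \<pi>[of i] by (simp add: continuous_on_eq_continuous_at)
      moreover have "((\<lambda>h. (z0 + h *\<^sub>R (z - z0)) $ i) \<longlongrightarrow> (z0 + 0 *\<^sub>R (z - z0)) $ i) (at_right 0)"
        by (intro tendsto_intros)
      ultimately show "((\<lambda>h. \<pi> i ((z0 + h *\<^sub>R (z - z0)) $ i)) \<longlongrightarrow> \<pi> i ((z0 + 0 *\<^sub>R (z - z0)) $ i)) (at_right 0)"
        by (rule isCont_tendsto_compose)
    qed
    then have "(\<Sum>i\<in>UNIV. \<pi> i ((z0 + 0 *\<^sub>R (z - z0)) $ i) * (z - z0) $ i) \<le> \<Psi> z - \<Psi> z0"
    proof (rule tendsto_upperbound)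
      show "\<forall>\<^sub>F h in at_right 0. (\<Sum>i\<in>UNIV. \<pi> i ((z0 + h *\<^sub>R (z - z0)) $ i) * (z - z0) $ i) \<le> \<Psi> z - \<Psi> z0"
        by (rule eventually_at_rightI[of 0 1]) (use ev in auto)
    qed simp
    then show ?thesis by (simp add: p_def inner_vec_def)
  qed
  have "\<forall>i. \<exists>\<gamma> w. optimal_extremal (a $ i) (b $ i) (y $ i) t (p $ i) \<gamma> w \<and> \<gamma> 0 = z0 $ i"
    using opt unfolding p_def by simp
  then obtain \<gamma> w where o: "\<And>i. optimal_extremal (a $ i) (b $ i) (y $ i) t (p $ i) (\<gamma> i) (w i)"
    and \<gamma>0: "\<And>i. \<gamma> i 0 = z0 $ i" unfolding choice_iff by blast
  have ex: "extremal (a $ i) (b $ i) (y $ i) t (p $ i) (\<gamma> i) (w i)"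
    and ga: "gamma1 s (y $ i) t (p $ i) (a $ i) (b $ i) = \<gamma> i s"
    and Vw: "V1 (y $ i) t (p $ i) (a $ i) (b $ i) = w i t * (y $ i) - 1/2 * integral {0..t} (\<lambda>s. (w i s)\<^sup>2)"
    and kc: "k i (z0 $ i) = cost1 (a $ i) (b $ i) t (\<gamma> i) (w i)" for i s
    using o[of i] V1_eq[of i "p $ i" "z0 $ i"] \<gamma>0[of i] unfolding optimal_extremal_def p_def by simp_all
  define \<gamma>' where "\<gamma>' s = (\<chi> i. \<gamma> i s)" for s
  define w' where "w' s = (\<chi> i. w i s)" for s
  have sl: "slopes_in (- b $ i) (a $ i) (w i)" and d\<gamma>: "(\<gamma> i has_real_derivative w i s) (at s)"
    and w0: "w i 0 = p $ i" and \<gamma>t: "\<gamma> i t = y $ i" for i s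
    using ex[of i] unfolding extremal_def by auto
  have cw: "continuous_on S (w i)" for S i using slopes_in_continuous[OF sl[of i]] ab[of i] by simp
  have cw': "continuous_on UNIV w'" unfolding w'_def by (intro continuous_on_vec_lambda cw)
  have d\<gamma>': "(\<gamma>' has_vector_derivative w' s) (at s)" for s
    unfolding \<gamma>'_def w'_def using d\<gamma> by (rule has_vector_derivative_vec)
  have ac: "ac_curve t \<gamma>' w'"
    by (rule C1_imp_ac_curve[OF d\<gamma>' continuous_on_subset[OF cw']]) simp
  have g0: "\<gamma>' 0 = z0" by (simp add: \<gamma>'_def \<gamma>0 vec_eq_iff)
  have ac_eq: "acost a b t \<gamma>' w' = (\<Sum>i\<in>UNIV. k i (z0 $ i))"
    using t by (subst acost_eq_sum(1)[OF ac]) (auto simp: kc \<gamma>'_def w'_def)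
  show thesis
  proof (rule that[of \<gamma>' p w'])
    show "\<Psi> (\<gamma>' 0) + p \<bullet> (z - \<gamma>' 0) \<le> \<Psi> z" for z unfolding g0 by (rule sub)
    show "\<gamma>' t = y" by (simp add: \<gamma>'_def \<gamma>t vec_eq_iff)
    show "w' 0 = p" by (simp add: w'_def w0 vec_eq_iff)
    show "slopes_in (- b $ i) (a $ i) (\<lambda>s. w' s $ i)" for i using sl by (simp add: w'_def)
    show "gamma1 s (y $ i) t (p $ i) (a $ i) (b $ i) = \<gamma>' s $ i" for s i by (simp add: ga \<gamma>'_def)
    have "integral {0..t} (\<lambda>s. (norm (w' s))\<^sup>2) = (\<Sum>i\<in>UNIV. integral {0..t} (\<lambda>s. (w i s)\<^sup>2))"
      unfolding norm_sq_vec w'_def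
      by (simp, intro integral_sum integrable_continuous_real continuous_intros cw) simp
    then show "(\<Sum>i\<in>UNIV. V1 (y $ i) t (p $ i) (a $ i) (b $ i)) = w' t \<bullet> y - 1/2 * integral {0..t} (\<lambda>s. (norm (w' s))\<^sup>2)"
      by (simp add: Vw sum_subtractf inner_vec_def w'_def sum_divide_distrib)
    have "p' \<bullet> z0 = (\<Sum>i\<in>UNIV. p' $ i * z0 $ i)" for p' by (simp add: inner_vec_def)
    then have rhs: "acost a b t \<gamma>' w' + p' \<bullet> \<gamma>' 0 = (\<Sum>i\<in>UNIV. k i (z0 $ i) + p' $ i * z0 $ i)" for p'
      by (simp add: ac_eq g0 sum.distrib)
    show "(\<Sum>i\<in>UNIV. V1 (y $ i) t (p' $ i) (a $ i) (b $ i)) \<le> acost a b t \<gamma>' w' + p' \<bullet> \<gamma>' 0" for p'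
      unfolding rhs by (intro sum_mono V1_le)
    show "(\<Sum>i\<in>UNIV. V1 (y $ i) t (p' $ i) (a $ i) (b $ i)) = acost a b t \<gamma>' w' + p' \<bullet> \<gamma>' 0 \<longleftrightarrow> p' = p" for p'
    proof
      assume eq: "(\<Sum>i\<in>UNIV. V1 (y $ i) t (p' $ i) (a $ i) (b $ i)) = acost a b t \<gamma>' w' + p' \<bullet> \<gamma>' 0"
      \<comment> \<open>Equality of sums with termwise inequalities forces equality in each
        coordinate, where the maximising p is unique.\<close>
      have "V1 (y $ i) t (p' $ i) (a $ i) (b $ i) = k i (z0 $ i) + p' $ i * z0 $ i" for i
        using sum_mono_inv[OF eq[unfolded rhs] V1_le, of i] by simp
      then show "p' = p" by (simp add: V1_eq p_def vec_eq_iff)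
    next
      assume "p' = p"
      then show "(\<Sum>i\<in>UNIV. V1 (y $ i) t (p' $ i) (a $ i) (b $ i)) = acost a b t \<gamma>' w' + p' \<bullet> \<gamma>' 0"
        unfolding rhs using V1_eq by (intro sum.cong) (auto simp: p_def)
    qed
  qed (use d\<gamma>' cw' in auto)
qed


section \<open>Strong duality for one convex initial cost\<close>

lemma matrix_inv_mult:
  assumes "invertible (P :: real^'n^'n)"
  shows "P ** matrix_inv P = mat 1" "matrix_inv P ** P = mat 1"
  using someI_ex[OF assms[unfolded invertible_def]] unfolding matrix_inv_def by auto

lemma legendre_ge: "ereal (p \<bullet> z - g z) \<le> legendre g p"
  unfolding legendre_def by (rule SUP_upper) simp

lemma legendre_le:
  assumes "\<And>z. p \<bullet> z - g z \<le> c"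
  shows "legendre g p \<le> ereal c"
  unfolding legendre_def by (rule SUP_least) (simp add: assms)

lemma ereal_minus_legendre_le: "ereal v - legendre g p \<le> ereal (v - (p \<bullet> z - g z))"
  using ereal_minus_mono[OF order_refl legendre_ge[of p z g], of "ereal v"] by simp

lemma ereal_minus_legendre_ge:
  assumes "\<And>z. p \<bullet> z - g z \<le> c"
  shows "ereal (v - c) \<le> ereal v - legendre g p"
  using ereal_minus_mono[OF order_refl legendre_le[OF assms], of "ereal v"] by simp

lemma convex_Psi_tilde:
  fixes P :: "real^'n^'n"
  assumes "convex_on UNIV \<Psi>"
  shows "convex_on UNIV (Psi_tilde P u0 \<Psi>)"
proof (rule convex_onI)
  fix h :: real and x y :: "real^'n" assume h: "0 < h" "h < 1"
  have "P *v ((1 - h) *\<^sub>R x + h *\<^sub>R y) + u0 = (1 - h) *\<^sub>R (P *v x + u0) + h *\<^sub>R (P *v y + u0)"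
    by (simp add: matrix_vector_right_distrib matrix_vector_mult_scaleR algebra_simps)
  then show "Psi_tilde P u0 \<Psi> ((1 - h) *\<^sub>R x + h *\<^sub>R y) \<le> (1 - h) * Psi_tilde P u0 \<Psi> x + h * Psi_tilde P u0 \<Psi> y"
    unfolding Psi_tilde_def using h by (simp add: convex_onD[OF assms])
qed simp

text \<open>By Fenchel's inequality the Legendre transform at p is at least p z - \<Psi>(z) with z
  the start of the curve. The terms in p then cancel, so every curve bounds the supremum.\<close>

lemma V_Psi_le:
  assumes ab: "\<And>i. 0 < a $ i" "\<And>i. 0 < b $ i" and t: "0 < t" and Y: "ac_curve t Y v"
    "Y t = matrix_inv P *v (x - u0)"
  shows "V_Psi P u0 a b \<Psi> x t \<le> ereal (acost a b t Y v + Psi_tilde P u0 \<Psi> (Y 0))"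
  unfolding V_Psi_def
proof (rule SUP_least)
  fix p
  let ?S = "\<Sum>i\<in>UNIV. V1 ((matrix_inv P *v x - matrix_inv P *v u0) $ i) t (p $ i) (a $ i) (b $ i)"
  have "?S \<le> acost a b t Y v + p \<bullet> Y 0"
    using V1_sum_le_acost[OF ab t Y(1), of p] by (simp add: Y(2) matrix_vector_mult_diff_distrib)
  then have "ereal (?S - (p \<bullet> Y 0 - Psi_tilde P u0 \<Psi> (Y 0))) \<le> ereal (acost a b t Y v + Psi_tilde P u0 \<Psi> (Y 0))"
    by simp
  then show "V_objective P u0 a b \<Psi> x t p \<le> ereal (acost a b t Y v + Psi_tilde P u0 \<Psi> (Y 0))"
    unfolding V_objective_def using ereal_minus_legendre_le order_trans by blast
qed

text \<open>The saddle point closes the gap. Since p is a subgradient at the start of the curve, the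
  Legendre transform at p is finite, with value \<open>c\<close>. The last two conclusions restate
  the value through an affine function below the initial cost, the form in which it reappears in the
  comparison.\<close>

lemma V_Psi_attained:
  fixes P :: "real^'n^'n"
  assumes ab: "\<And>i. 0 < a $ i" "\<And>i. 0 < b $ i" and t: "0 < t" and conv: "convex_on UNIV \<Psi>"
  obtains \<gamma> w c where
    "V_Psi P u0 a b \<Psi> x t = ereal (acost a b t \<gamma> w + Psi_tilde P u0 \<Psi> (\<gamma> 0))"
    "\<And>s. gamma_Psi P u0 a b \<Psi> s x t = P *v \<gamma> s + u0"
    "\<gamma> t = matrix_inv P *v (x - u0)" "\<And>s. (\<gamma> has_vector_derivative w s) (at s)" "continuous_on UNIV w"
    "\<And>i. slopes_in (- b $ i) (a $ i) (\<lambda>s. w s $ i)"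
    "acost a b t \<gamma> w + Psi_tilde P u0 \<Psi> (\<gamma> 0) =
      w t \<bullet> (matrix_inv P *v (x - u0)) - 1/2 * integral {0..t} (\<lambda>s. (norm (w s))\<^sup>2) - c"
    "\<And>z. w 0 \<bullet> z - c \<le> Psi_tilde P u0 \<Psi> z"
proof -
  define y where "y = matrix_inv P *v (x - u0)"
  define \<Psi>' where "\<Psi>' = Psi_tilde P u0 \<Psi>"
  have conv': "convex_on UNIV \<Psi>'" unfolding \<Psi>'_def by (rule convex_Psi_tilde[OF conv])
  obtain p \<gamma> w where s: "\<And>z. \<Psi>' (\<gamma> 0) + p \<bullet> (z - \<gamma> 0) \<le> \<Psi>' z"
    "\<gamma> t = y" "w 0 = p" "\<And>s. (\<gamma> has_vector_derivative w s) (at s)" "continuous_on UNIV w"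
    "\<And>i. slopes_in (- b $ i) (a $ i) (\<lambda>s. w s $ i)"
    "\<And>s i. gamma1 s (y $ i) t (p $ i) (a $ i) (b $ i) = \<gamma> s $ i"
    "(\<Sum>i\<in>UNIV. V1 (y $ i) t (p $ i) (a $ i) (b $ i)) = w t \<bullet> y - 1/2 * integral {0..t} (\<lambda>s. (norm (w s))\<^sup>2)"
    "\<And>p'. (\<Sum>i\<in>UNIV. V1 (y $ i) t (p' $ i) (a $ i) (b $ i)) \<le> acost a b t \<gamma> w + p' \<bullet> \<gamma> 0"
    "\<And>p'. (\<Sum>i\<in>UNIV. V1 (y $ i) t (p' $ i) (a $ i) (b $ i)) = acost a b t \<gamma> w + p' \<bullet> \<gamma> 0 \<longleftrightarrow> p' = p"
    by (rule saddle_point[OF ab t conv', of y]) blast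
  define v where "v = acost a b t \<gamma> w + \<Psi>' (\<gamma> 0)"
  define c where "c = p \<bullet> \<gamma> 0 - \<Psi>' (\<gamma> 0)"
  have c: "p \<bullet> z - \<Psi>' z \<le> c" for z using s(1)[of z] unfolding c_def by (simp add: inner_diff_right)
  have obj: "V_objective P u0 a b \<Psi> x t q = ereal (\<Sum>i\<in>UNIV. V1 (y $ i) t (q $ i) (a $ i) (b $ i)) - legendre \<Psi>' q" for q
    unfolding V_objective_def y_def \<Psi>'_def by (simp add: matrix_vector_mult_diff_distrib)
  have le: "V_objective P u0 a b \<Psi> x t q \<le> ereal ((\<Sum>i\<in>UNIV. V1 (y $ i) t (q $ i) (a $ i) (b $ i)) - (q \<bullet> \<gamma> 0 - \<Psi>' (\<gamma> 0)))" for q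
    unfolding obj by (rule ereal_minus_legendre_le)
  have eqp: "(\<Sum>i\<in>UNIV. V1 (y $ i) t (p $ i) (a $ i) (b $ i)) = v + c" using s(10)[of p] by (simp add: v_def c_def)
  have leg: "ereal v \<le> V_objective P u0 a b \<Psi> x t p"
    unfolding obj eqp using ereal_minus_legendre_ge[OF c, of "v + c"] by simp
  have V: "V_Psi P u0 a b \<Psi> x t = ereal v"
  proof (rule antisym)
    show "V_Psi P u0 a b \<Psi> x t \<le> ereal v" unfolding V_Psi_def
    proof (rule SUP_least)
      fix q
      have "(\<Sum>i\<in>UNIV. V1 (y $ i) t (q $ i) (a $ i) (b $ i)) - (q \<bullet> \<gamma> 0 - \<Psi>' (\<gamma> 0)) \<le> v"
        using s(9)[of q] by (simp add: v_def)
      then show "V_objective P u0 a b \<Psi> x t q \<le> ereal v" using le[of q] order_trans by fastforce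
    qed
    show "ereal v \<le> V_Psi P u0 a b \<Psi> x t"
      unfolding V_Psi_def by (rule SUP_upper2[of p]) (use leg in auto)
  qed
  have "p_star P u0 a b \<Psi> x t = p" unfolding p_star_def
  proof (rule the_equality)
    have "V_objective P u0 a b \<Psi> x t p \<le> V_Psi P u0 a b \<Psi> x t"
      unfolding V_Psi_def by (rule SUP_upper) simp
    then show "V_objective P u0 a b \<Psi> x t p = V_Psi P u0 a b \<Psi> x t" using leg unfolding V by (rule antisym)
  next
    \<comment> \<open>A maximiser must attain equality in the bound by the optimal curve, and only p
      does. This gives \<open>THE\<close> its meaning in \<open>p_star\<close>.\<close>
    fix q assume "V_objective P u0 a b \<Psi> x t q = V_Psi P u0 a b \<Psi> x t"
    then have "ereal v \<le> ereal ((\<Sum>i\<in>UNIV. V1 (y $ i) t (q $ i) (a $ i) (b $ i)) - (q \<bullet> \<gamma> 0 - \<Psi>' (\<gamma> 0)))"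
      using le[of q] V by simp
    then have "(\<Sum>i\<in>UNIV. V1 (y $ i) t (q $ i) (a $ i) (b $ i)) = acost a b t \<gamma> w + q \<bullet> \<gamma> 0"
      using s(9)[of q] by (simp add: v_def)
    then show "q = p" using s(10) by blast
  qed
  then have g: "gamma_Psi P u0 a b \<Psi> r x t = P *v \<gamma> r + u0" for r
    unfolding gamma_Psi_def using s(7)[unfolded y_def] by simp
  show thesis
  proof (rule that[of \<gamma> w c])
    show "acost a b t \<gamma> w + Psi_tilde P u0 \<Psi> (\<gamma> 0) =
      w t \<bullet> (matrix_inv P *v (x - u0)) - 1/2 * integral {0..t} (\<lambda>s. (norm (w s))\<^sup>2) - c"
      using eqp s(8) unfolding v_def \<Psi>'_def[symmetric] y_def[symmetric] by simp
    show "w 0 \<bullet> z - c \<le> Psi_tilde P u0 \<Psi> z" for z using c[of z] s(3) unfolding \<Psi>'_def by simp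
  qed (use V g s in \<open>simp_all add: v_def \<Psi>'_def y_def\<close>)
qed

lemma V1_0: "0 < a \<Longrightarrow> 0 < b \<Longrightarrow> V1 x 0 p a b = p * x"
proof -
  have *: "V1_nonneg x 0 p a b = p * x" if "0 < a" "0 < b" "0 \<le> p" for x p a b :: real
  proof (cases "0 \<le> x")
    case True
    then show ?thesis using that by (simp add: V1_nonneg_def Omega1_def f1_def)
  next
    case False
    then have "(x, 0, p) \<notin> Omega1 a b" by (simp add: Omega1_def)
    \<comment> \<open>For p = 0 the time p/b is already reached at t = 0, and the second clause of
      \<open>Omega2\<close> applies.\<close>
    moreover have "(x, 0, p) \<in> Omega2 a b" using False that by (cases "p = 0") (auto simp: Omega2_def)
    ultimately show ?thesis by (simp add: V1_nonneg_def f2_def)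
  qed
  assume "0 < a" "0 < b"
  then show ?thesis using *[of a b p x] *[of b a "- p" "- x"] by (simp add: V1_def)
qed

text \<open>At time 0 the supremum is the biconjugate of the initial cost. Affine minorants that
  miss its value by e show that the biconjugate is no smaller.\<close>

lemma V_Psi_0:
  fixes P :: "real^'n^'n"
  assumes ab: "\<And>i. 0 < a $ i" "\<And>i. 0 < b $ i" and conv: "convex_on UNIV \<Psi>" and P: "invertible P"
  shows "V_Psi P u0 a b \<Psi> x 0 = ereal (\<Psi> x)"
proof -
  define y where "y = matrix_inv P *v (x - u0)"
  define \<Psi>' where "\<Psi>' = Psi_tilde P u0 \<Psi>"
  have conv': "convex_on UNIV \<Psi>'" unfolding \<Psi>'_def by (rule convex_Psi_tilde[OF conv])
  have obj: "V_objective P u0 a b \<Psi> x 0 q = ereal (q \<bullet> y) - legendre \<Psi>' q" for q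
    unfolding V_objective_def y_def \<Psi>'_def
    by (simp add: matrix_vector_mult_diff_distrib V1_0[OF ab] inner_vec_def)
  have "P *v y = x - u0" unfolding y_def
    by (simp add: matrix_vector_mul_assoc matrix_inv_mult(1)[OF P])
  then have y: "\<Psi>' y = \<Psi> x" by (simp add: \<Psi>'_def Psi_tilde_def)
  have "V_Psi P u0 a b \<Psi> x 0 = ereal (\<Psi>' y)"
  proof (rule antisym)
    show "V_Psi P u0 a b \<Psi> x 0 \<le> ereal (\<Psi>' y)" unfolding V_Psi_def
    proof (rule SUP_least)
      fix q
      show "V_objective P u0 a b \<Psi> x 0 q \<le> ereal (\<Psi>' y)"
        unfolding obj using ereal_minus_legendre_le[of "q \<bullet> y" \<Psi>' q y] by simp
    qed
    show "ereal (\<Psi>' y) \<le> V_Psi P u0 a b \<Psi> x 0"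
    proof (rule ereal_le_epsilon2)
      fix e :: real assume e: "0 < e"
      obtain q where q: "\<And>z. \<Psi>' y - e + q \<bullet> (z - y) \<le> \<Psi>' z"
        using convex_affine_minorant[OF conv' e, of y] by blast
      have "q \<bullet> z - \<Psi>' z \<le> q \<bullet> y - \<Psi>' y + e" for z using q[of z] by (simp add: inner_diff_right)
      from ereal_minus_legendre_ge[OF this, of "q \<bullet> y"]
      have "ereal (\<Psi>' y - e) \<le> V_objective P u0 a b \<Psi> x 0 q" unfolding obj by simp
      also have "\<dots> \<le> V_Psi P u0 a b \<Psi> x 0" unfolding V_Psi_def by (rule SUP_upper) simp
      finally have "ereal (\<Psi>' y - e) + ereal e \<le> V_Psi P u0 a b \<Psi> x 0 + ereal e" by (rule add_right_mono)
      then show "ereal (\<Psi>' y) \<le> V_Psi P u0 a b \<Psi> x 0 + ereal e" by simp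
    qed
  qed
  then show ?thesis using y by simp
qed

section \<open>Value functions of convex Lagrangians\<close>

text \<open>What remains of the explicit formulas: V bounds no curve's cost from above and is
  attained by a C1 curve. \<open>Q\<close> measures velocities and \<open>R\<close> momenta;
  \<open>dual\<close> says that R is the inverse transpose of Q, so that \<open>lag\<close> and
  \<open>ham\<close> below are Legendre dual.\<close>

locale value_function =
  fixes Q R :: "'a::euclidean_space \<Rightarrow> 'a" and F \<Phi> :: "'a \<Rightarrow> real" and K :: real
    and V :: "'a \<Rightarrow> real \<Rightarrow> real" and \<alpha> :: 'a and \<beta> :: real
  assumes Q: "linear Q" and R: "linear R" and dual: "\<And>q v. q \<bullet> v = R q \<bullet> Q v"
    and F_nonneg: "\<And>x. 0 \<le> F x" and F_lip: "\<And>x y. \<bar>F x - F y\<bar> \<le> K * norm (x - y)"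
    and Phi_lip: "\<And>r. \<exists>C. \<forall>x y. norm x \<le> r \<longrightarrow> norm y \<le> r \<longrightarrow> \<bar>\<Phi> x - \<Phi> y\<bar> \<le> C * norm (x - y)"
    and Phi_lb: "\<And>x. \<alpha> \<bullet> x + \<beta> \<le> \<Phi> x"
    and V_0: "\<And>x. V x 0 = \<Phi> x"
    and V_le: "\<And>t X v. 0 < t \<Longrightarrow> ac_curve t X v \<Longrightarrow>
      V (X t) t \<le> integral {0..t} (\<lambda>s. 1/2 * (norm (Q (v s)))\<^sup>2 + F (X s)) + \<Phi> (X 0)"
    and V_attained: "\<And>t x. 0 < t \<Longrightarrow> \<exists>X v. X t = x \<and> (\<forall>s. (X has_vector_derivative v s) (at s)) \<and>
      continuous_on UNIV v \<and> V x t = integral {0..t} (\<lambda>s. 1/2 * (norm (Q (v s)))\<^sup>2 + F (X s)) + \<Phi> (X 0)"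
begin

definition lag :: "'a \<Rightarrow> 'a \<Rightarrow> real" where
  "lag x v = 1/2 * (norm (Q v))\<^sup>2 + F x"

definition ham :: "'a \<Rightarrow> 'a \<Rightarrow> real" where
  "ham x q = 1/2 * (norm (R q))\<^sup>2 - F x"

definition optimal :: "'a \<Rightarrow> real \<Rightarrow> (real \<Rightarrow> 'a) \<Rightarrow> (real \<Rightarrow> 'a) \<Rightarrow> bool" where
  "optimal x t X v \<longleftrightarrow> X t = x \<and> (\<forall>s. (X has_vector_derivative v s) (at s)) \<and>
      continuous_on UNIV v \<and> V x t = integral {0..t} (\<lambda>s. lag (X s) (v s)) + \<Phi> (X 0)"

lemma optimal_exists: "0 < t \<Longrightarrow> \<exists>X v. optimal x t X v"
  using V_attained[of t x] unfolding optimal_def lag_def by auto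

lemma value_le: "0 < t \<Longrightarrow> ac_curve t X v \<Longrightarrow> V (X t) t \<le> integral {0..t} (\<lambda>s. lag (X s) (v s)) + \<Phi> (X 0)"
  using V_le unfolding lag_def by auto

lemma K_nonneg: "0 \<le> K"
proof -
  obtain e :: 'a where "e \<in> Basis" using nonempty_Basis by blast
  then have "0 \<le> K * norm (e - 0)" using F_lip[of e 0] by linarith
  then show ?thesis using \<open>e \<in> Basis\<close> by simp
qed

definition \<rho> :: real where "\<rho> = (SOME r. 0 < r \<and> (\<forall>x. norm (R x) \<le> r * norm x))"

lemma rho: "0 < \<rho>" "norm (R x) \<le> \<rho> * norm x"
proof -
  have "\<exists>r. 0 < r \<and> (\<forall>x. norm (R x) \<le> r * norm x)"
    using linear_bounded_pos[OF R] by metis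
  from someI_ex[OF this] show "0 < \<rho>" "norm (R x) \<le> \<rho> * norm x" unfolding \<rho>_def by auto
qed

lemma inner_le_rho: "\<bar>q \<bullet> v\<bar> \<le> \<rho> * norm q * norm (Q v)"
proof -
  have "\<bar>q \<bullet> v\<bar> \<le> norm (R q) * norm (Q v)" unfolding dual[of q v] by (rule Cauchy_Schwarz_ineq2)
  also have "\<dots> \<le> \<rho> * norm q * norm (Q v)" by (intro mult_right_mono rho) simp
  finally show ?thesis .
qed

lemma Q_surj: "\<exists>v. Q v = z"
proof -
  have "inj Q"
  proof (rule linear_injective_0[OF Q, THEN iffD2], intro allI impI)
    fix x assume "Q x = 0"
    then show "x = 0" using dual[of x x] by simp
  qed
  then show ?thesis using linear_injective_imp_surjective[OF Q] by (metis surjD)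
qed

lemma Q_bounded_linear: "bounded_linear Q" using Q linear_conv_bounded_linear by blast

lemma continuous_on_Q [continuous_intros]: "continuous_on S f \<Longrightarrow> continuous_on S (\<lambda>x. Q (f x))"
  by (rule bounded_linear.continuous_on[OF Q_bounded_linear])

lemma continuous_on_F [continuous_intros]: "continuous_on S f \<Longrightarrow> continuous_on S (\<lambda>x. F (f x))"
proof -
  have "K-lipschitz_on UNIV F" using F_lip K_nonneg by (intro lipschitz_onI) (auto simp: dist_norm)
  then have "continuous_on UNIV F" by (rule lipschitz_on_continuous_on)
  then show "continuous_on S f \<Longrightarrow> continuous_on S (\<lambda>x. F (f x))" by (rule continuous_on_compose2) auto
qed

lemma continuous_on_lag: "continuous_on S X \<Longrightarrow> continuous_on S v \<Longrightarrow> continuous_on S (\<lambda>s. lag (X s) (v s))"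
  unfolding lag_def by (intro continuous_intros)

lemma optimal_continuous: "optimal x t X v \<Longrightarrow> continuous_on S X" "optimal x t X v \<Longrightarrow> continuous_on S v"
  unfolding optimal_def
  by (auto intro: continuous_on_subset has_vector_derivative_continuous continuous_at_imp_continuous_on)

lemma lag_nonneg: "0 \<le> lag x v" unfolding lag_def using F_nonneg[of x] by simp

text \<open>One half of dynamic programming: the initial part of an optimal curve competes for the
  value at the intermediate point.\<close>

lemma optimal_restrict:
  assumes o: "optimal x t X v" and s: "0 \<le> s" "s \<le> t"
  shows "V (X s) s + integral {s..t} (\<lambda>r. lag (X r) (v r)) \<le> V x t"
proof -
  have "V (X s) s \<le> integral {0..s} (\<lambda>s. lag (X s) (v s)) + \<Phi> (X 0)"
  proof (cases "s = 0")
    case False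
    have "ac_curve s X v"
      using o by (intro C1_imp_ac_curve optimal_continuous(2)[OF o]) (auto simp: optimal_def)
    then show ?thesis using value_le False s by simp
  qed (simp add: V_0)
  moreover have "integral {0..s} (\<lambda>r. lag (X r) (v r)) + integral {s..t} (\<lambda>r. lag (X r) (v r)) = integral {0..t} (\<lambda>r. lag (X r) (v r))"
    using s by (intro Henstock_Kurzweil_Integration.integral_combine integrable_continuous_real continuous_on_lag optimal_continuous[OF o])
  ultimately show ?thesis using o by (simp add: optimal_def)
qed

text \<open>Cauchy-Schwarz in time, applied to the velocity in the direction of the displacement. As
  F is nonnegative, the kinetic energy is at most the cost, so bounded cost gives a Hoelder bound of
  exponent 1/2.\<close>

lemma energy_bound:
  assumes d: "\<And>s. (X has_vector_derivative v s) (at s)" and cv: "continuous_on {r..t} v" and rt: "r < t"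
    and Xc: "continuous_on {r..t} X"
  shows "(norm (X t - X r))\<^sup>2 \<le> 2 * \<rho>\<^sup>2 * (t - r) * integral {r..t} (\<lambda>s. lag (X s) (v s))"
proof (cases "X t = X r")
  case True
  have "0 \<le> integral {r..t} (\<lambda>s. lag (X s) (v s))"
    by (intro integral_nonneg integrable_continuous_real continuous_on_lag Xc cv lag_nonneg)
  then show ?thesis using True rt by simp
next
  case False
  define e where "e = X t - X r"
  have "((\<lambda>s. e \<bullet> v s) has_integral (e \<bullet> X t - e \<bullet> X r)) {r..t}"
    by (rule fundamental_theorem_of_calculus[OF less_imp_le[OF rt]])
      (rule bounded_linear.has_vector_derivative[OF bounded_linear_inner_right has_vector_derivative_at_within[OF d]])
  then have I: "((\<lambda>s. e \<bullet> v s) has_integral (norm e)\<^sup>2) {r..t}"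
    by (simp add: e_def power2_norm_eq_inner inner_diff_right)
  have "((norm e)\<^sup>2)\<^sup>2 / (t - r) \<le> integral {r..t} (\<lambda>s. (e \<bullet> v s)\<^sup>2)"
    by (rule integral_square_ge[OF _ I rt]) (intro integrable_continuous_real continuous_intros cv)
  also have "\<dots> \<le> integral {r..t} (\<lambda>s. (2 * \<rho>\<^sup>2 * (norm e)\<^sup>2) * lag (X s) (v s))"
  proof (rule integral_le)
    show "(\<lambda>s. (e \<bullet> v s)\<^sup>2) integrable_on {r..t}"
      by (intro integrable_continuous_real continuous_intros cv)
    show "(\<lambda>s. (2 * \<rho>\<^sup>2 * (norm e)\<^sup>2) * lag (X s) (v s)) integrable_on {r..t}"
      by (intro integrable_continuous_real continuous_on_mult continuous_on_const continuous_on_lag Xc cv)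
    fix s
    have "(e \<bullet> v s)\<^sup>2 \<le> (\<rho> * norm e * norm (Q (v s)))\<^sup>2"
      using inner_le_rho[of e "v s"] rho(1) by (intro abs_le_square_iff[THEN iffD1]) (simp add: abs_mult)
    also have "\<dots> = (2 * \<rho>\<^sup>2 * (norm e)\<^sup>2) * (1/2 * (norm (Q (v s)))\<^sup>2)" by (simp add: power_mult_distrib)
    also have "\<dots> \<le> (2 * \<rho>\<^sup>2 * (norm e)\<^sup>2) * lag (X s) (v s)"
      unfolding lag_def using F_nonneg by (intro mult_left_mono) auto
    finally show "(e \<bullet> v s)\<^sup>2 \<le> (2 * \<rho>\<^sup>2 * (norm e)\<^sup>2) * lag (X s) (v s)" .
  qed
  also have "\<dots> = (norm e)\<^sup>2 * (2 * \<rho>\<^sup>2 * integral {r..t} (\<lambda>s. lag (X s) (v s)))" by simp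
  finally have "(norm e)\<^sup>2 * (norm e)\<^sup>2 \<le> (norm e)\<^sup>2 * (2 * \<rho>\<^sup>2 * (t - r) * integral {r..t} (\<lambda>s. lag (X s) (v s)))"
    using rt by (simp add: field_simps power2_eq_square)
  then have "(norm e)\<^sup>2 \<le> 2 * \<rho>\<^sup>2 * (t - r) * integral {r..t} (\<lambda>s. lag (X s) (v s))"
    by (rule mult_left_le_imp_le) (use False in \<open>simp add: e_def\<close>)
  then show ?thesis unfolding e_def .
qed

text \<open>Compare with an optimal curve for \<open>(x, s)\<close>, continued by a segment of velocity \<open>v\<close>.\<close>

lemma value_step:
  assumes s: "0 \<le> s" and h: "0 < h"
  shows "V (x + h *\<^sub>R v) (s + h) \<le> V x s + h * (lag x v + K * (h * norm v))"
proof -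
  have seg: "integral {s..s + h} (\<lambda>r. lag (x + (r - s) *\<^sub>R v) v) \<le> h * (lag x v + K * (h * norm v))"
  proof -
    have "integral {s..s + h} (\<lambda>r. lag (x + (r - s) *\<^sub>R v) v) \<le> integral {s..s + h} (\<lambda>r. lag x v + K * (h * norm v))"
    proof (rule integral_le)
      fix r assume r: "r \<in> {s..s + h}"
      have "F (x + (r - s) *\<^sub>R v) - F x \<le> K * norm ((r - s) *\<^sub>R v)"
        using F_lip[of "x + (r - s) *\<^sub>R v" x] by simp
      also have "\<dots> \<le> K * (h * norm v)" using r K_nonneg by (intro mult_left_mono) (auto intro!: mult_right_mono)
      finally show "lag (x + (r - s) *\<^sub>R v) v \<le> lag x v + K * (h * norm v)" unfolding lag_def by simp
    qed (intro integrable_continuous_real continuous_on_lag continuous_intros)+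
    then show ?thesis using h by simp
  qed
  have dseg: "((\<lambda>r. x + (r - s) *\<^sub>R v) has_vector_derivative v) (at r)" for r
    by (auto intro!: derivative_eq_intros)
  show ?thesis
  proof (cases "s = 0")
    case True
    have "ac_curve h (\<lambda>r. x + (r - s) *\<^sub>R v) (\<lambda>r. v)"
      by (rule C1_imp_ac_curve[OF dseg]) simp
    from value_le[OF h this] seg show ?thesis using True by (simp add: V_0)
  next
    case False
    then have s: "0 < s" using s by simp
    obtain X w where o: "optimal x s X w" using optimal_exists[OF s] by blast
    define Y where "Y r = (if r \<le> s then X r else x + (r - s) *\<^sub>R v)" for r
    define u where "u r = (if r \<le> s then w r else v)" for r
    have acX: "ac_curve s X w"
      using o by (intro C1_imp_ac_curve optimal_continuous(2)[OF o]) (auto simp: optimal_def)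
    then obtain L1 where L1: "L1-lipschitz_on {0..s} X" unfolding ac_curve_def by blast
    have L2: "(norm v)-lipschitz_on {s..s + h} (\<lambda>r. x + (r - s) *\<^sub>R v)"
    proof (rule lipschitz_onI)
      fix r r' :: real
      have "(x + (r - s) *\<^sub>R v) - (x + (r' - s) *\<^sub>R v) = (r - r') *\<^sub>R v" by (simp add: algebra_simps)
      then show "dist (x + (r - s) *\<^sub>R v) (x + (r' - s) *\<^sub>R v) \<le> norm v * dist r r'"
        by (simp add: dist_norm)
    qed simp
    \<comment> \<open>The velocity may jump at the junction. The concatenation is an admissible
      Lipschitz competitor, with the junction as its exceptional set.\<close>
    have Yac: "ac_curve (s + h) Y u"
    proof (rule ac_curveI[where N = "{s}"])
      show "(max L1 (norm v))-lipschitz_on {0..s + h} Y" unfolding Y_def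
        by (rule lipschitz_on_concat_max[OF L1 L2]) (use o in \<open>simp add: optimal_def\<close>)
      fix r assume r: "r \<in> {0..s + h}" "r \<notin> {s}"
      show "(Y has_vector_derivative u r) (at r within {0..s + h})"
      proof (rule has_vector_derivative_at_within, cases "r < s")
        case True
        have "(X has_vector_derivative w r) (at r)" using o by (simp add: optimal_def)
        then have "(Y has_vector_derivative w r) (at r)"
          by (rule has_vector_derivative_transform_within_open[where S = "{..<s}"]) (use True in \<open>auto simp: Y_def\<close>)
        then show "(Y has_vector_derivative u r) (at r)" using True by (simp add: u_def)
      next
        case False
        have "(Y has_vector_derivative v) (at r)"
          by (rule has_vector_derivative_transform_within_open[OF dseg, where S = "{s<..}"])
            (use False r in \<open>auto simp: Y_def\<close>)
        then show "(Y has_vector_derivative u r) (at r)" using False r by (simp add: u_def)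
      qed
    qed simp
    have "((\<lambda>r. lag (Y r) (u r)) has_integral integral {0..s} (\<lambda>r. lag (X r) (w r))) {0..s}"
      by (rule has_integral_eq[OF _ integrable_integral[OF integrable_continuous_real[OF
            continuous_on_lag[OF optimal_continuous[OF o]]]]]) (simp add: Y_def u_def)
    moreover have "((\<lambda>r. lag (Y r) (u r)) has_integral integral {s..s + h} (\<lambda>r. lag (x + (r - s) *\<^sub>R v) v)) {s..s + h}"
    proof (rule has_integral_spike_finite[of "{s}"])
      show "((\<lambda>r. lag (x + (r - s) *\<^sub>R v) v) has_integral integral {s..s + h} (\<lambda>r. lag (x + (r - s) *\<^sub>R v) v)) {s..s + h}"
        by (intro integrable_integral integrable_continuous_real continuous_on_lag continuous_intros)
    qed (auto simp: Y_def u_def)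
    ultimately have "((\<lambda>r. lag (Y r) (u r)) has_integral (integral {0..s} (\<lambda>r. lag (X r) (w r)) +
        integral {s..s + h} (\<lambda>r. lag (x + (r - s) *\<^sub>R v) v))) {0..s + h}"
      using s h by (intro has_integral_combine[of 0 s "s + h"]) auto
    moreover have "V (Y (s + h)) (s + h) \<le> integral {0..s + h} (\<lambda>r. lag (Y r) (u r)) + \<Phi> (Y 0)"
      using s h by (intro value_le Yac) simp
    moreover have "Y (s + h) = x + h *\<^sub>R v" "Y 0 = X 0" using s h by (auto simp: Y_def)
    ultimately show ?thesis using seg o by (simp add: integral_unique optimal_def)
  qed
qed

section \<open>A priori bounds and regularity of the value function\<close>

lemma value_upper: "0 \<le> t \<Longrightarrow> V x t \<le> \<Phi> x + t * F x"
  using value_step[of 0 t x 0] linear_0[OF Q] by (cases "t = 0") (auto simp: V_0 lag_def)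

lemma optimal_energy:
  assumes o: "optimal x t X v" and t: "0 < t"
  shows "(norm (x - X 0))\<^sup>2 \<le> 2 * \<rho>\<^sup>2 * t * (V x t - \<Phi> (X 0))"
  using energy_bound[of X v 0 t, OF _ optimal_continuous(2)[OF o] t optimal_continuous(1)[OF o]] o
  by (simp add: optimal_def)

lemma value_lower: "0 \<le> t \<Longrightarrow> \<alpha> \<bullet> x + \<beta> - \<rho>\<^sup>2 * t * (norm \<alpha>)\<^sup>2 / 2 \<le> V x t"
proof (cases "t = 0")
  case False
  assume "0 \<le> t"
  then have t: "0 < t" using False by simp
  obtain X v where o: "optimal x t X v" using optimal_exists[OF t] by blast
  define d where "d = norm (x - X 0)"
  define c where "c = \<rho>\<^sup>2 * t"
  have c: "0 < c" unfolding c_def using rho(1) t by simp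
  have "d\<^sup>2 \<le> 2 * c * (V x t - \<Phi> (X 0))" using optimal_energy[OF o t] by (simp add: d_def c_def mult_ac)
  then have "d\<^sup>2 / (2 * c) \<le> V x t - \<Phi> (X 0)" using c by (simp add: divide_le_eq mult.commute)
  moreover have "\<alpha> \<bullet> X 0 + \<beta> \<le> \<Phi> (X 0)" by (rule Phi_lb)
  moreover have "\<alpha> \<bullet> x - \<alpha> \<bullet> X 0 \<le> norm \<alpha> * d"
    using norm_cauchy_schwarz[of \<alpha> "x - X 0"] by (simp add: d_def inner_diff_right)
  \<comment> \<open>Young's inequality: the energy d^2 / (2 c) absorbs the linear gain from starting
    at distance d in the direction that lowers the affine minorant.\<close>
  moreover have "norm \<alpha> * d \<le> d\<^sup>2 / (2 * c) + c * (norm \<alpha>)\<^sup>2 / 2"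
  proof -
    have "0 \<le> (d - c * norm \<alpha>)\<^sup>2 / (2 * c)" using c by simp
    also have "\<dots> = d\<^sup>2 / (2 * c) + c * (norm \<alpha>)\<^sup>2 / 2 - norm \<alpha> * d"
      using c by (simp add: field_simps power2_eq_square)
    finally show ?thesis by simp
  qed
  ultimately show ?thesis unfolding c_def by linarith
qed (simp add: V_0 Phi_lb)

lemma Phi_bounded: "\<exists>B\<ge>0. \<forall>x. norm x \<le> r \<longrightarrow> \<bar>\<Phi> x\<bar> \<le> B"
proof -
  obtain C where C: "\<And>x y. norm x \<le> \<bar>r\<bar> \<Longrightarrow> norm y \<le> \<bar>r\<bar> \<Longrightarrow> \<bar>\<Phi> x - \<Phi> y\<bar> \<le> C * norm (x - y)"
    using Phi_lip[of "\<bar>r\<bar>"] by blast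
  have "\<bar>\<Phi> x\<bar> \<le> \<bar>\<Phi> 0\<bar> + \<bar>C\<bar> * \<bar>r\<bar>" if "norm x \<le> r" for x
  proof -
    have "\<bar>\<Phi> x - \<Phi> 0\<bar> \<le> C * norm x" using C[of x 0] that by simp
    also have "\<dots> \<le> \<bar>C\<bar> * \<bar>r\<bar>" using that by (intro mult_mono) auto
    finally show ?thesis by linarith
  qed
  then show ?thesis by (intro exI[of _ "\<bar>\<Phi> 0\<bar> + \<bar>C\<bar> * \<bar>r\<bar>"]) auto
qed

lemma F_bounded: "norm x \<le> r \<Longrightarrow> F x \<le> F 0 + K * r"
  using F_lip[of x 0] mult_left_mono[of "norm x" r K] K_nonneg by simp

text \<open>The resting curve bounds the value from above, and the affine minorant bounds the
  initial cost from below by a linear function of the distance d travelled. The energy is quadratic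
  in d, so d is bounded.\<close>

lemma optimal_bounds:
  "\<exists>B\<ge>0. \<forall>x t X v. norm x \<le> r \<longrightarrow> 0 < t \<longrightarrow> t \<le> T \<longrightarrow> optimal x t X v \<longrightarrow>
     norm (X 0) \<le> B \<and> integral {0..t} (\<lambda>s. lag (X s) (v s)) \<le> B"
proof (cases "0 \<le> r \<and> 0 < T")
  case True
  obtain b where b: "0 \<le> b" "\<And>x. norm x \<le> r \<Longrightarrow> \<bar>\<Phi> x\<bar> \<le> b" using Phi_bounded[of r] by blast
  define B1 where "B1 = b + T * (F 0 + K * r) + norm \<alpha> * r + \<bar>\<beta>\<bar>"
  have FK: "0 \<le> F 0 + K * r" using F_nonneg[of 0] K_nonneg True by simp
  have B1: "0 \<le> B1" unfolding B1_def using b FK True by simp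
  \<comment> \<open>For d >= 1 the inequality d^2 <= 2 \<rho>^2 T (B1 + |\<alpha>| d) can be divided
    by d; the summand 1 covers smaller d.\<close>
  define D where "D = 1 + 2 * \<rho>\<^sup>2 * T * (B1 + norm \<alpha>)"
  obtain b' where b': "0 \<le> b'" "\<And>x. norm x \<le> r + D \<Longrightarrow> \<bar>\<Phi> x\<bar> \<le> b'" using Phi_bounded[of "r + D"] by blast
  have D: "0 \<le> D" unfolding D_def using B1 True by simp
  show ?thesis
  proof (intro exI[of _ "r + D + b + T * (F 0 + K * r) + b'"] conjI allI impI)
    fix x t X v assume x: "norm x \<le> r" and t: "0 < t" "t \<le> T" and o: "optimal x t X v"
    define d where "d = norm (x - X 0)"
    have Vx: "V x t \<le> b + T * (F 0 + K * r)"
    proof -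
      have "V x t \<le> \<Phi> x + t * F x" using value_upper t by simp
      also have "\<dots> \<le> b + T * (F 0 + K * r)"
        using b(2)[OF x] F_bounded[OF x] F_nonneg t by (intro add_mono mult_mono) auto
      finally show ?thesis .
    qed
    have "V x t - \<Phi> (X 0) \<le> B1 + norm \<alpha> * d"
    proof -
      have "\<alpha> \<bullet> X 0 + \<beta> \<le> \<Phi> (X 0)" by (rule Phi_lb)
      moreover have "\<alpha> \<bullet> x - \<alpha> \<bullet> X 0 \<le> norm \<alpha> * d"
        using norm_cauchy_schwarz[of \<alpha> "x - X 0"] by (simp add: d_def inner_diff_right)
      moreover have "- (norm \<alpha> * r) \<le> \<alpha> \<bullet> x"
      proof -
        have "\<bar>\<alpha> \<bullet> x\<bar> \<le> norm \<alpha> * norm x" by (rule Cauchy_Schwarz_ineq2)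
        also have "\<dots> \<le> norm \<alpha> * r" using x by (intro mult_left_mono) auto
        finally show ?thesis by linarith
      qed
      ultimately show ?thesis using Vx unfolding B1_def by linarith
    qed
    then have d2: "d\<^sup>2 \<le> 2 * \<rho>\<^sup>2 * T * (B1 + norm \<alpha> * d)"
    proof -
      have "d\<^sup>2 \<le> 2 * \<rho>\<^sup>2 * t * (V x t - \<Phi> (X 0))" using optimal_energy[OF o t(1)] by (simp add: d_def)
      also have "\<dots> \<le> 2 * \<rho>\<^sup>2 * t * (B1 + norm \<alpha> * d)"
        using \<open>V x t - \<Phi> (X 0) \<le> B1 + norm \<alpha> * d\<close> t by (intro mult_left_mono) auto
      also have "\<dots> \<le> 2 * \<rho>\<^sup>2 * T * (B1 + norm \<alpha> * d)"
        using t B1 by (intro mult_right_mono mult_left_mono) (auto simp: d_def)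
      finally show ?thesis .
    qed
    have "d \<le> D"
    proof (cases "d \<le> 1")
      case True
      have "0 \<le> 2 * \<rho>\<^sup>2 * T * (B1 + norm \<alpha>)" using B1 \<open>0 \<le> r \<and> 0 < T\<close> by simp
      then show ?thesis using True unfolding D_def by linarith
    next
      case False
      have "d * d \<le> d * (2 * \<rho>\<^sup>2 * T * (B1 + norm \<alpha>))"
      proof -
        have "d * d \<le> 2 * \<rho>\<^sup>2 * T * (B1 + norm \<alpha> * d)" using d2 by (simp add: power2_eq_square)
        also have "\<dots> \<le> 2 * \<rho>\<^sup>2 * T * (B1 * d + norm \<alpha> * d)"
          using False B1 True mult_left_mono[of 1 d B1] by (intro mult_left_mono) auto
        finally show ?thesis by (simp add: algebra_simps)
      qed
      then have "d \<le> 2 * \<rho>\<^sup>2 * T * (B1 + norm \<alpha>)" using False by simp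
      then show ?thesis unfolding D_def by simp
    qed
    then have X0: "norm (X 0) \<le> r + D"
      using x norm_triangle_ineq4[of x "x - X 0"] unfolding d_def by simp
    have TF: "0 \<le> T * (F 0 + K * r)" using FK True by simp
    show "norm (X 0) \<le> r + D + b + T * (F 0 + K * r) + b'" using X0 TF b(1) b'(1) by linarith
    have "integral {0..t} (\<lambda>s. lag (X s) (v s)) = V x t - \<Phi> (X 0)" using o by (simp add: optimal_def)
    then show "integral {0..t} (\<lambda>s. lag (X s) (v s)) \<le> r + D + b + T * (F 0 + K * r) + b'"
      using Vx b'(2)[OF X0] D True by linarith
  qed (use True b b' D FK in auto)
next
  case False
  then show ?thesis
    by (intro exI[of _ 0]) (auto, (meson norm_ge_zero order_trans less_le_trans)+)
qed

text \<open>Translating an optimal curve for x by y - x keeps its velocity, so only F and the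
  initial cost change, each by a Lipschitz amount. The radius B + 2 |r| contains the starting points
  of both curves.\<close>

lemma value_lipschitz_space:
  "\<exists>C\<ge>0. \<forall>x y t. norm x \<le> r \<longrightarrow> norm y \<le> r \<longrightarrow> 0 \<le> t \<longrightarrow> t \<le> T \<longrightarrow> \<bar>V y t - V x t\<bar> \<le> C * norm (y - x)"
proof -
  obtain B where B: "0 \<le> B" "\<And>x t X v. norm x \<le> r \<Longrightarrow> 0 < t \<Longrightarrow> t \<le> T \<Longrightarrow> optimal x t X v \<Longrightarrow> norm (X 0) \<le> B"
    using optimal_bounds[of r T] by blast
  obtain C where C: "\<And>x y. norm x \<le> B + 2 * \<bar>r\<bar> \<Longrightarrow> norm y \<le> B + 2 * \<bar>r\<bar> \<Longrightarrow> \<bar>\<Phi> x - \<Phi> y\<bar> \<le> C * norm (x - y)"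
    using Phi_lip[of "B + 2 * \<bar>r\<bar>"] by blast
  define C' where "C' = \<bar>C\<bar> + K * \<bar>T\<bar>"
  have C'0: "0 \<le> C'" unfolding C'_def using K_nonneg by simp
  have one: "V y t - V x t \<le> C' * norm (y - x)" if x: "norm x \<le> r" and y: "norm y \<le> r" and t: "0 \<le> t" "t \<le> T" for x y t
  proof -
    have Phi: "\<Phi> (z + (y - x)) - \<Phi> z \<le> \<bar>C\<bar> * norm (y - x)" if "norm z \<le> B + \<bar>r\<bar>" "norm (z + (y - x)) \<le> B + 2 * \<bar>r\<bar>" for z
    proof -
      have "\<bar>\<Phi> (z + (y - x)) - \<Phi> z\<bar> \<le> C * norm (y - x)" using C[of "z + (y - x)" z] that by simp
      also have "\<dots> \<le> \<bar>C\<bar> * norm (y - x)" by (intro mult_right_mono) auto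
      finally show ?thesis by linarith
    qed
    show ?thesis
    proof (cases "t = 0")
      case True
      have "0 \<le> K * \<bar>T\<bar> * norm (y - x)" using K_nonneg by simp
      moreover have "\<Phi> (x + (y - x)) - \<Phi> x \<le> \<bar>C\<bar> * norm (y - x)" using x y B(1) by (intro Phi) auto
      ultimately show ?thesis using True by (simp add: V_0 C'_def distrib_right)
    next
      case False
      then have t0: "0 < t" using t by simp
      obtain X v where o: "optimal x t X v" using optimal_exists[OF t0] by blast
      have "((\<lambda>s. X s + (y - x)) has_vector_derivative v s) (at s)" for s
        using o by (auto simp: optimal_def intro!: derivative_eq_intros)
      then have "ac_curve t (\<lambda>s. X s + (y - x)) v"
        by (rule C1_imp_ac_curve) (rule optimal_continuous(2)[OF o])
      from value_le[OF t0 this] have "V y t \<le> integral {0..t} (\<lambda>s. lag (X s + (y - x)) (v s)) + \<Phi> (X 0 + (y - x))"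
        using o by (simp add: optimal_def)
      also have "integral {0..t} (\<lambda>s. lag (X s + (y - x)) (v s)) \<le> integral {0..t} (\<lambda>s. lag (X s) (v s) + K * norm (y - x))"
      proof (rule integral_le)
        fix s
        show "lag (X s + (y - x)) (v s) \<le> lag (X s) (v s) + K * norm (y - x)"
          using F_lip[of "X s + (y - x)" "X s"] by (simp add: lag_def)
      qed (intro integrable_continuous_real continuous_on_lag continuous_intros optimal_continuous[OF o])+
      also have "\<dots> = integral {0..t} (\<lambda>s. lag (X s) (v s)) + t * (K * norm (y - x))"
        using t by (subst integral_add)
          (auto intro!: integrable_continuous_real continuous_on_lag continuous_intros optimal_continuous[OF o])
      finally have "V y t \<le> V x t + (\<Phi> (X 0 + (y - x)) - \<Phi> (X 0)) + t * (K * norm (y - x))"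
        using o by (simp add: optimal_def)
      moreover have "\<Phi> (X 0 + (y - x)) - \<Phi> (X 0) \<le> \<bar>C\<bar> * norm (y - x)"
      proof (rule Phi)
        have "norm (X 0) \<le> B" using B(2)[OF x t0 t(2) o] .
        then show "norm (X 0) \<le> B + \<bar>r\<bar>" by simp
        have "norm (X 0 + (y - x)) \<le> norm (X 0) + (norm y + norm x)"
          using norm_triangle_ineq[of "X 0" "y - x"] norm_triangle_ineq4[of y x] by linarith
        then show "norm (X 0 + (y - x)) \<le> B + 2 * \<bar>r\<bar>" using \<open>norm (X 0) \<le> B\<close> x y by linarith
      qed
      moreover have "t * (K * norm (y - x)) \<le> K * \<bar>T\<bar> * norm (y - x)"
        using t K_nonneg mult_right_mono[of t "\<bar>T\<bar>" "K * norm (y - x)"] by (simp add: mult_ac)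
      ultimately show ?thesis unfolding C'_def by (simp add: distrib_right)
    qed
  qed
  have "\<bar>V y t - V x t\<bar> \<le> C' * norm (y - x)" if "norm x \<le> r" "norm y \<le> r" "0 \<le> t" "t \<le> T" for x y t
    using one[OF that] one[OF that(2,1,3,4)] by (simp add: abs_le_iff norm_minus_commute)
  then show ?thesis using C'0 by blast
qed

text \<open>Resting at x bounds the increase. For the decrease, an optimal curve is cut at the
  earlier time s; by the energy bound it is then within a multiple of the square root of t - s of x,
  and Lipschitz continuity in space applies.\<close>

lemma value_continuous_time: "continuous_on {0..} (V x)"
  unfolding continuous_on_def
proof
  fix t0 :: real assume t0: "t0 \<in> {0..}"
  define r where "r = norm x + 1"
  obtain B where B: "0 \<le> B" "\<And>t X v. 0 < t \<Longrightarrow> t \<le> t0 + 1 \<Longrightarrow> optimal x t X v \<Longrightarrow>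
     integral {0..t} (\<lambda>s. lag (X s) (v s)) \<le> B"
    using optimal_bounds[of r "t0 + 1"] unfolding r_def by force
  define D where "D = 2 * \<rho>\<^sup>2 * B"
  have D: "0 \<le> D" unfolding D_def using B(1) by simp
  obtain C where C: "0 \<le> C" "\<And>y z t. norm y \<le> r + D \<Longrightarrow> norm z \<le> r + D \<Longrightarrow> 0 \<le> t \<Longrightarrow> t \<le> t0 + 1 \<Longrightarrow> \<bar>V z t - V y t\<bar> \<le> C * norm (z - y)"
    using value_lipschitz_space[of "r + D" "t0 + 1"] by blast
  have le: "\<bar>V x t - V x s\<bar> \<le> F x * (t - s) + C * sqrt (D * (t - s))" if s: "0 \<le> s" "s < t" "t \<le> t0 + 1" "t - s \<le> 1" for s t
  proof -
    have st: "0 < t - s" using s by simp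
    have up: "V x t - V x s \<le> F x * (t - s)"
      using value_step[OF s(1) st, of x 0] linear_0[OF Q] by (simp add: lag_def mult.commute)
    have t: "0 < t" using s by simp
    obtain X v where o: "optimal x t X v" using optimal_exists[OF t] by blast
    have res: "V (X s) s + integral {s..t} (\<lambda>r. lag (X r) (v r)) \<le> V x t"
      by (rule optimal_restrict[OF o]) (use s in auto)
    have i0: "0 \<le> integral {p..q} (\<lambda>r. lag (X r) (v r))" for p q
      by (intro integral_nonneg integrable_continuous_real continuous_on_lag optimal_continuous[OF o] lag_nonneg)
    have "integral {0..s} (\<lambda>r. lag (X r) (v r)) + integral {s..t} (\<lambda>r. lag (X r) (v r)) = integral {0..t} (\<lambda>r. lag (X r) (v r))"
      using s by (intro Henstock_Kurzweil_Integration.integral_combine integrable_continuous_real continuous_on_lag optimal_continuous[OF o]) auto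
    then have "integral {s..t} (\<lambda>r. lag (X r) (v r)) \<le> B" using i0[of 0 s] B(2)[OF t s(3) o] by linarith
    have "(norm (x - X s))\<^sup>2 \<le> 2 * \<rho>\<^sup>2 * (t - s) * integral {s..t} (\<lambda>s. lag (X s) (v s))"
      using energy_bound[of X v s t, OF _ optimal_continuous(2)[OF o] s(2) optimal_continuous(1)[OF o]] o
      by (simp add: optimal_def)
    also have "\<dots> \<le> 2 * \<rho>\<^sup>2 * (t - s) * B"
      using \<open>integral {s..t} (\<lambda>r. lag (X r) (v r)) \<le> B\<close> st by (intro mult_left_mono) auto
    finally have "(norm (x - X s))\<^sup>2 \<le> D * (t - s)" by (simp add: D_def mult_ac)
    then have n: "norm (x - X s) \<le> sqrt (D * (t - s))" by (rule real_le_rsqrt)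
    have "D * (t - s) \<le> (1 + D)\<^sup>2"
    proof -
      have "D * (t - s) \<le> D * 1" using s D by (intro mult_left_mono) auto
      also have "\<dots> \<le> (1 + D)\<^sup>2" using D by (simp add: power2_sum)
      finally show ?thesis .
    qed
    then have "sqrt (D * (t - s)) \<le> 1 + D" by (rule real_le_lsqrt[rotated]) (use D in simp)
    moreover have "norm (X s) \<le> norm x + norm (x - X s)" using norm_triangle_ineq4[of x "x - X s"] by simp
    ultimately have Xs: "norm (X s) \<le> r + D" using n unfolding r_def by linarith
    have "V x s - V (X s) s \<le> C * norm (x - X s)"
      using C(2)[OF Xs, of x s] s D unfolding r_def by simp
    also have "\<dots> \<le> C * sqrt (D * (t - s))" using n C(1) by (rule mult_left_mono)
    finally have low: "V x s - V x t \<le> C * sqrt (D * (t - s))" using res i0[of s t] by linarith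
    have "0 \<le> F x * (t - s)" "0 \<le> C * sqrt (D * (t - s))" using F_nonneg[of x] st C(1) D by auto
    then show ?thesis using up low by linarith
  qed
  have bound: "\<bar>V x t - V x t0\<bar> \<le> F x * \<bar>t - t0\<bar> + C * sqrt (D * \<bar>t - t0\<bar>)" if "0 \<le> t" "\<bar>t - t0\<bar> \<le> 1" for t
    using le[of t t0] le[of t0 t] that t0 by (cases t t0 rule: linorder_cases) (auto simp: abs_minus_commute)
  have "((\<lambda>t. V x t - V x t0) \<longlongrightarrow> 0) (at t0 within {0..})"
  proof (rule Lim_null_comparison)
    have "((\<lambda>t. F x * \<bar>t - t0\<bar> + C * sqrt (D * \<bar>t - t0\<bar>)) \<longlongrightarrow> F x * \<bar>t0 - t0\<bar> + C * sqrt (D * \<bar>t0 - t0\<bar>)) (at t0 within {0..})"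
      by (intro tendsto_intros)
    then show "((\<lambda>t. F x * \<bar>t - t0\<bar> + C * sqrt (D * \<bar>t - t0\<bar>)) \<longlongrightarrow> 0) (at t0 within {0..})" by simp
    show "\<forall>\<^sub>F t in at t0 within {0..}. norm (V x t - V x t0) \<le> F x * \<bar>t - t0\<bar> + C * sqrt (D * \<bar>t - t0\<bar>)"
      unfolding eventually_at by (intro exI[of _ 1]) (use bound in \<open>auto simp: dist_real_def\<close>)
  qed
  then show "(V x \<longlongrightarrow> V x t0) (at t0 within {0..})" by (rule LIM_zero_cancel)
qed

lemma value_continuous: "continuous_on (UNIV \<times> {0..}) (\<lambda>(x, t). V x t)"
  unfolding continuous_on_def
proof
  fix z0 :: "'a \<times> real" assume "z0 \<in> UNIV \<times> {0..}"
  then obtain x0 t0 where z0: "z0 = (x0, t0)" and t0: "0 \<le> t0" by auto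
  let ?N = "at z0 within UNIV \<times> {0..}"
  obtain C where C: "\<And>x y t. norm x \<le> norm x0 + 1 \<Longrightarrow> norm y \<le> norm x0 + 1 \<Longrightarrow> 0 \<le> t \<Longrightarrow> t \<le> t0 + 1 \<Longrightarrow> \<bar>V y t - V x t\<bar> \<le> C * norm (y - x)"
    using value_lipschitz_space[of "norm x0 + 1" "t0 + 1"] by blast
  have "((\<lambda>z. V (fst z) (snd z) - V x0 t0) \<longlongrightarrow> 0) ?N"
  proof (rule Lim_null_comparison)
    have 1: "((\<lambda>z. V x0 (snd z)) \<longlongrightarrow> V x0 t0) ?N"
    proof (rule continuous_on_tendsto_compose[OF value_continuous_time[of x0]])
      show "(snd \<longlongrightarrow> t0) ?N" unfolding z0 by (auto intro!: tendsto_eq_intros)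
      show "\<forall>\<^sub>F z in ?N. snd z \<in> {0..}" unfolding eventually_at by (intro exI[of _ 1]) auto
    qed (use t0 in simp)
    have "((\<lambda>z. C * norm (fst z - x0) + \<bar>V x0 (snd z) - V x0 t0\<bar>) \<longlongrightarrow> C * norm (fst z0 - x0) + \<bar>V x0 t0 - V x0 t0\<bar>) ?N"
      by (intro tendsto_intros 1)
    then show "((\<lambda>z. C * norm (fst z - x0) + \<bar>V x0 (snd z) - V x0 t0\<bar>) \<longlongrightarrow> 0) ?N" by (simp add: z0)
    show "\<forall>\<^sub>F z in ?N. norm (V (fst z) (snd z) - V x0 t0) \<le> C * norm (fst z - x0) + \<bar>V x0 (snd z) - V x0 t0\<bar>"
      unfolding eventually_at
    proof (intro exI[of _ 1] conjI ballI impI)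
      fix z assume z: "z \<in> UNIV \<times> {0..}" "z \<noteq> z0 \<and> dist z z0 < 1"
      have "dist (fst z) x0 < 1" "dist (snd z) t0 < 1"
        using z dist_fst_le[of z z0] dist_snd_le[of z z0] unfolding z0 by auto
      then have "norm (fst z) \<le> norm x0 + 1" "snd z \<le> t0 + 1" "0 \<le> snd z"
        using norm_triangle_ineq2[of "fst z" x0] z(1) by (auto simp: dist_norm dist_real_def)
      then have "\<bar>V (fst z) (snd z) - V x0 (snd z)\<bar> \<le> C * norm (fst z - x0)" by (intro C) auto
      then show "norm (V (fst z) (snd z) - V x0 t0) \<le> C * norm (fst z - x0) + \<bar>V x0 (snd z) - V x0 t0\<bar>"
        by simp
    qed simp
  qed
  from LIM_zero_cancel[OF this] show "((\<lambda>(x, t). V x t) \<longlongrightarrow> (case z0 of (x, t) \<Rightarrow> V x t)) ?N"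
    by (simp add: z0 split_def)
qed

lemma value_in_class_G: "V \<in> class_G"
  unfolding class_G_def
proof (intro CollectI conjI allI impI)
  show "continuous_on (UNIV \<times> {0..}) (\<lambda>(x, t). V x t)" by (rule value_continuous)
  show "\<exists>\<alpha>. \<forall>T>0. \<exists>C. \<forall>x. \<forall>t\<in>{0..T}. C \<le> V x t - \<alpha> \<bullet> x"
  proof (intro exI[of _ \<alpha>] allI impI)
    fix T :: real assume T: "0 < T"
    have "\<beta> - \<rho>\<^sup>2 * T * (norm \<alpha>)\<^sup>2 / 2 \<le> V x t - \<alpha> \<bullet> x" if t: "t \<in> {0..T}" for x t
    proof -
      have "\<rho>\<^sup>2 * t * (norm \<alpha>)\<^sup>2 \<le> \<rho>\<^sup>2 * T * (norm \<alpha>)\<^sup>2" using t by (intro mult_right_mono mult_left_mono) auto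
      then show ?thesis using value_lower[of t x] t by simp
    qed
    then show "\<exists>C. \<forall>x. \<forall>t\<in>{0..T}. C \<le> V x t - \<alpha> \<bullet> x" by blast
  qed
  fix r :: real assume r: "0 < r"
  obtain C where C: "0 \<le> C" "\<And>x y t. norm x \<le> r + 1 \<Longrightarrow> norm y \<le> r + 1 \<Longrightarrow> 0 \<le> t \<Longrightarrow> t \<le> r \<Longrightarrow> \<bar>V y t - V x t\<bar> \<le> C * norm (y - x)"
    using value_lipschitz_space[of "r + 1" r] by blast
  have "compact (cball 0 r \<times> {0..r} :: ('a \<times> real) set)" by (intro compact_Times) auto
  then have "compact ((\<lambda>(x, t). V x t) ` (cball 0 r \<times> {0..r}))"
    by (intro compact_continuous_image continuous_on_subset[OF value_continuous]) auto
  then obtain B where B: "\<And>x t. norm x \<le> r \<Longrightarrow> 0 \<le> t \<Longrightarrow> t \<le> r \<Longrightarrow> \<bar>V x t\<bar> \<le> B"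
  proof -
    assume c: "compact ((\<lambda>(x, t). V x t) ` (cball 0 r \<times> {0..r}))"
    obtain B where "\<forall>z\<in>(\<lambda>(x, t). V x t) ` (cball 0 r \<times> {0..r}). norm z \<le> B"
      using compact_imp_bounded[OF c] unfolding bounded_iff by blast
    then show thesis by (intro that[of B]) auto
  qed
  \<comment> \<open>A subgradient longer than the local Lipschitz constant is refuted by a step in
    its own direction, short enough to stay in the larger ball of radius r + 1.\<close>
  have grad: "norm q \<le> C" if q: "q \<in> frechet_subdifferential (\<lambda>y. V y t) x" and x: "norm x \<le> r" and t: "0 \<le> t" "t \<le> r" for q x t
  proof (rule ccontr)
    assume "\<not> norm q \<le> C"
    then have qC: "C < norm q" by simp
    then have q0: "q \<noteq> 0" using C(1) by auto
    have "ereal (C - norm q) < 0" using qC by simp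
    then have "\<forall>\<^sub>F y in at x. ereal (C - norm q) < ereal ((V y t - V x t - q \<bullet> (y - x)) / norm (y - x))"
      using q unfolding frechet_subdifferential_def le_Liminf_iff by blast
    then obtain d where d: "0 < d" "\<And>y. y \<noteq> x \<Longrightarrow> dist y x < d \<Longrightarrow> C - norm q < (V y t - V x t - q \<bullet> (y - x)) / norm (y - x)"
      unfolding eventually_at by auto
    define h where "h = min (d / 2) 1 / norm q"
    have h: "0 < h" "h * norm q < d" "h * norm q \<le> 1" using d(1) q0 unfolding h_def by auto
    define y where "y = x + h *\<^sub>R q"
    have yx: "norm (y - x) = h * norm q" using h by (simp add: y_def)
    have "y \<noteq> x" using h q0 by (simp add: y_def)
    moreover have "dist y x < d" using h yx by (simp add: dist_norm)
    ultimately have "C - norm q < (V y t - V x t - q \<bullet> (y - x)) / norm (y - x)" by (rule d(2))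
    then have "(C - norm q) * (h * norm q) < V y t - V x t - q \<bullet> (y - x)"
      unfolding yx using h q0 by (simp add: less_divide_eq)
    moreover have "q \<bullet> (y - x) = norm q * (h * norm q)" by (simp add: y_def power2_norm_eq_inner[symmetric] power2_eq_square)
    moreover have "V y t - V x t \<le> C * (h * norm q)"
    proof -
      have "norm y \<le> r + 1" using norm_triangle_ineq[of x "y - x"] yx h x by simp
      then have "\<bar>V y t - V x t\<bar> \<le> C * norm (y - x)" using x t by (intro C(2)) auto
      then show ?thesis unfolding yx by simp
    qed
    ultimately show False by (simp add: algebra_simps)
  qed
  have "local_norm r V \<le> ereal (B + C)"
    unfolding local_norm_def
  proof (rule Sup_least)
    fix e assume "e \<in> {ereal (\<bar>V x t\<bar> + norm q) | x t q.
            x \<in> cball 0 r \<and> t \<in> {0..r} \<and> q \<in> frechet_subdifferential (\<lambda>y. V y t) x}"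
    then obtain x t q where e: "e = ereal (\<bar>V x t\<bar> + norm q)" and *: "norm x \<le> r" "0 \<le> t" "t \<le> r"
      "q \<in> frechet_subdifferential (\<lambda>y. V y t) x" by auto
    then show "e \<le> ereal (B + C)" using B[OF *(1-3)] grad[OF *(4,1-3)] by simp
  qed
  then show "local_norm r V < \<infinity>" using order_le_less_trans by fastforce
qed

section \<open>The viscosity inequalities for the value function\<close>

lemma left_derivative_nonneg:
  fixes m :: "real \<Rightarrow> real"
  assumes d: "(m has_real_derivative D) (at t)" and le: "\<forall>\<^sub>F s in at_left t. m s \<le> m t"
  shows "0 \<le> D"
proof -
  have "((\<lambda>s. (m s - m t) / (s - t)) \<longlongrightarrow> D) (at_left t)"
    using has_field_derivative_at_within[OF d, of "{..<t}"] by (simp add: has_field_derivative_iff)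
  then show ?thesis
  proof (rule tendsto_lowerbound)
    show "\<forall>\<^sub>F s in at_left t. 0 \<le> (m s - m t) / (s - t)"
      using le eventually_at_left_real[of "t - 1" t, simplified] by eventually_elim (simp add: divide_nonpos_neg)
  qed simp
qed

lemma test_function_along_curve:
  assumes phi: "C1_test \<phi> D\<phi>" and t: "0 < t" and X: "(X has_vector_derivative v) (at t)"
  shows "((\<lambda>s. \<phi> (X s, s)) has_real_derivative (v \<bullet> fst (D\<phi> (X t, t)) + snd (D\<phi> (X t, t)))) (at t)"
proof -
  have "(\<phi> has_derivative (\<lambda>h. h \<bullet> D\<phi> (X t, t))) (at (X t, t))"
    using phi t unfolding C1_test_def gderiv_def by auto
  moreover have "((\<lambda>s. (X s, s)) has_derivative (\<lambda>h. (h *\<^sub>R v, h))) (at t)"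
    using X by (intro has_derivative_Pair has_derivative_ident) (simp add: has_vector_derivative_def)
  ultimately have "((\<lambda>s. \<phi> (X s, s)) has_derivative (\<lambda>h. (h *\<^sub>R v, h) \<bullet> D\<phi> (X t, t))) (at t)"
    by (rule has_derivative_compose[rotated])
  moreover have "(\<lambda>h. (h *\<^sub>R v, h) \<bullet> D\<phi> (X t, t)) = (*) (v \<bullet> fst (D\<phi> (X t, t)) + snd (D\<phi> (X t, t)))"
    by (auto simp: inner_prod_def fun_eq_iff algebra_simps)
  ultimately show ?thesis by (simp add: has_field_derivative_def)
qed

lemma eventually_along_curve:
  assumes ev: "\<forall>\<^sub>F (y, s) in nhds (X t, t). P y s" and X: "isCont X t"
  shows "\<forall>\<^sub>F s in at_left t. P (X s) s"
proof -
  have "((\<lambda>s. (X s, s)) \<longlongrightarrow> (X t, t)) (at_left t)"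
    using X unfolding isCont_def by (intro tendsto_Pair tendsto_ident_at) (rule tendsto_mono[OF at_le[OF subset_UNIV]])
  from filterlim_iff[THEN iffD1, OF this, rule_format, OF ev] show ?thesis by simp
qed

lemma inner_le_ham_lag: "q \<bullet> v \<le> ham x q + lag x v"
proof -
  have "R q \<bullet> Q v \<le> 1/2 * (norm (R q))\<^sup>2 + 1/2 * (norm (Q v))\<^sup>2"
  proof -
    have "0 \<le> (norm (R q - Q v))\<^sup>2" by simp
    then show ?thesis by (simp add: power2_norm_eq_inner inner_diff inner_commute algebra_simps)
  qed
  then show ?thesis unfolding ham_def lag_def dual[of q v] by simp
qed

text \<open>Along an optimal curve into (x, t), the test function minus the accumulated cost has a
  maximum from the left at t. Continuity of the velocity up to t gives the derivative of that cost,
  and Fenchel's inequality replaces the optimal velocity by the Hamiltonian.\<close>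

lemma value_supersolution: "viscosity_supersolution ham V"
  unfolding viscosity_supersolution_def
proof (intro allI impI, elim conjE)
  fix \<phi> D\<phi> x t
  assume phi: "C1_test \<phi> D\<phi>" and t: "0 < t"
    and ev: "\<forall>\<^sub>F (y, s) in nhds (x, t). V x t - \<phi> (x, t) \<le> V y s - \<phi> (y, s)"
  obtain X v where o: "optimal x t X v" using optimal_exists[OF t] by blast
  have Xt: "X t = x" and dX: "\<And>s. (X has_vector_derivative v s) (at s)" and cv: "continuous_on UNIV v"
    using o by (auto simp: optimal_def)
  define \<Lambda> where "\<Lambda> s = integral {0..s} (\<lambda>r. lag (X r) (v r))" for s
  have cl: "continuous_on S (\<lambda>r. lag (X r) (v r))" for S
    by (intro continuous_on_lag optimal_continuous[OF o])
  have "(\<Lambda> has_real_derivative lag (X t) (v t)) (at t within {0..t + 1})"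
    unfolding \<Lambda>_def by (rule integral_has_real_derivative[OF cl]) (use t in auto)
  then have d\<Lambda>: "(\<Lambda> has_real_derivative lag (X t) (v t)) (at t)"
    using t at_within_interior[of t "{0..t + 1}"] by simp
  have "0 \<le> v t \<bullet> fst (D\<phi> (X t, t)) + snd (D\<phi> (X t, t)) - lag (X t) (v t)"
  proof (rule left_derivative_nonneg)
    show "((\<lambda>s. \<phi> (X s, s) - \<Lambda> s) has_real_derivative (v t \<bullet> fst (D\<phi> (X t, t)) + snd (D\<phi> (X t, t)) - lag (X t) (v t))) (at t)"
      by (intro DERIV_diff test_function_along_curve[OF phi t dX] d\<Lambda>)
    have "\<forall>\<^sub>F s in at_left t. V x t - \<phi> (x, t) \<le> V (X s) s - \<phi> (X s, s)"
      using ev has_vector_derivative_continuous[OF dX[of t]] unfolding Xt[symmetric] by (rule eventually_along_curve)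
    moreover have "\<forall>\<^sub>F s in at_left t. s \<in> {0<..<t}" using eventually_at_left_real[OF t] .
    ultimately show "\<forall>\<^sub>F s in at_left t. \<phi> (X s, s) - \<Lambda> s \<le> \<phi> (X t, t) - \<Lambda> t"
    proof eventually_elim
      case (elim s)
      have "V (X s) s + integral {s..t} (\<lambda>r. lag (X r) (v r)) \<le> V x t"
        using elim by (intro optimal_restrict[OF o]) auto
      moreover have "\<Lambda> s + integral {s..t} (\<lambda>r. lag (X r) (v r)) = \<Lambda> t"
        unfolding \<Lambda>_def using elim
        by (intro Henstock_Kurzweil_Integration.integral_combine integrable_continuous_real cl) auto
      ultimately show ?case using elim Xt by simp
    qed
  qed
  then show "0 \<le> snd (D\<phi> (x, t)) + ham x (fst (D\<phi> (x, t)))"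
    using inner_le_ham_lag[of "fst (D\<phi> (x, t))" "v t" x] by (simp add: Xt inner_commute)
qed

text \<open>The comparison curve reaches (x, t) with the constant velocity v for which Q v = R q,
  the one that maximises q v - L and so turns Fenchel's inequality into equality.\<close>

lemma value_subsolution: "viscosity_subsolution ham V"
  unfolding viscosity_subsolution_def
proof (intro allI impI, elim conjE)
  fix \<phi> D\<phi> x t
  assume phi: "C1_test \<phi> D\<phi>" and t: "0 < t"
    and ev: "\<forall>\<^sub>F (y, s) in nhds (x, t). V y s - \<phi> (y, s) \<le> V x t - \<phi> (x, t)"
  define q where "q = fst (D\<phi> (x, t))"
  obtain v where v: "Q v = R q" using Q_surj by blast
  define X where "X s = x + (s - t) *\<^sub>R v" for s
  have Xt: "X t = x" by (simp add: X_def)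
  have dX: "(X has_vector_derivative v) (at s)" for s
    unfolding X_def by (auto intro!: derivative_eq_intros)
  \<comment> \<open>The quadratic term absorbs two errors of first order in F, one from
    \<open>value_step\<close> and one from moving its base point to x, and does not change the
    derivative at t.\<close>
  define m where "m s = - \<phi> (X s, s) + (lag x v * (s - t) - 2 * K * norm v * (s - t)\<^sup>2)" for s
  have "0 \<le> - (v \<bullet> fst (D\<phi> (X t, t)) + snd (D\<phi> (X t, t))) + lag x v"
  proof (rule left_derivative_nonneg)
    have "((\<lambda>s. lag x v * (s - t) - 2 * K * norm v * (s - t)\<^sup>2) has_real_derivative lag x v) (at t)"
      by (auto intro!: derivative_eq_intros)
    then show "(m has_real_derivative (- (v \<bullet> fst (D\<phi> (X t, t)) + snd (D\<phi> (X t, t))) + lag x v)) (at t)"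
      unfolding m_def by (intro DERIV_add DERIV_minus test_function_along_curve[OF phi t dX])
    have "\<forall>\<^sub>F s in at_left t. V (X s) s - \<phi> (X s, s) \<le> V x t - \<phi> (x, t)"
      using ev has_vector_derivative_continuous[OF dX[of t]] unfolding Xt[symmetric] by (rule eventually_along_curve)
    moreover have "\<forall>\<^sub>F s in at_left t. s \<in> {0<..<t}" using eventually_at_left_real[OF t] .
    ultimately show "\<forall>\<^sub>F s in at_left t. m s \<le> m t"
    proof eventually_elim
      case (elim s)
      have "V (X s + (t - s) *\<^sub>R v) (s + (t - s)) \<le> V (X s) s + (t - s) * (lag (X s) v + K * ((t - s) * norm v))"
        using elim by (intro value_step) auto
      moreover have "X s + (t - s) *\<^sub>R v = x" by (simp add: X_def algebra_simps)
      moreover have "lag (X s) v \<le> lag x v + K * ((t - s) * norm v)"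
        using F_lip[of "X s" x] elim by (simp add: lag_def X_def)
      then have "lag (X s) v + K * ((t - s) * norm v) \<le> lag x v + 2 * (K * ((t - s) * norm v))" by linarith
      then have "(t - s) * (lag (X s) v + K * ((t - s) * norm v)) \<le> (t - s) * (lag x v + 2 * (K * ((t - s) * norm v)))"
        by (rule mult_left_mono) (use elim in simp)
      moreover have "(t - s) * (lag x v + 2 * (K * ((t - s) * norm v))) = - (lag x v * (s - t) - 2 * K * norm v * (s - t)\<^sup>2)"
        by (simp add: power2_eq_square algebra_simps)
      ultimately show ?case using elim Xt by (simp add: m_def)
    qed
  qed
  then have "snd (D\<phi> (x, t)) + (q \<bullet> v - lag x v) \<le> 0" by (simp add: Xt q_def inner_commute)
  moreover have "q \<bullet> v = (norm (R q))\<^sup>2" unfolding dual[of q v] v by (simp add: power2_norm_eq_inner)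
  ultimately show "snd (D\<phi> (x, t)) + ham x (fst (D\<phi> (x, t))) \<le> 0"
    by (simp add: ham_def lag_def v q_def)
qed

lemma value_viscosity_solution: "viscosity_solution_ivp ham \<Phi> V"
  unfolding viscosity_solution_ivp_def
  using value_continuous value_subsolution value_supersolution V_0 by blast

end

section \<open>Comparison\<close>

lemma has_derivative_integral_from_0:
  fixes f :: "real \<Rightarrow> real"
  assumes "continuous_on {0..} f" "0 < t"
  shows "((\<lambda>s. integral {0..s} f) has_real_derivative f t) (at t)"
proof -
  have "((\<lambda>s. integral {0..s} f) has_real_derivative f t) (at t within {0..t + 1})"
    by (rule integral_has_real_derivative[OF continuous_on_subset[OF assms(1)]]) (use assms(2) in auto)
  then show ?thesis using assms(2) at_within_interior[of t "{0..t + 1}"] by simp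
qed

lemma continuous_on_integral_from_0:
  fixes f :: "real \<Rightarrow> real"
  assumes "continuous_on {0..} f"
  shows "continuous_on {0..} (\<lambda>s. integral {0..s} f)"
  unfolding continuous_on_def
proof
  fix t :: real assume t: "t \<in> {0..}"
  have "continuous_on {0..t + 1} (\<lambda>s. integral {0..s} f)"
    by (intro indefinite_integral_continuous_1 integrable_continuous_real continuous_on_subset[OF assms]) auto
  then have "((\<lambda>s. integral {0..s} f) \<longlongrightarrow> integral {0..t} f) (at t within {0..t + 1})"
    using t by (auto simp: continuous_on_def)
  moreover have "at t within {0..} = at t within {0..t + 1}"
    by (rule at_within_nhd[of _ "{..<t + 1}"]) (use t in auto)
  ultimately show "((\<lambda>s. integral {0..s} f) \<longlongrightarrow> integral {0..t} f) (at t within {0..})" by simp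
qed

text \<open>The square makes the penalty for late times continuously differentiable, as a test
  function must be.\<close>

lemma DERIV_square_pos_part: "((\<lambda>s. (max (s - t) 0)\<^sup>2) has_real_derivative 2 * max (s - t) 0) (at s)" for t :: real
proof -
  have "((\<lambda>s. if s < t then 0 else (s - t)\<^sup>2) has_real_derivative (if s < t then 0 else 2 * (s - t))) (at s)"
    by (rule DERIV_glue) (auto intro!: derivative_eq_intros)
  moreover have "(\<lambda>s. if s < t then 0 else (s - t)\<^sup>2) = (\<lambda>s. (max (s - t) 0)\<^sup>2)" by (auto simp: max_def)
  moreover have "(if s < t then 0 else 2 * (s - t)) = 2 * max (s - t) 0" by auto
  ultimately show ?thesis by simp
qed

lemma C1_test_tube:
  fixes X v :: "real \<Rightarrow> 'a::euclidean_space"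
  assumes A: "\<And>s. 0 < s \<Longrightarrow> (A has_real_derivative A' s) (at s)" "continuous_on {0<..} A'"
    and X: "\<And>s. (X has_vector_derivative v s) (at s)" "continuous_on UNIV v"
  shows "C1_test (\<lambda>z. A (snd z) + n * ((fst z - X (snd z)) \<bullet> (fst z - X (snd z))))
    (\<lambda>z. ((2 * n) *\<^sub>R (fst z - X (snd z)), A' (snd z) - 2 * n * ((fst z - X (snd z)) \<bullet> v (snd z))))"
  unfolding C1_test_def gderiv_def
proof (intro conjI ballI)
  fix z :: "'a \<times> real" assume "z \<in> UNIV \<times> {0<..}"
  then have s: "0 < snd z" by auto
  have dA: "((\<lambda>z. A (snd z)) has_derivative (\<lambda>h. A' (snd z) * snd h)) (at z)"
    using has_derivative_compose[OF has_derivative_snd[OF has_derivative_ident] A(1)[OF s, unfolded has_field_derivative_def]] .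
  have dX: "((\<lambda>z. X (snd z)) has_derivative (\<lambda>h. snd h *\<^sub>R v (snd z))) (at z)"
    using has_derivative_compose[OF has_derivative_snd[OF has_derivative_ident] X(1)[of "snd z", unfolded has_vector_derivative_def]] .
  show "((\<lambda>z. A (snd z) + n * ((fst z - X (snd z)) \<bullet> (fst z - X (snd z)))) has_derivative
     (\<lambda>h. h \<bullet> ((2 * n) *\<^sub>R (fst z - X (snd z)), A' (snd z) - 2 * n * ((fst z - X (snd z)) \<bullet> v (snd z))))) (at z)"
    by (rule derivative_eq_intros dA dX refl)+
      (simp add: fun_eq_iff inner_prod_def inner_diff inner_commute algebra_simps)
next
  have Xc: "continuous_on UNIV X" 
    using X(1) by (auto intro: has_vector_derivative_continuous continuous_at_imp_continuous_on)
  show "continuous_on (UNIV \<times> {0<..}) (\<lambda>z. ((2 * n) *\<^sub>R (fst z - X (snd z)), A' (snd z) - 2 * n * ((fst z - X (snd z)) \<bullet> v (snd z))))"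
    by (intro continuous_intros continuous_on_compose2[OF Xc] continuous_on_compose2[OF X(2)] continuous_on_compose2[OF A(2)]) auto
qed

context value_function
begin

text \<open>Otherwise \<open>W\<close> minus a test function, penalised away from the curve and beyond time \<open>t\<close>, has an interior
  maximum at which the subsolution inequality fails.\<close>

lemma subsolution_along_curve:
  assumes W: "continuous_on (UNIV \<times> {0..}) (\<lambda>(x, t). W x t)" and sub: "viscosity_subsolution ham W"
    and X: "\<And>s. (X has_vector_derivative v s) (at s)" "continuous_on UNIV v" and t: "0 < t"
  shows "W (X t) t \<le> W (X 0) 0 + integral {0..t} (\<lambda>s. lag (X s) (v s))"
proof (rule ccontr)
  define \<theta> where "\<theta> s = integral {0..s} (\<lambda>s. lag (X s) (v s))" for s
  define \<omega> where "\<omega> s = W (X s) s - \<theta> s" for s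
  assume "\<not> W (X t) t \<le> W (X 0) 0 + integral {0..t} (\<lambda>s. lag (X s) (v s))"
  then have gt: "\<omega> 0 < \<omega> t" unfolding \<omega>_def \<theta>_def by simp
  have Xc: "continuous_on S X" for S
    using X(1) by (auto intro: continuous_on_subset has_vector_derivative_continuous continuous_at_imp_continuous_on)
  have cl: "continuous_on S (\<lambda>s. lag (X s) (v s))" for S
    by (rule continuous_on_lag[OF Xc continuous_on_subset[OF X(2)]]) simp
  have c\<theta>: "continuous_on {0..} \<theta>" unfolding \<theta>_def by (rule continuous_on_integral_from_0[OF cl])
  have d\<theta>: "(\<theta> has_real_derivative lag (X s) (v s)) (at s)" if "0 < s" for s
    unfolding \<theta>_def by (rule has_derivative_integral_from_0[OF cl that])
  have cW: "continuous_on S (\<lambda>s. W (p s) (q s))"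
    if "continuous_on S p" "continuous_on S q" "\<And>s. s \<in> S \<Longrightarrow> 0 \<le> q s"
    for S :: "'b::topological_space set" and p :: "'b \<Rightarrow> 'a" and q :: "'b \<Rightarrow> real"
  proof -
    have "continuous_on S (\<lambda>s. (\<lambda>(x, t). W x t) (p s, q s))"
      by (rule continuous_on_compose2[OF W continuous_on_Pair[OF that(1,2)]]) (use that(3) in auto)
    then show ?thesis by simp
  qed
  have c\<omega>: "continuous_on {0..} \<omega>"
    unfolding \<omega>_def by (intro continuous_on_diff c\<theta> cW Xc continuous_on_id) auto
  \<comment> \<open>Half of the mean excess is spent on a linear term in time; this is the margin by
    which the subsolution inequality will fail.\<close>
  define \<eta> where "\<eta> = (\<omega> t - \<omega> 0) / (2 * t)"
  have \<eta>: "0 < \<eta>" unfolding \<eta>_def using gt t by simp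
  have \<eta>t: "\<omega> 0 < \<omega> t - \<eta> * t" unfolding \<eta>_def using gt t by (simp add: field_simps)
  \<comment> \<open>The cylinder must start at a positive time, since the viscosity inequality holds
    only there. Continuity at 0 supplies an s0 that keeps the strict gap.\<close>
  obtain s0 where s0: "0 < s0" "s0 < t" "\<omega> s0 - \<eta> * s0 < \<omega> t - \<eta> * t"
  proof -
    have "(\<omega> \<longlongrightarrow> \<omega> 0) (at_right 0)"
      using c\<omega> by (auto simp: continuous_on_def intro: tendsto_within_subset)
    then have "((\<lambda>s. \<omega> s - \<eta> * s) \<longlongrightarrow> \<omega> 0 - \<eta> * 0) (at_right 0)" by (intro tendsto_intros)
    then have "\<forall>\<^sub>F s in at_right 0. \<omega> s - \<eta> * s < \<omega> t - \<eta> * t"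
      using \<eta>t by (intro order_tendstoD) auto
    moreover have "\<forall>\<^sub>F s in at_right 0. s \<in> {0<..<t}" by (rule eventually_at_right_real[OF t])
    ultimately have "\<forall>\<^sub>F s in at_right 0. 0 < s \<and> s < t \<and> \<omega> s - \<eta> * s < \<omega> t - \<eta> * t"
      by eventually_elim auto
    then show thesis using that eventually_happens'[OF trivial_limit_at_right_real] by blast
  qed
  define \<delta> where "\<delta> = (\<omega> t - \<eta> * t) - (\<omega> s0 - \<eta> * s0)"
  have \<delta>: "0 < \<delta>" unfolding \<delta>_def using s0 by simp
  define f where "f z = W (X (snd z) + fst z) (snd z) - \<theta> (snd z) - \<eta> * snd z" for z :: "'a \<times> real"
  have cf: "continuous_on (UNIV \<times> {0..}) f"
  proof -
    have "continuous_on (UNIV \<times> {0..}) (\<lambda>z :: 'a \<times> real. W (X (snd z) + fst z) (snd z))"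
      by (intro cW continuous_intros continuous_on_compose2[OF Xc[of UNIV]]) auto
    then show ?thesis unfolding f_def
      by (intro continuous_intros continuous_on_compose2[OF c\<theta>]) auto
  qed
  have "compact (cball 0 1 \<times> {s0..t + 1} :: ('a \<times> real) set)" by (intro compact_Times) auto
  moreover have cf1: "continuous_on (cball 0 1 \<times> {s0..t + 1}) f"
    by (rule continuous_on_subset[OF cf]) (use s0 in auto)
  ultimately have uc: "uniformly_continuous_on (cball 0 1 \<times> {s0..t + 1}) f"
    and bd: "bounded (f ` (cball 0 1 \<times> {s0..t + 1}))"
    by (auto intro: compact_uniformly_continuous compact_imp_bounded compact_continuous_image)
  obtain \<epsilon> where \<epsilon>: "0 < \<epsilon>" "\<And>z z'. z \<in> cball 0 1 \<times> {s0..t + 1} \<Longrightarrow> z' \<in> cball 0 1 \<times> {s0..t + 1} \<Longrightarrow>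
      dist z' z < \<epsilon> \<Longrightarrow> dist (f z') (f z) < \<delta>"
    using uc \<delta> unfolding uniformly_continuous_on_def by metis
  obtain M where M: "0 < M" "\<And>z. z \<in> cball 0 1 \<times> {s0..t + 1} \<Longrightarrow> \<bar>f z\<bar> \<le> M"
    using bd unfolding bounded_pos by (metis imageI real_norm_def)
  \<comment> \<open>The bound by \<open>\<epsilon>\<close> excludes a maximum at the bottom s0 of
    the cylinder, and K r < \<eta> absorbs the variation of F across the tube. K + 1 avoids division
    by 0.\<close>
  define r where "r = min 1 (min (\<epsilon> / 2) (\<eta> / (2 * (K + 1))))"
  have r: "0 < r" "r \<le> 1" "r < \<epsilon>" "K * r < \<eta>"
  proof -
    show "0 < r" "r \<le> 1" "r < \<epsilon>" using \<epsilon>(1) \<eta> K_nonneg unfolding r_def by auto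
    have "K * r \<le> (K + 1) * (\<eta> / (2 * (K + 1)))"
      using K_nonneg \<open>0 < r\<close> by (intro mult_mono) (auto simp: r_def)
    also have "\<dots> < \<eta>" using K_nonneg \<eta> by (simp add: field_simps add_pos_nonneg)
    finally show "K * r < \<eta>" .
  qed
  \<comment> \<open>On the lateral boundary the penalty is 2 M + 1, more than the oscillation of f,
    which excludes a maximum there; \<open>B\<close> does the same at time t + 1.\<close>
  define n where "n = (2 * M + 1) / r\<^sup>2"
  have n: "n * r\<^sup>2 = 2 * M + 1" "0 < n" using r(1) M(1) unfolding n_def by auto
  define B where "B = 2 * M + 1"
  define g where "g z = f z - n * (fst z \<bullet> fst z) - B * (max (snd z - t) 0)\<^sup>2" for z :: "'a \<times> real"
  have "compact (cball 0 r \<times> {s0..t + 1} :: ('a \<times> real) set)" by (intro compact_Times) auto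
  moreover have "continuous_on (cball 0 r \<times> {s0..t + 1}) g"
    unfolding g_def by (intro continuous_intros continuous_on_subset[OF cf]) (use s0 in auto)
  ultimately obtain zs where zs: "zs \<in> cball 0 r \<times> {s0..t + 1}"
    and max: "\<And>z. z \<in> cball 0 r \<times> {s0..t + 1} \<Longrightarrow> g z \<le> g zs"
    using continuous_attains_sup[of "cball 0 r \<times> {s0..t + 1}" g] r(1) s0 by fastforce
  obtain z s where zs': "zs = (z, s)" by (cases zs)
  have z: "norm z \<le> r" and s: "s0 \<le> s" "s \<le> t + 1" using zs unfolding zs' by auto
  have in1: "(z, s) \<in> cball 0 1 \<times> {s0..t + 1}" using z s r by auto
  have gt': "\<omega> t - \<eta> * t \<le> g (z, s)"
    using max[of "(0, t)"] s0 r unfolding zs' by (simp add: g_def f_def \<omega>_def)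
  have low: "- M \<le> \<omega> t - \<eta> * t"
    using M(2)[of "(0, t)"] s0 by (simp add: f_def \<omega>_def)
  have nn: "0 \<le> n * (z \<bullet> z)" "0 \<le> B * (max (s - t) 0)\<^sup>2" using n(2) M(1) unfolding B_def by auto
  have "s \<noteq> s0"
  proof
    assume "s = s0"
    have "dist (z, s0) (0, s0) < \<epsilon>" using z r by (simp add: dist_Pair_Pair dist_norm)
    then have "\<bar>f (z, s0) - f (0, s0)\<bar> < \<delta>"
      using \<epsilon>(2)[of "(0, s0)" "(z, s0)"] z r s0 by (simp add: dist_real_def)
    then have "f (z, s0) < \<omega> t - \<eta> * t" unfolding \<delta>_def by (simp add: f_def \<omega>_def)
    then show False using gt' nn \<open>s = s0\<close> by (simp add: g_def)
  qed
  then have s1: "s0 < s" using s by simp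
  have fM: "f (z, s) \<le> M" using M(2)[OF in1] by linarith
  have s2: "s < t + 1"
  proof (rule ccontr)
    assume "\<not> s < t + 1"
    then have "g (z, s) \<le> M - B" using s fM nn by (simp add: g_def)
    then show False using gt' low M(1) unfolding B_def by linarith
  qed
  have zr: "norm z < r"
  proof (rule ccontr)
    assume "\<not> norm z < r"
    then have "z \<bullet> z = r\<^sup>2" using z by (simp add: power2_norm_eq_inner[symmetric])
    then have "g (z, s) \<le> M - (2 * M + 1)" using fM nn n(1) by (simp add: g_def)
    then show False using gt' low M(1) by linarith
  qed
  have s0': "0 < s" using s1 s0 by simp
  define A where "A s = \<theta> s + \<eta> * s + B * (max (s - t) 0)\<^sup>2" for s
  define A' where "A' s = lag (X s) (v s) + \<eta> + B * (2 * max (s - t) 0)" for s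
  have dA: "(A has_real_derivative A' s) (at s)" if "0 < s" for s
    unfolding A_def A'_def
    by (intro DERIV_add DERIV_cmult d\<theta>[OF that] DERIV_square_pos_part) (auto intro!: derivative_eq_intros)
  have cA': "continuous_on {0<..} A'" unfolding A'_def by (intro continuous_intros cl)
  note test = C1_test_tube[OF dA cA' X, of n]
  have "\<forall>\<^sub>F w in nhds (X s + z, s). (fst w - X (snd w), snd w) \<in> ball 0 r \<times> {s0<..<t + 1}"
  proof -
    have "continuous_on UNIV (\<lambda>w :: 'a \<times> real. (fst w - X (snd w), snd w))"
      by (intro continuous_intros continuous_on_compose2[OF Xc[of UNIV]]) auto
    then have "isCont (\<lambda>w. (fst w - X (snd w), snd w)) (X s + z, s)"
      by (simp add: continuous_on_eq_continuous_at)
    then have "((\<lambda>w. (fst w - X (snd w), snd w)) \<longlongrightarrow> (fst (X s + z, s) - X (snd (X s + z, s)), snd (X s + z, s))) (nhds (X s + z, s))"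
      using tendsto_at_iff_tendsto_nhds[of "\<lambda>w. (fst w - X (snd w), snd w)" "(X s + z, s)"] by (simp add: isCont_def)
    moreover have "open (ball (0::'a) r \<times> {s0<..<t + 1})" by (intro open_Times) auto
    ultimately show ?thesis using zr s1 s2 by (intro topological_tendstoD) auto
  qed
  then have ev: "\<forall>\<^sub>F (y, s') in nhds (X s + z, s).
     W y s' - (A (snd (y, s')) + n * ((fst (y, s') - X (snd (y, s'))) \<bullet> (fst (y, s') - X (snd (y, s')))))
     \<le> W (X s + z) s - (A (snd (X s + z, s)) + n * ((fst (X s + z, s) - X (snd (X s + z, s))) \<bullet> (fst (X s + z, s) - X (snd (X s + z, s)))))"
  proof eventually_elim
    case (elim w)
    have "g (fst w - X (snd w), snd w) \<le> g (z, s)"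
      using max[of "(fst w - X (snd w), snd w)"] elim unfolding zs' by auto
    then show ?case by (simp add: g_def f_def A_def split_def)
  qed
  \<comment> \<open>The spatial gradient of the penalty grows with n, but so does its time
    derivative through the motion of the tube. Fenchel's inequality cancels q v against the
    Hamiltonian whatever the size of q.\<close>
  define q where "q = (2 * n) *\<^sub>R z"
  have "A' s - 2 * n * (z \<bullet> v s) + ham (X s + z) q \<le> 0"
    using sub[unfolded viscosity_subsolution_def, rule_format, OF conjI[OF test conjI[OF s0' ev]]]
    by (simp add: q_def)
  moreover have "q \<bullet> v s \<le> ham (X s + z) q + lag (X s + z) (v s)" by (rule inner_le_ham_lag)
  moreover have "lag (X s + z) (v s) \<le> lag (X s) (v s) + K * r"
    using F_lip[of "X s + z" "X s"] mult_left_mono[OF z K_nonneg] by (simp add: lag_def)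
  moreover have "0 \<le> B * (2 * max (s - t) 0)" using M(1) unfolding B_def by simp
  ultimately show False using r(4) unfolding A'_def q_def by simp
qed

lemma subsolution_le_value:
  assumes W: "continuous_on (UNIV \<times> {0..}) (\<lambda>(x, t). W x t)" and sub: "viscosity_subsolution ham W"
    and W0: "\<And>x. W x 0 \<le> \<Phi> x" and t: "0 \<le> t"
  shows "W x t \<le> V x t"
proof (cases "t = 0")
  case False
  then have t: "0 < t" using t by simp
  obtain X v where o: "optimal x t X v" using optimal_exists[OF t] by blast
  have "W (X t) t \<le> W (X 0) 0 + integral {0..t} (\<lambda>s. lag (X s) (v s))"
    using o by (intro subsolution_along_curve[OF W sub _ _ t]) (auto simp: optimal_def)
  then show ?thesis using o W0[of "X 0"] by (simp add: optimal_def)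
qed (use W0 V_0 in simp)

text \<open>The perturbation \<open>e exp(l t) (1 + |x|\<^sup>2)\<close> makes the minimum exist, since \<open>W - S\<close> decreases at most
  linearly in \<open>x\<close>, and keeps \<open>S\<close> a strict subsolution, since its gradient is bounded.\<close>

lemma C1_subsolution_le:
  assumes W: "continuous_on (UNIV \<times> {0..}) (\<lambda>(x, t). W x t)" and sup: "viscosity_supersolution ham W"
    and lb: "\<And>x t. 0 \<le> t \<Longrightarrow> t \<le> T + 1 \<Longrightarrow> c \<le> W x t - \<alpha>' \<bullet> x"
    and S: "C1_test S DS" "continuous_on (UNIV \<times> {0..}) S"
    and S_sub: "\<And>x t. 0 < t \<Longrightarrow> snd (DS (x, t)) + ham x (fst (DS (x, t))) \<le> 0"
    and S_bound: "\<And>x t. 0 \<le> t \<Longrightarrow> t \<le> T + 1 \<Longrightarrow> S (x, t) \<le> k * (1 + norm x)"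
    and DS_bound: "\<And>x t. 0 < t \<Longrightarrow> t \<le> T + 1 \<Longrightarrow> norm (R (fst (DS (x, t)))) \<le> k"
    and S0: "\<And>x. S (x, 0) \<le> W x 0" and t: "0 \<le> t" "t \<le> T"
  shows "S (x, t) \<le> W x t"
proof (rule ccontr)
  assume "\<not> S (x, t) \<le> W x t"
  then have gap: "W x t < S (x, t)" by simp
  then have t0: "0 < t" using S0[of x] t by (cases "t = 0") auto
  have k: "0 \<le> k" using order_trans[OF norm_ge_zero DS_bound[of t x]] t t0 by simp
  \<comment> \<open>The time derivative of the perturbation must beat its effect on the Hamiltonian,
    at most 2 k \<rho> |y| + 2 \<rho>^2 |y|^2 per unit of e exp(l s); the summand 1 makes this
    strict.\<close>
  define l where "l = 2 * k * \<rho> + 2 * \<rho>\<^sup>2 + 1"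
  have l: "0 \<le> l" unfolding l_def using k rho(1) by simp
  \<comment> \<open>The first bound keeps e exp(l s) <= 1 up to time T + 1, so its square is
    dominated by itself; the second leaves the gap at (x, t) open.\<close>
  define e where "e = min (exp (- (l * (T + 1)))) ((S (x, t) - W x t) / (2 * exp (l * t) * (1 + (norm x)\<^sup>2)))"
  have px: "0 < 1 + (norm x)\<^sup>2" by (simp add: add_pos_nonneg)
  have e: "0 < e" unfolding e_def using gap px by simp
  have e1: "e * exp (l * s) \<le> 1" if "s \<le> T + 1" for s
  proof -
    have "e * exp (l * s) \<le> exp (- (l * (T + 1))) * exp (l * (T + 1))"
      using that l by (intro mult_mono) (auto simp: e_def intro!: mult_left_mono)
    then show ?thesis by (simp add: exp_minus)
  qed
  have e2: "e * exp (l * t) * (1 + (norm x)\<^sup>2) < S (x, t) - W x t"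
  proof -
    have "e \<le> (S (x, t) - W x t) / (2 * exp (l * t) * (1 + (norm x)\<^sup>2))" by (simp add: e_def)
    then have "e * (2 * exp (l * t) * (1 + (norm x)\<^sup>2)) \<le> S (x, t) - W x t"
      using px by (simp add: pos_le_divide_eq)
    then show ?thesis using gap by simp
  qed
  define k1 where "k1 = \<bar>c\<bar> + norm \<alpha>' + k"
  have k1: "0 \<le> k1" unfolding k1_def using k by simp
  \<comment> \<open>Beyond this radius e |y|^2 outweighs the linear loss 2 k1 |y|, so the negative
    minimum lies inside.\<close>
  define r where "r = 1 + 2 * k1 / e"
  have r: "1 \<le> r" unfolding r_def using k1 e by simp
  \<comment> \<open>At time T + 1 the penalty equals B, which covers the linear loss within the ball
    and keeps the minimum away from the final time.\<close>
  define B where "B = k1 * (1 + r)"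
  have B: "0 \<le> B" unfolding B_def using k1 r by simp
  define m where "m z = W (fst z) (snd z) - S z + e * exp (l * snd z) * (1 + (norm (fst z))\<^sup>2) + B * (max (snd z - T) 0)\<^sup>2"
    for z :: "'a \<times> real"
  have low: "- (k1 * (1 + norm y)) + e * (1 + (norm y)\<^sup>2) + B * (max (s - T) 0)\<^sup>2 \<le> m (y, s)" if "0 \<le> s" "s \<le> T + 1" for y s
  proof -
    have "- (norm \<alpha>' * norm y) \<le> \<alpha>' \<bullet> y" using Cauchy_Schwarz_ineq2[of \<alpha>' y] by linarith
    moreover have "c \<le> W y s - \<alpha>' \<bullet> y" "S (y, s) \<le> k * (1 + norm y)" using that by (auto intro: lb S_bound)
    moreover have "- (\<bar>c\<bar> * (1 + norm y)) \<le> c"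
      using mult_left_mono[of 1 "1 + norm y" "\<bar>c\<bar>"] by simp
    moreover have "k1 * (1 + norm y) = \<bar>c\<bar> * (1 + norm y) + norm \<alpha>' * norm y + norm \<alpha>' + k * (1 + norm y)"
      unfolding k1_def by (simp add: algebra_simps)
    moreover have "e * (1 + (norm y)\<^sup>2) \<le> e * exp (l * s) * (1 + (norm y)\<^sup>2)"
    proof (rule mult_right_mono)
      show "e \<le> e * exp (l * s)" using e l that by simp
    qed simp
    ultimately show ?thesis using norm_ge_zero[of \<alpha>'] unfolding m_def fst_conv snd_conv by linarith
  qed
  have cm: "continuous_on (UNIV \<times> {0..}) m"
    unfolding m_def using W S(2) by (intro continuous_intros) (simp add: split_def)
  have "compact (cball 0 r \<times> {0..T + 1} :: ('a \<times> real) set)" by (intro compact_Times) auto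
  then obtain zs where zs: "zs \<in> cball 0 r \<times> {0..T + 1}" and min: "\<And>z. z \<in> cball 0 r \<times> {0..T + 1} \<Longrightarrow> m zs \<le> m z"
    using continuous_attains_inf[of "cball 0 r \<times> {0..T + 1}" m] continuous_on_subset[OF cm, of "cball 0 r \<times> {0..T + 1}"] r t
    by fastforce
  obtain y s where ys: "zs = (y, s)" by (cases zs)
  have s: "0 \<le> s" "s \<le> T + 1" using zs ys by auto
  have outside: "0 \<le> m (y, s)" if "r \<le> norm y" "0 \<le> s" "s \<le> T + 1" for y s
  proof -
    have y1: "1 \<le> norm y" using r that by simp
    have "2 * k1 \<le> e * norm y" using that(1) e unfolding r_def by (simp add: field_simps)
    then have "2 * k1 * norm y \<le> e * norm y * norm y" by (rule mult_right_mono) simp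
    moreover have "k1 * (1 + norm y) \<le> k1 * (2 * norm y)" using y1 k1 by (intro mult_left_mono) auto
    moreover have "0 \<le> B * (max (s - T) 0)\<^sup>2" using B by simp
    moreover have "e * (1 + (norm y)\<^sup>2) = e + e * norm y * norm y" by (simp add: algebra_simps power2_eq_square)
    ultimately show ?thesis using low[OF that(2,3), of y] e by linarith
  qed
  have mx: "m (x, t) < 0" unfolding m_def using e2 t by simp
  then have "norm x < r" using outside[of x t] t by force
  then have m0: "m (y, s) < 0" using min[of "(x, t)"] mx t unfolding ys by simp
  have yr: "norm y < r" using outside[of y s] m0 s by force
  have s1: "0 < s"
  proof (rule ccontr)
    assume "\<not> 0 < s"
    then have "s = 0" using s by simp
    moreover have "0 \<le> e * (1 + (norm y)\<^sup>2)" "0 \<le> B * (max (0 - T) 0)\<^sup>2" using e B by auto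
    ultimately have "0 \<le> m (y, s)" using S0[of y] unfolding m_def by simp
    then show False using m0 by simp
  qed
  have s2: "s < T + 1"
  proof (rule ccontr)
    assume "\<not> s < T + 1"
    then have "s = T + 1" using s by simp
    moreover have "k1 * (1 + norm y) \<le> B" unfolding B_def using yr k1 by (intro mult_left_mono) auto
    moreover have "0 \<le> e * (1 + (norm y)\<^sup>2)" using e by simp
    ultimately have "0 \<le> m (y, s)" using low[OF s, of y] by simp
    then show False using m0 by simp
  qed
  define \<phi> where "\<phi> z = S z - (e * exp (l * snd z) * (1 + fst z \<bullet> fst z) + B * (max (snd z - T) 0)\<^sup>2)" for z :: "'a \<times> real"
  define D where "D z = DS z - ((2 * e * exp (l * snd z)) *\<^sub>R fst z,
     e * l * exp (l * snd z) * (1 + fst z \<bullet> fst z) + B * (2 * max (snd z - T) 0))" for z :: "'a \<times> real"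
  have test: "C1_test \<phi> D"
    unfolding C1_test_def
  proof (intro conjI ballI)
    fix z :: "'a \<times> real" assume z: "z \<in> UNIV \<times> {0<..}"
    have dB: "((\<lambda>z. (max (snd z - T) 0)\<^sup>2) has_derivative (\<lambda>h. 2 * max (snd z - T) 0 * snd h)) (at z)"
      using has_derivative_compose[OF has_derivative_snd[OF has_derivative_ident] DERIV_square_pos_part[of T "snd z", unfolded has_field_derivative_def]] .
    have "((\<lambda>z. e * exp (l * snd z) * (1 + fst z \<bullet> fst z) + B * (max (snd z - T) 0)\<^sup>2) has_derivative
       (\<lambda>h. h \<bullet> ((2 * e * exp (l * snd z)) *\<^sub>R fst z, e * l * exp (l * snd z) * (1 + fst z \<bullet> fst z) + B * (2 * max (snd z - T) 0)))) (at z)"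
      by (rule derivative_eq_intros dB refl)+
        (simp add: fun_eq_iff inner_prod_def inner_commute algebra_simps)
    moreover have "GDERIV S z :> DS z" using S(1) z unfolding C1_test_def by blast
    ultimately show "GDERIV \<phi> z :> D z"
      unfolding \<phi>_def D_def by (intro GDERIV_diff) (auto simp: gderiv_def)
  next
    show "continuous_on (UNIV \<times> {0<..}) D"
      unfolding D_def using S(1) by (intro continuous_intros) (simp add: C1_test_def)
  qed
  have "\<forall>\<^sub>F w in nhds (y, s). w \<in> ball 0 r \<times> {0<..<T + 1}"
    using yr s1 s2 by (intro eventually_nhds_in_open open_Times) auto
  then have ev: "\<forall>\<^sub>F (y', s') in nhds (y, s). W y s - \<phi> (y, s) \<le> W y' s' - \<phi> (y', s')"
  proof eventually_elim
    case (elim w)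
    then have "m (y, s) \<le> m w" using min[of w] ys by auto
    then show ?case by (simp add: m_def \<phi>_def split_def power2_norm_eq_inner)
  qed
  have ge: "0 \<le> snd (D (y, s)) + ham y (fst (D (y, s)))"
    using sup[unfolded viscosity_supersolution_def, rule_format, OF conjI[OF test conjI[OF s1 ev]]] .
  define E where "E = e * exp (l * s)"
  have E: "0 < E" "E \<le> 1" using e e1[OF s(2)] unfolding E_def by auto
  define g where "g = fst (DS (y, s))"
  have Rg: "norm (R g) \<le> k" unfolding g_def using DS_bound s1 s by simp
  have Ry: "norm (R y) \<le> \<rho> * norm y" by (rule rho)
  have RD: "R (fst (D (y, s))) = R g - (2 * E) *\<^sub>R R y"
    unfolding D_def g_def E_def by (simp add: linear_diff[OF R] linear_cmul[OF R])
  \<comment> \<open>The cross term is controlled by the gradient bound of S and the square by E E <=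
    E. Both become linear in E and lose against E l (1 + |y|^2).\<close>
  have "1/2 * (norm (R (fst (D (y, s)))))\<^sup>2 = 1/2 * (norm (R g))\<^sup>2 - 2 * E * (R g \<bullet> R y) + 2 * (E * E) * (norm (R y))\<^sup>2"
    unfolding RD by (simp add: power2_norm_eq_inner inner_diff inner_commute algebra_simps)
  moreover have "- (R g \<bullet> R y) \<le> k * \<rho> * norm y"
  proof -
    have "- (R g \<bullet> R y) \<le> norm (R g) * norm (R y)" using Cauchy_Schwarz_ineq2[of "R g" "R y"] by linarith
    also have "\<dots> \<le> k * (\<rho> * norm y)" by (intro mult_mono Rg Ry k) simp
    finally show ?thesis by simp
  qed
  then have "2 * E * - (R g \<bullet> R y) \<le> 2 * E * (k * \<rho> * norm y)" using E by (intro mult_left_mono) auto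
  moreover have "2 * (E * E) * (norm (R y))\<^sup>2 \<le> 2 * E * (\<rho>\<^sup>2 * (norm y)\<^sup>2)"
  proof -
    have "(norm (R y))\<^sup>2 \<le> \<rho>\<^sup>2 * (norm y)\<^sup>2" using power_mono[OF Ry, of 2] by (simp add: power_mult_distrib)
    moreover have "E * E \<le> E" using E by (simp add: mult_left_le)
    ultimately show ?thesis using E by (intro mult_mono) auto
  qed
  moreover have "snd (D (y, s)) \<le> snd (DS (y, s)) - E * l * (1 + (norm y)\<^sup>2)"
    using B unfolding D_def E_def by (simp add: power2_norm_eq_inner mult_ac)
  moreover have "snd (DS (y, s)) + 1/2 * (norm (R g))\<^sup>2 - F y \<le> 0" using S_sub[OF s1, of y] unfolding ham_def g_def by simp
  ultimately have "0 \<le> 2 * E * (k * \<rho> * norm y) + 2 * E * (\<rho>\<^sup>2 * (norm y)\<^sup>2) - E * l * (1 + (norm y)\<^sup>2)"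
    using ge unfolding ham_def by linarith
  also have "\<dots> = E * (2 * k * \<rho> * norm y + 2 * \<rho>\<^sup>2 * (norm y)\<^sup>2 - l * (1 + (norm y)\<^sup>2))" by algebra
  finally have "0 \<le> 2 * k * \<rho> * norm y + 2 * \<rho>\<^sup>2 * (norm y)\<^sup>2 - l * (1 + (norm y)\<^sup>2)"
    using E by (simp add: zero_le_mult_iff)
  moreover have "2 * k * \<rho> * norm y \<le> 2 * k * \<rho> * (1 + (norm y)\<^sup>2)"
  proof (rule mult_left_mono)
    have "0 \<le> (norm y - 1/2)\<^sup>2" by simp
    then show "norm y \<le> 1 + (norm y)\<^sup>2" by (simp add: power2_eq_square algebra_simps)
  qed (use k rho(1) in simp)
  moreover have "l * (1 + (norm y)\<^sup>2) = 2 * k * \<rho> * (1 + (norm y)\<^sup>2) + 2 * \<rho>\<^sup>2 + 2 * \<rho>\<^sup>2 * (norm y)\<^sup>2 + 1 + (norm y)\<^sup>2"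
    unfolding l_def by (simp add: algebra_simps)
  moreover have "0 \<le> 2 * \<rho>\<^sup>2" "0 \<le> (norm y)\<^sup>2" by auto
  ultimately show False by linarith
qed

end

section \<open>Dual certificates\<close>

lemma norm_convex_combination_sq:
  fixes z :: "'b \<Rightarrow> 'a::real_inner"
  assumes J: "finite J" "\<And>j. j \<in> J \<Longrightarrow> 0 \<le> \<omega> j" "(\<Sum>j\<in>J. \<omega> j) = 1"
  shows "(norm (\<Sum>j\<in>J. \<omega> j *\<^sub>R z j))\<^sup>2 \<le> (\<Sum>j\<in>J. \<omega> j * (norm (z j))\<^sup>2)"
proof -
  define m where "m = (\<Sum>j\<in>J. \<omega> j *\<^sub>R z j)"
  have "(norm m)\<^sup>2 = (\<Sum>j\<in>J. \<omega> j * (z j \<bullet> m))"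
    by (simp add: power2_norm_eq_inner inner_sum_left m_def[symmetric]) (simp add: m_def inner_sum_left)
  also have "\<dots> \<le> (\<Sum>j\<in>J. \<omega> j * (1/2 * (norm (z j))\<^sup>2 + 1/2 * (norm m)\<^sup>2))"
  proof (intro sum_mono mult_left_mono J)
    fix j
    have "0 \<le> (norm (z j - m))\<^sup>2" by simp
    then show "z j \<bullet> m \<le> 1/2 * (norm (z j))\<^sup>2 + 1/2 * (norm m)\<^sup>2"
      by (simp add: power2_norm_eq_inner inner_diff inner_commute)
  qed
  also have "\<dots> = 1/2 * (\<Sum>j\<in>J. \<omega> j * (norm (z j))\<^sup>2) + 1/2 * (norm m)\<^sup>2 * (\<Sum>j\<in>J. \<omega> j)"
    by (simp add: distrib_left sum.distrib sum_distrib_left sum_distrib_right mult_ac)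
  finally show ?thesis using J(3) by (simp add: m_def)
qed

lemma GDERIV_sum:
  assumes "finite J" "\<And>j. j \<in> J \<Longrightarrow> GDERIV (f j) x :> D j"
  shows "GDERIV (\<lambda>x. \<Sum>j\<in>J. f j x) x :> (\<Sum>j\<in>J. D j)"
  using assms by (induction J rule: finite_induct) (auto intro: GDERIV_add GDERIV_const)

text \<open>A soft minimum of finitely many \<open>C\<^sup>1\<close> subsolutions is again one, because the Hamiltonian is
  convex in the gradient and the gradient of the soft minimum is a convex combination.\<close>

lemma soft_min_GDERIV:
  assumes J: "finite J" "J \<noteq> {}" and d: "0 < d" and L: "\<And>j. j \<in> J \<Longrightarrow> GDERIV (L j) z :> D j"
  shows "GDERIV (\<lambda>z. - d * ln (\<Sum>j\<in>J. exp (- L j z / d))) z :>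
    (\<Sum>j\<in>J. (exp (- L j z / d) / (\<Sum>j\<in>J. exp (- L j z / d))) *\<^sub>R D j)"
proof -
  define Z where "Z z = (\<Sum>j\<in>J. exp (- L j z / d))" for z
  have Z: "0 < Z z" unfolding Z_def using J by (intro sum_pos) auto
  have "GDERIV Z z :> (\<Sum>j\<in>J. (exp (- L j z / d) * (- 1 / d)) *\<^sub>R D j)"
    unfolding Z_def
  proof (rule GDERIV_sum[OF J(1)])
    fix j assume "j \<in> J"
    show "GDERIV (\<lambda>z. exp (- L j z / d)) z :> (exp (- L j z / d) * (- 1 / d)) *\<^sub>R D j"
      by (rule GDERIV_DERIV_compose[OF L[OF \<open>j \<in> J\<close>], where g = "\<lambda>u. exp (- u / d)"])
        (use d in \<open>auto intro!: derivative_eq_intros\<close>)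
  qed
  then have "GDERIV (\<lambda>z. - d * ln (Z z)) z :> (- d / Z z) *\<^sub>R (\<Sum>j\<in>J. (exp (- L j z / d) * (- 1 / d)) *\<^sub>R D j)"
    by (rule GDERIV_DERIV_compose[where g = "\<lambda>u. - d * ln u"]) (use Z in \<open>auto intro!: derivative_eq_intros\<close>)
  moreover have "(- d / Z z) *\<^sub>R (\<Sum>j\<in>J. (exp (- L j z / d) * (- 1 / d)) *\<^sub>R D j) = (\<Sum>j\<in>J. (exp (- L j z / d) / Z z) *\<^sub>R D j)"
    unfolding scaleR_sum_right using d by (intro sum.cong) auto
  ultimately show ?thesis unfolding Z_def by simp
qed

context value_function
begin

text \<open>At time 0 only some member of the family lies below W at each point, so it is the
  minimum that is compared. The soft minimum with parameter d lies below every member, and at (x, t)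
  it is at least M - d ln(card J), since each of its exponentials is at most exp(-M/d); then d tends
  to 0.\<close>

lemma dual_certificate_le:
  assumes W: "continuous_on (UNIV \<times> {0..}) (\<lambda>(x, t). W x t)" and sup: "viscosity_supersolution ham W"
    and lb: "\<And>T. 0 < T \<Longrightarrow> \<exists>c. \<forall>x. \<forall>t\<in>{0..T}. c \<le> W x t - \<alpha>' \<bullet> x"
    and J: "finite J" "J \<noteq> {}"
    and g: "\<And>j s. j \<in> J \<Longrightarrow> (g j has_vector_derivative g' j s) (at s)" "\<And>j. j \<in> J \<Longrightarrow> continuous_on UNIV (g' j)"
    and c: "\<And>j s. j \<in> J \<Longrightarrow> 0 < s \<Longrightarrow> (c j has_real_derivative c' j s) (at s)"
      "\<And>j. j \<in> J \<Longrightarrow> continuous_on {0<..} (c' j)" "\<And>j. j \<in> J \<Longrightarrow> continuous_on {0..} (c j)"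
    and sub: "\<And>j s x. j \<in> J \<Longrightarrow> 0 < s \<Longrightarrow> g' j s \<bullet> x + c' j s + ham x (g j s) \<le> 0"
    and init: "\<And>x. \<exists>j\<in>J. g j 0 \<bullet> x + c j 0 \<le> W x 0"
    and M: "\<And>j. j \<in> J \<Longrightarrow> M \<le> g j t \<bullet> x + c j t" and t: "0 \<le> t"
  shows "M \<le> W x t"
proof -
  define L where "L j z = g j (snd z) \<bullet> fst z + c j (snd z)" for j and z :: "'a \<times> real"
  define DL where "DL j z = (g j (snd z), g' j (snd z) \<bullet> fst z + c' j (snd z))" for j and z :: "'a \<times> real"
  have cg: "continuous_on S (g j)" if "j \<in> J" for j S
    using g(1)[OF that] by (auto intro: has_vector_derivative_continuous continuous_at_imp_continuous_on)
  have dL: "GDERIV (L j) z :> DL j z" if j: "j \<in> J" and z: "0 < snd z" for j z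
  proof -
    have dg: "((\<lambda>z. g j (snd z)) has_derivative (\<lambda>h. snd h *\<^sub>R g' j (snd z))) (at z)"
      using has_derivative_compose[OF has_derivative_snd[OF has_derivative_ident] g(1)[OF j, of "snd z", unfolded has_vector_derivative_def]] .
    have dc: "((\<lambda>z. c j (snd z)) has_derivative (\<lambda>h. c' j (snd z) * snd h)) (at z)"
      using has_derivative_compose[OF has_derivative_snd[OF has_derivative_ident] c(1)[OF j z, unfolded has_field_derivative_def]] .
    show ?thesis unfolding gderiv_def L_def DL_def
      by (rule derivative_eq_intros dg dc refl)+ (simp add: fun_eq_iff inner_prod_def inner_commute algebra_simps)
  qed
  have cL: "continuous_on (UNIV \<times> {0..}) (L j)" if "j \<in> J" for j
    unfolding L_def by (intro continuous_intros continuous_on_compose2[OF cg[OF that, of UNIV]] continuous_on_compose2[OF c(3)[OF that]]) auto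
  have cDL: "continuous_on (UNIV \<times> {0<..}) (DL j)" if "j \<in> J" for j
    unfolding DL_def by (intro continuous_intros continuous_on_compose2[OF cg[OF that, of UNIV]]
      continuous_on_compose2[OF g(2)[OF that]] continuous_on_compose2[OF c(2)[OF that]]) auto
  have "\<exists>k. \<forall>s\<in>{0..t + 1}. norm (g j s) + \<bar>c j s\<bar> + norm (R (g j s)) \<le> k" if j: "j \<in> J" for j
  proof -
    have "continuous_on {0..t + 1} (\<lambda>s. norm (g j s) + \<bar>c j s\<bar> + norm (R (g j s)))"
      by (intro continuous_intros cg[OF j] continuous_on_subset[OF c(3)[OF j]]
          bounded_linear.continuous_on[OF R[unfolded linear_conv_bounded_linear]]) auto
    from compact_continuous_image[OF this compact_Icc]
    have "bounded ((\<lambda>s. norm (g j s) + \<bar>c j s\<bar> + norm (R (g j s))) ` {0..t + 1})" by (rule compact_imp_bounded)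
    then show ?thesis unfolding bounded_iff by force
  qed
  then obtain kj where kj: "\<And>j s. j \<in> J \<Longrightarrow> s \<in> {0..t + 1} \<Longrightarrow> norm (g j s) + \<bar>c j s\<bar> + norm (R (g j s)) \<le> kj j"
    by metis
  have kj0: "0 \<le> kj j" if "j \<in> J" for j
    using kj[OF that, of 0] t by (smt (verit) atLeastAtMost_iff norm_ge_zero)
  define k where "k = (\<Sum>j\<in>J. kj j)"
  have k: "norm (g j s) + \<bar>c j s\<bar> + norm (R (g j s)) \<le> k" if "j \<in> J" "s \<in> {0..t + 1}" for j s
    using kj[OF that] member_le_sum[of j J kj] kj0 J that unfolding k_def by fastforce
  obtain j0 where j0: "j0 \<in> J" using J by blast
  obtain b where b: "\<forall>x. \<forall>s\<in>{0..t + 1}. b \<le> W x s - \<alpha>' \<bullet> x" using lb[of "t + 1"] t by auto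
  have le: "M - d * ln (card J) \<le> W x t" if d: "0 < d" for d
  proof -
    define Z where "Z z = (\<Sum>j\<in>J. exp (- L j z / d))" for z
    have Z: "0 < Z z" for z unfolding Z_def using J by (intro sum_pos) auto
    define S where "S z = - d * ln (Z z)" for z
    define DS where "DS z = (\<Sum>j\<in>J. (exp (- L j z / d) / Z z) *\<^sub>R DL j z)" for z
    have SL: "S z \<le> L j z" if j: "j \<in> J" for j z
    proof -
      have "exp (- L j z / d) \<le> Z z" unfolding Z_def using J(1) j by (intro member_le_sum) auto
      then have "- L j z / d \<le> ln (Z z)" using Z[of z] by (simp add: ln_ge_iff)
      then show ?thesis unfolding S_def using d by (simp add: field_simps)
    qed
    define \<omega> where "\<omega> j z = exp (- L j z / d) / Z z" for j z
    have \<omega>0: "0 \<le> \<omega> j z" for j z using Z[of z] by (simp add: \<omega>_def)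
    have \<omega>1: "(\<Sum>j\<in>J. \<omega> j z) = 1" for z
      using Z[of z] unfolding \<omega>_def sum_divide_distrib[symmetric] by (simp add: Z_def)
    have RD: "R (fst (DS z)) = (\<Sum>j\<in>J. \<omega> j z *\<^sub>R R (g j (snd z)))" for z
      unfolding DS_def \<omega>_def DL_def by (simp add: fst_sum linear_sum[OF R] linear_cmul[OF R])
    have "S (x, t) \<le> W x t"
    proof (rule C1_subsolution_le[OF W sup, where T = t and S = S and DS = DS and c = b and k = k and \<alpha>' = \<alpha>'])
      show "b \<le> W x s - \<alpha>' \<bullet> x" if "0 \<le> s" "s \<le> t + 1" for x s using b that by auto
      show "C1_test S DS" unfolding C1_test_def
      proof (intro conjI ballI)
        fix z :: "'a \<times> real" assume "z \<in> UNIV \<times> {0<..}"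
        then show "GDERIV S z :> DS z"
          unfolding S_def DS_def Z_def by (intro soft_min_GDERIV[OF J d] dL) auto
      next
        show "continuous_on (UNIV \<times> {0<..}) DS"
          unfolding DS_def Z_def using Z[unfolded Z_def] less_imp_neq[OF Z[unfolded Z_def]]
          by (intro continuous_intros cDL continuous_on_subset[OF cL]) (use d in \<open>auto simp: less_imp_neq[symmetric]\<close>)
      qed
      show "continuous_on (UNIV \<times> {0..}) S"
        unfolding S_def Z_def using d Z[unfolded Z_def] by (intro continuous_intros cL) (auto simp: less_imp_neq[symmetric])
      show "snd (DS (x, s)) + ham x (fst (DS (x, s))) \<le> 0" if s: "0 < s" for x s
      proof -
        have "(norm (R (fst (DS (x, s)))))\<^sup>2 \<le> (\<Sum>j\<in>J. \<omega> j (x, s) * (norm (R (g j s)))\<^sup>2)"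
          unfolding RD using norm_convex_combination_sq[OF J(1) \<omega>0 \<omega>1, of "(x, s)" "\<lambda>j. R (g j s)"] by simp
        moreover have "snd (DS (x, s)) = (\<Sum>j\<in>J. \<omega> j (x, s) * (g' j s \<bullet> x + c' j s))"
          unfolding DS_def \<omega>_def DL_def by (simp add: snd_sum)
        moreover have "F x = (\<Sum>j\<in>J. \<omega> j (x, s) * F x)" unfolding sum_distrib_right[symmetric] \<omega>1 by simp
        ultimately have "snd (DS (x, s)) + ham x (fst (DS (x, s))) \<le>
           (\<Sum>j\<in>J. \<omega> j (x, s) * (g' j s \<bullet> x + c' j s)) + 1/2 * (\<Sum>j\<in>J. \<omega> j (x, s) * (norm (R (g j s)))\<^sup>2) - (\<Sum>j\<in>J. \<omega> j (x, s) * F x)"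
          unfolding ham_def by linarith
        also have "\<dots> = (\<Sum>j\<in>J. \<omega> j (x, s) * (g' j s \<bullet> x + c' j s + ham x (g j s)))"
          unfolding ham_def by (simp add: algebra_simps sum.distrib sum_subtractf sum_divide_distrib)
        also have "\<dots> \<le> 0"
          by (intro sum_nonpos mult_nonneg_nonpos \<omega>0 sub s)
        finally show ?thesis .
      qed
      show "S (x, s) \<le> k * (1 + norm x)" if s: "0 \<le> s" "s \<le> t + 1" for x s
      proof -
        have "S (x, s) \<le> g j0 s \<bullet> x + c j0 s" using SL[OF j0, of "(x, s)"] by (simp add: L_def)
        also have "\<dots> \<le> norm (g j0 s) * norm x + \<bar>c j0 s\<bar>" using norm_cauchy_schwarz[of "g j0 s" x] by linarith
        also have "\<dots> \<le> k * norm x + k"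
        proof -
          have "norm (g j0 s) \<le> k" "\<bar>c j0 s\<bar> \<le> k"
            using k[OF j0, of s] s norm_ge_zero[of "g j0 s"] norm_ge_zero[of "R (g j0 s)"] abs_ge_zero[of "c j0 s"]
            by (simp_all, linarith+)
          then show ?thesis by (intro add_mono mult_right_mono) auto
        qed
        finally show ?thesis by (simp add: algebra_simps)
      qed
      show "norm (R (fst (DS (x, s)))) \<le> k" if s: "0 < s" "s \<le> t + 1" for x s
      proof -
        have "norm (R (fst (DS (x, s)))) \<le> (\<Sum>j\<in>J. norm (\<omega> j (x, s) *\<^sub>R R (g j s)))"
          unfolding RD snd_conv by (rule norm_sum)
        also have "\<dots> \<le> (\<Sum>j\<in>J. \<omega> j (x, s) * k)"
        proof (rule sum_mono)
          fix j assume j: "j \<in> J"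
          have "norm (g j s) + \<bar>c j s\<bar> + norm (R (g j s)) \<le> k" using k[OF j, of s] s by simp
          then have "norm (R (g j s)) \<le> k" using norm_ge_zero[of "g j s"] abs_ge_zero[of "c j s"] by linarith
          then show "norm (\<omega> j (x, s) *\<^sub>R R (g j s)) \<le> \<omega> j (x, s) * k" using \<omega>0 by (simp add: mult_left_mono)
        qed
        also have "\<dots> = k" unfolding sum_distrib_right[symmetric] \<omega>1 by simp
        finally show ?thesis .
      qed
      show "S (x, 0) \<le> W x 0" for x
      proof -
        obtain j where "j \<in> J" "g j 0 \<bullet> x + c j 0 \<le> W x 0" using init[of x] by blast
        then show ?thesis using SL[of j "(x, 0)"] by (simp add: L_def)
      qed
    qed (use t in auto)
    moreover have "M - d * ln (card J) \<le> S (x, t)"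
    proof -
      have "Z (x, t) \<le> (\<Sum>j\<in>J. exp (- M / d))"
        unfolding Z_def
      proof (rule sum_mono)
        fix j assume j: "j \<in> J"
        have "- L j (x, t) \<le> - M" using M[OF j] by (simp add: L_def)
        then have "- L j (x, t) / d \<le> - M / d" using d by (intro divide_right_mono) auto
        then show "exp (- L j (x, t) / d) \<le> exp (- M / d)" by simp
      qed
      then have "ln (Z (x, t)) \<le> ln (card J * exp (- M / d))"
        using Z[of "(x, t)"] by (intro ln_mono) auto
      also have "\<dots> = ln (card J) - M / d"
        using J by (subst ln_mult) (auto simp: card_gt_0_iff)
      finally have "d * ln (Z (x, t)) \<le> d * (ln (card J) - M / d)" using d by (intro mult_left_mono) auto
      then show ?thesis unfolding S_def using d by (simp add: right_diff_distrib)
    qed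
    ultimately show ?thesis by linarith
  qed
  have "((\<lambda>d. M - d * ln (card J)) \<longlongrightarrow> M - 0 * ln (card J)) (at_right 0)" by (intro tendsto_intros)
  then show ?thesis
    by (intro tendsto_upperbound[where f = "\<lambda>d. M - d * ln (card J)" and F = "at_right 0"])
      (auto simp: eventually_at_filter le)
qed

end

section \<open>Smoothing of the momenta\<close>

definition smoothing :: "real \<Rightarrow> real \<Rightarrow> real \<Rightarrow> (real \<Rightarrow> real) \<Rightarrow> (real \<Rightarrow> real) \<Rightarrow> (real \<Rightarrow> real) \<Rightarrow> bool" where
  "smoothing m M e w u u' \<longleftrightarrow> (\<forall>s. (u has_real_derivative u' s) (at s)) \<and> continuous_on UNIV u' \<and>
     (\<forall>s. m \<le> u' s \<and> u' s \<le> M) \<and> u 0 = w 0 \<and> (\<forall>s. \<bar>u s - w s\<bar> \<le> e)"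

text \<open>The moving average of \<open>w\<close> over \<open>[s, s + h]\<close> has the difference quotients of \<open>w\<close> as its derivative.\<close>

lemma smoothing_exists:
  assumes w: "slopes_in m M w" and A: "\<And>s. (A has_real_derivative w s) (at s)" and e: "0 < e"
  shows "\<exists>u u'. smoothing m M e w u u'"
proof -
  define l where "l = \<bar>m\<bar> + \<bar>M\<bar> + 1"
  define h where "h = e / (2 * l)"
  have l: "0 < l" unfolding l_def by simp
  have h: "0 < h" "2 * (l * h) = e" using e l unfolding h_def by auto
  have lip: "\<bar>w s - w r\<bar> \<le> l * (s - r)" if "r \<le> s" for r s
  proof -
    have "m * (s - r) \<le> w s - w r" "w s - w r \<le> M * (s - r)" using w that by (auto simp: slopes_in_def)
    moreover have "- l \<le> m" "M \<le> l" unfolding l_def by linarith+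
    then have "(- l) * (s - r) \<le> m * (s - r)" "M * (s - r) \<le> l * (s - r)"
      using that by (intro mult_right_mono; simp)+
    then have "- (l * (s - r)) \<le> m * (s - r)" "M * (s - r) \<le> l * (s - r)" by simp_all
    ultimately show ?thesis by linarith
  qed
  have cw: "continuous_on UNIV w"
  proof -
    have "l-lipschitz_on UNIV w"
    proof (rule lipschitz_onI)
      fix r s :: real
      show "dist (w r) (w s) \<le> l * dist r s"
        using lip[of r s] lip[of s r] by (cases "r \<le> s") (auto simp: dist_real_def abs_minus_commute)
    qed (use l in simp)
    then show ?thesis by (rule lipschitz_on_continuous_on)
  qed
  \<comment> \<open>The added constant restores the value at 0, so that an affine function below the
    initial cost remains one. It may double the error, whence 2 l h = e.\<close>
  define u where "u s = (A (s + h) - A s) / h + (w 0 - (A (0 + h) - A 0) / h)" for s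
  have avg: "\<bar>(A (s + h) - A s) / h - w s\<bar> \<le> l * h" for s
  proof -
    obtain x where x: "s < x" "x < s + h" "A (s + h) - A s = (s + h - s) * w x"
      using MVT2[of s "s + h" A w] A h by auto
    have "\<bar>w x - w s\<bar> \<le> l * (x - s)" using lip x by simp
    also have "\<dots> \<le> l * h" using x l by (intro mult_left_mono) auto
    finally show ?thesis using x h by simp
  qed
  have "smoothing m M e w u (\<lambda>s. (w (s + h) - w s) / h)"
    unfolding smoothing_def
  proof (intro conjI allI)
    fix s
    have "((\<lambda>s. A (s + h)) has_real_derivative w (s + h)) (at s)"
      using A[of "s + h"] by (simp add: DERIV_shift)
    then show "(u has_real_derivative (w (s + h) - w s) / h) (at s)"
      unfolding u_def using h A by (auto intro!: derivative_eq_intros)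
    have "m * h \<le> w (s + h) - w s" "w (s + h) - w s \<le> M * h" using w h unfolding slopes_in_def by (metis add_diff_cancel_left' le_add_same_cancel1 less_imp_le)+
    then show "m \<le> (w (s + h) - w s) / h" "(w (s + h) - w s) / h \<le> M" using h by (auto simp: le_divide_eq divide_le_eq)
    show "\<bar>u s - w s\<bar> \<le> e" using avg[of s] avg[of 0] h(2) unfolding u_def by linarith
  next
    show "continuous_on UNIV (\<lambda>s. (w (s + h) - w s) / h)"
      using h by (intro continuous_intros continuous_on_compose2[OF cw]) auto
    show "u 0 = w 0" by (simp add: u_def)
  qed
  then show ?thesis by blast
qed

lemma has_vector_derivative_nth:
  "(\<gamma> has_vector_derivative w) (at s) \<Longrightarrow> ((\<lambda>s. \<gamma> s $ i) has_real_derivative w $ i) (at s)"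
  using bounded_linear.has_vector_derivative[OF bounded_linear_vec_nth]
  by (simp add: has_real_derivative_iff_has_vector_derivative)

lemma slopes_in_smooth_vec:
  fixes w :: "real \<Rightarrow> real^'n"
  assumes w: "\<And>i. slopes_in (- b $ i) (a $ i) (\<lambda>s. w s $ i)" and A: "\<And>s. (A has_vector_derivative w s) (at s)" and e: "0 < e"
  obtains u u' where "\<And>s. (u has_vector_derivative u' s) (at s)" "continuous_on UNIV u'"
    "\<And>s i. - b $ i \<le> u' s $ i" "\<And>s i. u' s $ i \<le> a $ i" "u 0 = w 0" "\<And>s. norm (u s - w s) \<le> e"
proof -
  define d where "d = e / real CARD('n)"
  have d: "0 < d" unfolding d_def using e by simp
  obtain u u' where sm: "\<And>i. smoothing (- b $ i) (a $ i) d (\<lambda>s. w s $ i) (u i) (u' i)"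
    using smoothing_exists[OF w has_vector_derivative_nth[OF A] d] by metis
  have u: "(u i has_real_derivative u' i s) (at s)" "continuous_on UNIV (u' i)"
    "- b $ i \<le> u' i s" "u' i s \<le> a $ i" "u i 0 = w 0 $ i" "\<bar>u i s - w s $ i\<bar> \<le> d" for i s
    using sm[of i] unfolding smoothing_def by auto
  show thesis
  proof (rule that[of "\<lambda>s. \<chi> i. u i s" "\<lambda>s. \<chi> i. u' i s"])
    show "((\<lambda>s. \<chi> i. u i s) has_vector_derivative (\<chi> i. u' i s)) (at s)" for s
      by (rule has_vector_derivative_vec[OF u(1)])
    show "continuous_on UNIV (\<lambda>s. \<chi> i. u' i s)" by (intro continuous_on_vec_lambda u)
    show "norm ((\<chi> i. u i s) - w s) \<le> e" for s
    proof -
      have "norm ((\<chi> i. u i s) - w s) \<le> (\<Sum>i\<in>UNIV. \<bar>((\<chi> i. u i s) - w s) $ i\<bar>)" by (rule norm_le_l1_cart)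
      also have "\<dots> \<le> (\<Sum>i\<in>(UNIV :: 'n set). d)" using u(6) by (intro sum_mono) simp
      also have "\<dots> = e" unfolding d_def by simp
      finally show ?thesis .
    qed
  qed (use u in \<open>auto simp: vec_eq_iff\<close>)
qed

section \<open>The change of variables\<close>

lemma gcost_eq_max: "0 < a \<Longrightarrow> 0 < b \<Longrightarrow> gcost a b y = max (a * y) (- b * y)"
  unfolding gcost_def max_def by (auto simp: not_le zero_le_mult_iff mult_le_0_iff) (smt (verit) mult_nonneg_nonneg mult_pos_neg)+

lemma gcost_triangle: "0 < a \<Longrightarrow> 0 < b \<Longrightarrow> gcost a b (x + y) \<le> gcost a b x + gcost a b y"
  by (auto simp: gcost_eq_max algebra_simps max_def)

lemma gcost_scale: "0 \<le> l \<Longrightarrow> gcost a b (l * y) = l * gcost a b y"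
proof (cases "0 \<le> y")
  case True
  assume "0 \<le> l"
  then show ?thesis using True by (simp add: gcost_pos)
next
  case False
  assume "0 \<le> l"
  then have "l * y \<le> 0" using False by (simp add: mult_le_0_iff)
  then show ?thesis using False by (simp add: gcost_neg)
qed

lemma Gcost_nonneg: "(\<And>i. 0 < a $ i) \<Longrightarrow> (\<And>i. 0 < b $ i) \<Longrightarrow> 0 \<le> Gcost a b y"
  unfolding Gcost_def by (intro sum_nonneg gcost_nonneg) (auto simp: less_imp_le)

lemma Gcost_triangle:
  "(\<And>i. 0 < a $ i) \<Longrightarrow> (\<And>i. 0 < b $ i) \<Longrightarrow> Gcost a b (x + y) \<le> Gcost a b x + Gcost a b y"
  unfolding Gcost_def sum.distrib[symmetric] by (intro sum_mono) (simp add: gcost_triangle)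

lemma Gcost_scale: "0 \<le> l \<Longrightarrow> Gcost a b (l *\<^sub>R y) = l * Gcost a b y"
  by (simp add: Gcost_def sum_distrib_left gcost_scale)

lemma Gcost_lipschitz:
  assumes ab: "\<And>i. 0 < a $ i" "\<And>i. 0 < b $ i"
  shows "\<bar>Gcost a b x - Gcost a b y\<bar> \<le> (\<Sum>i\<in>UNIV. a $ i + b $ i) * norm (x - y)"
proof -
  have le: "Gcost a b z \<le> (\<Sum>i\<in>UNIV. a $ i + b $ i) * norm z" for z
  proof -
    have "gcost (a $ i) (b $ i) (z $ i) \<le> (a $ i + b $ i) * norm z" for i
    proof -
      have "gcost (a $ i) (b $ i) (z $ i) \<le> (a $ i + b $ i) * \<bar>z $ i\<bar>"
        using ab[of i] by (cases "0 \<le> z $ i") (auto simp: gcost_pos gcost_neg algebra_simps mult_le_0_iff)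
      also have "\<dots> \<le> (a $ i + b $ i) * norm z"
        using ab[of i] by (intro mult_left_mono component_le_norm_cart) auto
      finally show ?thesis .
    qed
    then show ?thesis unfolding Gcost_def sum_distrib_right by (intro sum_mono)
  qed
  show ?thesis
    using Gcost_triangle[OF ab, of "x - y" y] Gcost_triangle[OF ab, of "y - x" x] le[of "x - y"] le[of "y - x"]
    by (simp add: abs_le_iff norm_minus_commute)
qed

text \<open>Both sides are gauges, that is nonnegative 1-homogeneous functions with the same unit sublevel set.\<close>

lemma potential_eq_Gcost:
  fixes U :: "real^'n \<Rightarrow> real" and P :: "real^'n^'n"
  assumes U_nonpos: "\<And>x. U x \<le> 0" and U_homog: "one_homogeneous (\<lambda>x. U (x + u0))"
    and P: "invertible P" and ab: "\<And>i. 0 < a $ i" "\<And>i. 0 < b $ i"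
    and level_set: "{x. U (x + u0) \<ge> -1} =
       convex hull (\<Union>j\<in>UNIV. {(1 / a $ j) *\<^sub>R column j P, - (1 / b $ j) *\<^sub>R column j P})"
  shows "U x = - Gcost a b (matrix_inv P *v (x - u0))"
proof -
  let ?E = "\<Union>j\<in>UNIV. {(1 / a $ j) *\<^sub>R column j P, - (1 / b $ j) *\<^sub>R column j P}"
  define Q where "Q = matrix_inv P"
  have PQ: "P *v (Q *v z) = z" "Q *v (P *v z) = z" for z
    unfolding Q_def by (simp_all add: matrix_vector_mul_assoc matrix_inv_mult[OF P])
  define G where "G z = Gcost a b (Q *v z)" for z
  have Gadd: "G (y + z) \<le> G y + G z" for y z
    unfolding G_def by (simp add: matrix_vector_right_distrib Gcost_triangle[OF ab])
  have Gscale: "G (l *\<^sub>R z) = l * G z" if "0 \<le> l" for l z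
    unfolding G_def using that by (simp add: matrix_vector_mult_scaleR Gcost_scale)
  have G0: "0 \<le> G z" for z unfolding G_def by (rule Gcost_nonneg[OF ab])
  have hull: "convex hull ?E = {z. G z \<le> 1}"
  proof
    show "convex hull ?E \<subseteq> {z. G z \<le> 1}"
    proof (rule hull_minimal)
      show "convex {z. G z \<le> 1}"
      proof (rule convexI)
        fix y z and u v :: real assume *: "y \<in> {z. G z \<le> 1}" "z \<in> {z. G z \<le> 1}" "0 \<le> u" "0 \<le> v" "u + v = 1"
        have "G (u *\<^sub>R y + v *\<^sub>R z) \<le> u * G y + v * G z" using Gadd[of "u *\<^sub>R y" "v *\<^sub>R z"] * by (simp add: Gscale)
        also have "\<dots> \<le> u * 1 + v * 1" using * by (intro add_mono mult_left_mono) auto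
        finally show "u *\<^sub>R y + v *\<^sub>R z \<in> {z. G z \<le> 1}" using * by simp
      qed
      have "G (l *\<^sub>R column j P) = gcost (a $ j) (b $ j) l" for l j
      proof -
        have "l *\<^sub>R column j P = P *v (l *\<^sub>R axis j 1)" by (simp add: matrix_vector_mult_scaleR matrix_vector_mult_basis)
        then have "G (l *\<^sub>R column j P) = Gcost a b (l *\<^sub>R axis j 1)" by (simp add: G_def PQ)
        also have "\<dots> = (\<Sum>i\<in>UNIV. if i = j then gcost (a $ j) (b $ j) l else 0)"
          unfolding Gcost_def by (intro sum.cong) (auto simp: axis_def gcost_def)
        finally show ?thesis by simp
      qed
      note 1 = this
      have "G ((1 / a $ j) *\<^sub>R column j P) \<le> 1" "G (- (1 / b $ j) *\<^sub>R column j P) \<le> 1" for j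
        unfolding 1 using ab[of j] by (simp_all add: gcost_pos gcost_neg)
      then show "?E \<subseteq> {z. G z \<le> 1}" by auto
    qed
    show "{z. G z \<le> 1} \<subseteq> convex hull ?E"
    proof
      fix z assume "z \<in> {z. G z \<le> 1}"
      then have Gz: "G z \<le> 1" by simp
      define y where "y = Q *v z"
      \<comment> \<open>The weights of z on the vertices chosen by the signs of its coordinates.
        They sum to G(z) <= 1; the missing mass is placed at 0.\<close>
      define c where "c i = gcost (a $ i) (b $ i) (y $ i)" for i
      define pt where "pt i = (if 0 \<le> y $ i then (1 / a $ i) *\<^sub>R column i P else - (1 / b $ i) *\<^sub>R column i P)" for i
      have c0: "0 \<le> c i" for i unfolding c_def using ab[of i] by (intro gcost_nonneg) auto
      have sumc: "(\<Sum>i\<in>UNIV. c i) \<le> 1" using Gz by (simp add: G_def Gcost_def c_def y_def)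
      have ptH: "pt i \<in> convex hull ?E" for i by (rule hull_inc) (auto simp: pt_def)
      have cpt: "c i *\<^sub>R pt i = y $ i *\<^sub>R column i P" for i
        using ab[of i] by (auto simp: c_def pt_def gcost_pos gcost_neg)
      have z: "z = (\<Sum>i\<in>UNIV. c i *\<^sub>R pt i)"
      proof -
        have "z = P *v y" by (simp add: y_def PQ)
        also have "\<dots> = (\<Sum>i\<in>UNIV. y $ i *\<^sub>R column i P)" by (simp add: matrix_mult_sum scalar_mult_eq_scaleR)
        finally show ?thesis by (simp add: cpt)
      qed
      \<comment> \<open>For any index the two vertices lie on opposite sides of 0 on one line, and
        the weights a/(a+b), b/(a+b) balance them.\<close>
      have zero: "0 \<in> convex hull ?E"
      proof -
        fix j :: 'n
        have s: "a $ j + b $ j > 0" using ab[of j] by simp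
        have "(a $ j / (a $ j + b $ j)) *\<^sub>R ((1 / a $ j) *\<^sub>R column j P) + (b $ j / (a $ j + b $ j)) *\<^sub>R (- (1 / b $ j) *\<^sub>R column j P) \<in> convex hull ?E"
          using ab[of j] s
          by (intro convexD[OF convex_convex_hull] hull_inc) (auto simp: add_divide_distrib[symmetric])
        then show ?thesis using ab[of j] by simp
      qed
      show "z \<in> convex hull ?E"
      proof (cases "(\<Sum>i\<in>UNIV. c i) = 0")
        case True
        then have "c i = 0" for i using c0 by (simp add: sum_nonneg_eq_0_iff)
        then show ?thesis using z zero by simp
      next
        case False
        define s where "s = (\<Sum>i\<in>UNIV. c i)"
        have s: "0 < s" "s \<le> 1" using False sumc sum_nonneg[of UNIV c] c0 unfolding s_def by (auto simp: less_le)
        have "(\<Sum>i\<in>UNIV. (c i / s) *\<^sub>R pt i) \<in> convex hull ?E"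
          using c0 s ptH by (intro convex_sum[OF _ convex_convex_hull]) (auto simp: s_def sum_divide_distrib[symmetric])
        then have "s *\<^sub>R (\<Sum>i\<in>UNIV. (c i / s) *\<^sub>R pt i) + (1 - s) *\<^sub>R 0 \<in> convex hull ?E"
          using s zero by (intro convexD[OF convex_convex_hull]) auto
        moreover have "s *\<^sub>R (\<Sum>i\<in>UNIV. (c i / s) *\<^sub>R pt i) = z"
          unfolding z scaleR_sum_right using s by (intro sum.cong) auto
        ultimately show ?thesis by simp
      qed
    qed
  qed
  define u where "u z = - U (z + u0)" for z
  have u0: "0 \<le> u z" for z unfolding u_def using U_nonpos[of "z + u0"] by simp
  have uscale: "u (l *\<^sub>R z) = l * u z" if "0 \<le> l" for l z
    using U_homog that unfolding one_homogeneous_def u_def by simp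
  have lev: "u z \<le> 1 \<longleftrightarrow> G z \<le> 1" for z
    using level_set[unfolded hull] unfolding u_def by (auto simp: set_eq_iff)
  \<comment> \<open>Homogeneity carries the sublevel set at 1 to every positive level. Level 0 is
    not reached, whence the slack e below.\<close>
  have levc: "u z \<le> c \<longleftrightarrow> G z \<le> c" if c: "0 < c" for z c
    using lev[of "(1 / c) *\<^sub>R z"] c by (simp add: uscale Gscale divide_le_eq)
  have "u z = G z" for z
  proof (rule antisym)
    show "u z \<le> G z"
    proof (rule field_le_epsilon)
      fix e :: real assume "0 < e"
      then show "u z \<le> G z + e" using levc[of "G z + e" z] G0[of z] by simp
    qed
    show "G z \<le> u z"
    proof (rule field_le_epsilon)
      fix e :: real assume "0 < e"
      then show "G z \<le> u z + e" using levc[of "u z + e" z] u0[of z] by simp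
    qed
  qed
  from this[of "x - u0"] show ?thesis by (simp add: u_def G_def Q_def)
qed

section \<open>Norms and costs in the new coordinates\<close>

lemma matrix_norm_PPT: "(matrix_norm (P ** transpose P) q)\<^sup>2 = (norm (transpose P *v q))\<^sup>2"
proof -
  have "q \<bullet> ((P ** transpose P) *v q) = (transpose P *v q) \<bullet> (transpose P *v q)"
    by (simp add: matrix_vector_mul_assoc[symmetric] dot_lmul_matrix[symmetric] transpose_matrix_vector)
  then show ?thesis by (simp add: matrix_norm_def power2_norm_eq_inner)
qed

lemma matrix_norm_PPT_inv:
  fixes P :: "real^'n^'n"
  assumes P: "invertible P"
  shows "(matrix_norm (matrix_inv (P ** transpose P)) v)\<^sup>2 = (norm (matrix_inv P *v v))\<^sup>2"
proof -
  define Q where "Q = matrix_inv P"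
  note PQ = matrix_inv_mult[OF P, folded Q_def]
  have "(P ** transpose P) ** (transpose Q ** Q) = P ** (transpose P ** transpose Q) ** Q"
    by (simp add: matrix_mul_assoc)
  also have "\<dots> = mat 1" unfolding matrix_transpose_mul[symmetric] PQ(2) by (simp add: PQ(1))
  finally have right: "(P ** transpose P) ** (transpose Q ** Q) = mat 1" .
  then have inv: "invertible (P ** transpose P)" unfolding invertible_def using matrix_left_right_inverse by blast
  have "matrix_inv (P ** transpose P) = matrix_inv (P ** transpose P) ** ((P ** transpose P) ** (transpose Q ** Q))"
    unfolding right by simp
  also have "\<dots> = transpose Q ** Q"
    by (subst matrix_mul_assoc, subst matrix_inv_mult(2)[OF inv], rule matrix_mul_lid)
  finally have "matrix_inv (P ** transpose P) = transpose Q ** transpose (transpose Q)" by simp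
  then show ?thesis using matrix_norm_PPT[of "transpose Q" v] by (simp add: Q_def)
qed

text \<open>\<open>vector_derivative\<close> has an unspecified value where the curve is not
  differentiable; it agrees with v off a null set, which the integral ignores.\<close>

lemma control_cost_eq:
  fixes X :: "real \<Rightarrow> real^'n"
  assumes X: "ac_curve t X v" and t: "0 < t" and N: "\<And>v. (matrix_norm (matrix_inv M) v)\<^sup>2 = (norm (Q *v v))\<^sup>2"
  shows "control_cost M U \<Phi> t X = integral {0..t} (\<lambda>s. 1/2 * (norm (Q *v v s))\<^sup>2 - U (X s)) + \<Phi> (X 0)"
proof -
  obtain N0 where N0: "negligible N0" "\<And>s. s \<in> {0..t} - N0 \<Longrightarrow> (X has_vector_derivative v s) (at s within {0..t})"
    using X unfolding ac_curve_def by blast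
  have "vector_derivative X (at s within {0..t}) = v s" if "s \<in> {0..t} - N0" for s
    using vector_derivative_within_cbox[of 0 t s X "v s"] N0(2)[OF that] that t by simp
  then have "integral {0..t} (\<lambda>s. 1/2 * (norm (Q *v v s))\<^sup>2 - U (X s)) =
    integral {0..t} (\<lambda>s. 1/2 * (matrix_norm (matrix_inv M) (vector_derivative X (at s within {0..t})))\<^sup>2 - U (X s))"
    unfolding N by (intro integral_spike[OF N0(1)]) simp
  then show ?thesis unfolding control_cost_def by simp
qed

lemma poly_growth_imp_locally_lipschitz:
  assumes "poly_growth_lipschitz g"
  shows "\<exists>C\<ge>0. \<forall>x y. norm x \<le> r \<longrightarrow> norm y \<le> r \<longrightarrow> \<bar>g x - g y\<bar> \<le> C * norm (x - y)"
proof -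
  obtain C \<delta> where C: "0 \<le> C" "0 \<le> \<delta>" "\<And>x y. \<bar>g x - g y\<bar> \<le> C * norm (x - y) * (1 + norm x powr \<delta> + norm y powr \<delta>)"
    using assms unfolding poly_growth_lipschitz_def by blast
  define k where "k = C * (1 + \<bar>r\<bar> powr \<delta> + \<bar>r\<bar> powr \<delta>)"
  have "\<bar>g x - g y\<bar> \<le> k * norm (x - y)" if "norm x \<le> r" "norm y \<le> r" for x y
  proof -
    have "norm x powr \<delta> \<le> \<bar>r\<bar> powr \<delta>" "norm y powr \<delta> \<le> \<bar>r\<bar> powr \<delta>"
      using that C(2) by (auto intro!: powr_mono2)
    then have "C * norm (x - y) * (1 + norm x powr \<delta> + norm y powr \<delta>) \<le> C * norm (x - y) * (1 + \<bar>r\<bar> powr \<delta> + \<bar>r\<bar> powr \<delta>)"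
      using C(1) by (intro mult_left_mono) auto
    then show ?thesis using C(3)[of x y] unfolding k_def by (simp add: mult_ac)
  qed
  moreover have "0 \<le> k" unfolding k_def using C(1) by simp
  ultimately show ?thesis by blast
qed

text \<open>The optimal momentum has kinks, whereas certificates must be C1 in time. Smoothing keeps
  its slopes in [-b, a] and its initial value, so the certificate property survives and only the
  value at (x, t) drops, by at most e.\<close>

lemma smooth_certificate:
  fixes P :: "real^'n^'n"
  assumes ab: "\<And>i. 0 < a $ i" "\<And>i. 0 < b $ i" and t: "0 < t" and conv: "convex_on UNIV \<Psi>" and e: "0 < e"
  shows "\<exists>u u' c. (\<forall>s. (u has_vector_derivative u' s) (at s)) \<and> continuous_on UNIV u' \<and>
    (\<forall>s i. - b $ i \<le> u' s $ i \<and> u' s $ i \<le> a $ i) \<and> (\<forall>z. u 0 \<bullet> z - c \<le> Psi_tilde P u0 \<Psi> z) \<and>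
    V_Psi P u0 a b \<Psi> x t \<le> ereal (u t \<bullet> (matrix_inv P *v (x - u0)) - 1/2 * integral {0..t} (\<lambda>s. (norm (u s))\<^sup>2) - c + e)"
proof -
  define y where "y = matrix_inv P *v (x - u0)"
  obtain \<gamma> w c where g: "V_Psi P u0 a b \<Psi> x t = ereal (acost a b t \<gamma> w + Psi_tilde P u0 \<Psi> (\<gamma> 0))"
    "\<And>s. (\<gamma> has_vector_derivative w s) (at s)" "continuous_on UNIV w"
    "\<And>i. slopes_in (- b $ i) (a $ i) (\<lambda>s. w s $ i)"
    "acost a b t \<gamma> w + Psi_tilde P u0 \<Psi> (\<gamma> 0) = w t \<bullet> y - 1/2 * integral {0..t} (\<lambda>s. (norm (w s))\<^sup>2) - c"
    "\<And>z. w 0 \<bullet> z - c \<le> Psi_tilde P u0 \<Psi> z"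
    unfolding y_def by (rule V_Psi_attained[OF ab t conv, of P u0 x]) blast
  have cw: "continuous_on {0..t} w" using g(3) continuous_on_subset by blast
  obtain B where B: "\<And>s. s \<in> {0..t} \<Longrightarrow> norm (w s) \<le> B" "0 < B"
    using compact_imp_bounded[OF compact_continuous_image[OF cw compact_Icc]] unfolding bounded_pos
    by (metis imageI)
  \<comment> \<open>Moving the momentum by d changes the endpoint term by at most d |y| and the
    integral of its square by at most t d (2 B + 1), where d <= 1 is used.\<close>
  define D where "D = norm y + t * (2 * B + 1)"
  have D: "0 < D" unfolding D_def using t B(2) by (simp add: add_nonneg_pos)
  define d where "d = min 1 (e / D)"
  have d: "0 < d" "d \<le> 1" "d * D \<le> e" using e D unfolding d_def by (auto simp: min_def field_simps)
  obtain u u' where u: "\<And>s. (u has_vector_derivative u' s) (at s)" "continuous_on UNIV u'"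
    "\<And>s i. - b $ i \<le> u' s $ i" "\<And>s i. u' s $ i \<le> a $ i" "u 0 = w 0" "\<And>s. norm (u s - w s) \<le> d"
    by (rule slopes_in_smooth_vec[OF g(4,2) d(1)]) blast
  have cu: "continuous_on {0..t} u"
    using u(1) by (auto intro: has_vector_derivative_continuous continuous_at_imp_continuous_on)
  have "integral {0..t} (\<lambda>s. (norm (u s))\<^sup>2) \<le> integral {0..t} (\<lambda>s. (norm (w s))\<^sup>2 + d * (2 * B + 1))"
  proof (rule integral_le)
    show "(\<lambda>s. (norm (u s))\<^sup>2) integrable_on {0..t}" "(\<lambda>s. (norm (w s))\<^sup>2 + d * (2 * B + 1)) integrable_on {0..t}"
      by (intro integrable_continuous_real continuous_intros cu cw)+
    fix s assume s: "s \<in> {0..t}"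
    have "norm (u s) \<le> norm (w s) + d" using norm_triangle_sub[of "u s" "w s"] u(6)[of s] by linarith
    then have "(norm (u s))\<^sup>2 \<le> (norm (w s) + d)\<^sup>2" by (rule power_mono) simp
    also have "\<dots> = (norm (w s))\<^sup>2 + d * (2 * norm (w s) + d)" by (simp add: power2_eq_square algebra_simps)
    also have "\<dots> \<le> (norm (w s))\<^sup>2 + d * (2 * B + 1)"
      using B(1)[OF s] d by (intro add_left_mono mult_left_mono) auto
    finally show "(norm (u s))\<^sup>2 \<le> (norm (w s))\<^sup>2 + d * (2 * B + 1)" .
  qed
  also have "\<dots> = integral {0..t} (\<lambda>s. (norm (w s))\<^sup>2) + t * (d * (2 * B + 1))"
    using t by (subst integral_add) (auto intro!: integrable_continuous_real continuous_intros cw)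
  finally have I: "integral {0..t} (\<lambda>s. (norm (u s))\<^sup>2) \<le> integral {0..t} (\<lambda>s. (norm (w s))\<^sup>2) + t * (d * (2 * B + 1))" .
  have "w t \<bullet> y - u t \<bullet> y \<le> d * norm y"
  proof -
    have "w t \<bullet> y - u t \<bullet> y \<le> norm (w t - u t) * norm y"
      using norm_cauchy_schwarz[of "w t - u t" y] by (simp add: inner_diff_left)
    also have "\<dots> \<le> d * norm y" using u(6)[of t] by (intro mult_right_mono) (auto simp: norm_minus_commute)
    finally show ?thesis .
  qed
  moreover have "d * D = d * norm y + t * (d * (2 * B + 1))" unfolding D_def by algebra
  moreover have "0 \<le> t * (d * (2 * B + 1))" using t d B(2) by simp
  ultimately have "acost a b t \<gamma> w + Psi_tilde P u0 \<Psi> (\<gamma> 0) \<le> u t \<bullet> y - 1/2 * integral {0..t} (\<lambda>s. (norm (u s))\<^sup>2) - c + e"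
    using I d(3) unfolding g(5) by linarith
  then show ?thesis
    using u g(6) unfolding g(1) y_def[symmetric] by (intro exI[of _ u] exI[of _ u'] exI[of _ c]) simp
qed

section \<open>The minimum of convex initial costs in the original coordinates\<close>

theorem proposition2p7:
  fixes \<Phi> :: "real^'n \<Rightarrow> real" and \<Phi>s :: "nat \<Rightarrow> real^'n \<Rightarrow> real" and m :: nat
    and U :: "real^'n \<Rightarrow> real" and u0 :: "real^'n" and P M :: "real^'n^'n"
    and a b :: "real^'n" and V :: "real^'n \<Rightarrow> real \<Rightarrow> ereal"
  assumes m: "m \<ge> 1"
    and cont: "continuous_on UNIV \<Phi>"
    and Phi_min: "\<And>x. \<Phi> x = (MIN j\<in>{1..m}. \<Phi>s j x)"
    and Phi_convex: "\<And>j. j \<in> {1..m} \<Longrightarrow> convex_on UNIV (\<Phi>s j)"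
    and Phi_growth: "\<And>j. j \<in> {1..m} \<Longrightarrow> poly_growth_lipschitz (\<Phi>s j)"
    and Phi_below: "\<exists>\<alpha> \<beta>. \<forall>x. \<alpha> \<bullet> x + \<beta> \<le> \<Phi> x"
    and U_nonpos: "\<And>x. U x \<le> 0"
    and U_pwa: "piecewise_affine U"
    and U_concave: "concave_on UNIV U"
    and U_homog: "one_homogeneous (\<lambda>x. U (x + u0))"
    and P_inv: "invertible P"
    and a_pos: "\<And>i. a $ i > 0"
    and b_pos: "\<And>i. b $ i > 0"
    and level_set: "{x. U (x + u0) \<ge> -1} =
       convex hull (\<Union>j\<in>UNIV. {(1 / a $ j) *\<^sub>R column j P, - (1 / b $ j) *\<^sub>R column j P})"
    and M: "M = P ** transpose P"
    and V: "\<And>x t. V x t = (MIN j\<in>{1..m}. V_Psi P u0 a b (\<Phi>s j) x t)"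
  shows "(\<forall>x. \<forall>t\<ge>0. \<bar>V x t\<bar> \<noteq> \<infinity>)
    \<and> (\<lambda>x t. real_of_ereal (V x t)) \<in> class_G
    \<and> viscosity_solution_ivp (\<lambda>x q. 1/2 * (matrix_norm M q)^2 + U x) \<Phi>
         (\<lambda>x t. real_of_ereal (V x t))
    \<and> (\<forall>W\<in>class_G. viscosity_solution_ivp (\<lambda>x q. 1/2 * (matrix_norm M q)^2 + U x) \<Phi> W
         \<longrightarrow> (\<forall>x. \<forall>t\<ge>0. W x t = real_of_ereal (V x t)))
    \<and> (\<forall>x. \<forall>t>0.
         (\<forall>r\<in>{1..m}. V_Psi P u0 a b (\<Phi>s r) x t = V x t \<longrightarrow>
            optimal_trajectory M U \<Phi> x t (\<lambda>s. gamma_Psi P u0 a b (\<Phi>s r) s x t))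
         \<and> optimal_value M U \<Phi> x t = V x t)"
proof -
  define Q where "Q = matrix_inv P"
  define F where "F x = - U x" for x
  define Vr where "Vr x t = real_of_ereal (V x t)" for x t
  define cost where "cost t X v = integral {0..t} (\<lambda>s. 1/2 * (norm (Q *v v s))\<^sup>2 + F (X s)) + \<Phi> (X 0)"
    for t and X v :: "real \<Rightarrow> real^'n"
  have PQ: "P *v (Q *v z) = z" "Q *v (P *v z) = z" for z
    unfolding Q_def by (simp_all add: matrix_vector_mul_assoc matrix_inv_mult[OF P_inv])
  have F: "F x = Gcost a b (Q *v (x - u0))" for x
    unfolding F_def Q_def using potential_eq_Gcost[OF U_nonpos U_homog P_inv a_pos b_pos level_set, of x] by simp
  have fin: "finite {1..m}" "{1..m} \<noteq> {}" using m by auto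
  have V_le: "V x t \<le> V_Psi P u0 a b (\<Phi>s j) x t" if "j \<in> {1..m}" for j x t
    unfolding V using fin that by (intro Min_le) auto
  have V_ex: "\<exists>r\<in>{1..m}. V_Psi P u0 a b (\<Phi>s r) x t = V x t" for x t
    using Min_in[of "(\<lambda>j. V_Psi P u0 a b (\<Phi>s j) x t) ` {1..m}"] fin unfolding V by fastforce
  have Phi_le: "\<Phi> x \<le> \<Phi>s j x" if "j \<in> {1..m}" for j x
    unfolding Phi_min using fin that by (intro Min_le) auto
  have Phi_ex: "\<exists>r\<in>{1..m}. \<Phi>s r x = \<Phi> x" for x
    using Min_in[of "(\<lambda>j. \<Phi>s j x) ` {1..m}"] fin unfolding Phi_min by fastforce
  \<comment> \<open>The index is the one active at the starting point of the curve, where it turns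
    the cost with \<Phi>s j into the cost with \<Phi>.\<close>
  have upper: "V (X t) t \<le> ereal (cost t X v)" if t: "0 < t" and X: "ac_curve t X v" for t X v
  proof -
    obtain j where j: "j \<in> {1..m}" "\<Phi>s j (X 0) = \<Phi> (X 0)" using Phi_ex by blast
    define Y where "Y s = Q *v (X s - u0)" for s
    have Y: "ac_curve t Y (\<lambda>s. Q *v v s)"
      unfolding Y_def
      using ac_curve_linear[OF ac_curve_diff[OF X ac_curve_const[of t u0]] matrix_vector_mul_bounded_linear[of Q]] by simp
    have "V (X t) t \<le> V_Psi P u0 a b (\<Phi>s j) (X t) t" by (rule V_le[OF j(1)])
    also have "\<dots> \<le> ereal (acost a b t Y (\<lambda>s. Q *v v s) + Psi_tilde P u0 (\<Phi>s j) (Y 0))"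
      by (rule V_Psi_le[OF a_pos b_pos t Y]) (simp add: Y_def Q_def)
    also have "Psi_tilde P u0 (\<Phi>s j) (Y 0) = \<Phi> (X 0)" by (simp add: Psi_tilde_def Y_def PQ j(2))
    also have "acost a b t Y (\<lambda>s. Q *v v s) + \<Phi> (X 0) = cost t X v"
      unfolding acost_def cost_def F Y_def ..
    finally show ?thesis .
  qed
  \<comment> \<open>Here the index is active for V at (x, t). Replacing \<Phi>s r by the smaller
    \<Phi> can only lower the cost of its optimal curve, while the upper bound forbids a cost below
    V; so both agree.\<close>
  have attained: "\<exists>X v. X t = x \<and> (\<forall>s. (X has_vector_derivative v s) (at s)) \<and> continuous_on UNIV v \<and>
      (\<forall>s. gamma_Psi P u0 a b (\<Phi>s r) s x t = X s) \<and> V x t = ereal (cost t X v)"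
    if t: "0 < t" and r: "r \<in> {1..m}" "V_Psi P u0 a b (\<Phi>s r) x t = V x t" for x t r
  proof -
    obtain \<gamma> w c where g: "V_Psi P u0 a b (\<Phi>s r) x t = ereal (acost a b t \<gamma> w + Psi_tilde P u0 (\<Phi>s r) (\<gamma> 0))"
      "\<And>s. gamma_Psi P u0 a b (\<Phi>s r) s x t = P *v \<gamma> s + u0" "\<gamma> t = Q *v (x - u0)"
      "\<And>s. (\<gamma> has_vector_derivative w s) (at s)" "continuous_on UNIV w"
      unfolding Q_def by (rule V_Psi_attained[OF a_pos b_pos t Phi_convex[OF r(1)], of P u0 x]) blast
    define X where "X s = P *v \<gamma> s + u0" for s
    define v where "v s = P *v w s" for s
    have dX: "(X has_vector_derivative v s) (at s)" for s
      using has_vector_derivative_add[OF bounded_linear.has_vector_derivative[OF matrix_vector_mul_bounded_linear[of P] g(4)[of s]]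
          has_vector_derivative_const[of u0]]
      unfolding X_def v_def by simp
    have cv: "continuous_on UNIV v"
      unfolding v_def by (rule bounded_linear.continuous_on[OF matrix_vector_mul_bounded_linear g(5)])
    have Xt: "X t = x" by (simp add: X_def g(3) PQ)
    have eq: "acost a b t \<gamma> w + \<Phi> (X 0) = cost t X v"
      unfolding acost_def cost_def F by (simp add: X_def v_def PQ)
    have "V x t = ereal (acost a b t \<gamma> w + \<Phi>s r (X 0))" using g(1) r(2) by (simp add: Psi_tilde_def X_def)
    then have "ereal (cost t X v) \<le> V x t" using Phi_le[OF r(1), of "X 0"] eq by simp
    moreover have "V x t \<le> ereal (cost t X v)"
      using upper[OF t C1_imp_ac_curve[OF dX continuous_on_subset[OF cv subset_UNIV]]] by (simp add: Xt)
    ultimately have "V x t = ereal (cost t X v)" by (rule antisym[rotated])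
    then show ?thesis using Xt dX cv by (intro exI[of _ X] exI[of _ v]) (simp add: g(2) X_def)
  qed
  have V0: "V x 0 = ereal (\<Phi> x)" for x
  proof (rule antisym)
    have V_Psi: "V_Psi P u0 a b (\<Phi>s j) x 0 = ereal (\<Phi>s j x)" if "j \<in> {1..m}" for j
      by (rule V_Psi_0[OF a_pos b_pos Phi_convex[OF that] P_inv])
    show "V x 0 \<le> ereal (\<Phi> x)" using Phi_ex[of x] V_le V_Psi by metis
    show "ereal (\<Phi> x) \<le> V x 0" using V_ex[of x 0] Phi_le V_Psi by (metis ereal_less_eq(3))
  qed
  have V_real: "V x t = ereal (Vr x t)" if "0 \<le> t" for x t
  proof (cases "t = 0")
    case False
    then have "0 < t" using that by simp
    then show ?thesis using attained V_ex[of x t] unfolding Vr_def by (metis real_of_ereal.simps(1))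
  qed (simp add: Vr_def V0)
  obtain \<alpha> \<beta> where ab: "\<And>x. \<alpha> \<bullet> x + \<beta> \<le> \<Phi> x" using Phi_below by blast
  obtain k where k: "\<And>z. norm (Q *v z) \<le> norm z * k"
    using bounded_linear.bounded[OF matrix_vector_mul_bounded_linear[of Q]] by blast
  define c where "c = (\<Sum>i\<in>UNIV. a $ i + b $ i)"
  have c: "0 \<le> c" unfolding c_def using a_pos b_pos by (intro sum_nonneg) (simp add: less_imp_le add_nonneg_nonneg)
  \<comment> \<open>Momenta transform with the transpose of P, the inverse transpose of Q. F is
    Lipschitz through its gauge representation, and \<Phi> locally so as a minimum of finitely many
    such functions.\<close>
  interpret vf: value_function "(*v) Q" "(*v) (transpose P)" F \<Phi> "c * k" Vr \<alpha> \<beta>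
  proof (rule value_function.intro)
    show "linear ((*v) Q)" "linear ((*v) (transpose P))" by (rule matrix_vector_mul_linear)+
    show "q \<bullet> v = (transpose P *v q) \<bullet> (Q *v v)" for q v :: "real^'n"
      by (simp add: transpose_matrix_vector dot_lmul_matrix PQ)
    show "0 \<le> F x" for x unfolding F_def using U_nonpos[of x] by simp
    show "\<bar>F x - F y\<bar> \<le> c * k * norm (x - y)" for x y
    proof -
      have "\<bar>F x - F y\<bar> \<le> c * norm (Q *v (x - u0) - Q *v (y - u0))"
        unfolding F c_def by (rule Gcost_lipschitz[OF a_pos b_pos])
      also have "Q *v (x - u0) - Q *v (y - u0) = Q *v (x - y)" by (simp add: matrix_vector_mult_diff_distrib)
      also have "c * norm (Q *v (x - y)) \<le> c * (norm (x - y) * k)" using k c by (intro mult_left_mono) auto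
      finally show ?thesis by (simp add: mult_ac)
    qed
    show "\<exists>C. \<forall>x y. norm x \<le> r \<longrightarrow> norm y \<le> r \<longrightarrow> \<bar>\<Phi> x - \<Phi> y\<bar> \<le> C * norm (x - y)" for r
    proof -
      have "\<forall>j\<in>{1..m}. \<exists>C\<ge>0. \<forall>x y. norm x \<le> r \<longrightarrow> norm y \<le> r \<longrightarrow> \<bar>\<Phi>s j x - \<Phi>s j y\<bar> \<le> C * norm (x - y)"
        using poly_growth_imp_locally_lipschitz[OF Phi_growth] by blast
      then obtain C where C: "\<And>j. j \<in> {1..m} \<Longrightarrow> 0 \<le> C j"
        "\<And>j x y. j \<in> {1..m} \<Longrightarrow> norm x \<le> r \<Longrightarrow> norm y \<le> r \<Longrightarrow> \<bar>\<Phi>s j x - \<Phi>s j y\<bar> \<le> C j * norm (x - y)"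
        by metis
      have le: "\<Phi> x - \<Phi> y \<le> (\<Sum>j\<in>{1..m}. C j) * norm (x - y)" if "norm x \<le> r" "norm y \<le> r" for x y
      proof -
        obtain j where j: "j \<in> {1..m}" "\<Phi>s j y = \<Phi> y" using Phi_ex by blast
        have "\<Phi> x - \<Phi> y \<le> \<Phi>s j x - \<Phi>s j y" using Phi_le[OF j(1), of x] j(2) by simp
        also have "\<dots> \<le> C j * norm (x - y)" using C(2)[OF j(1) that] by linarith
        also have "\<dots> \<le> (\<Sum>j\<in>{1..m}. C j) * norm (x - y)"
          using C(1) j(1) by (intro mult_right_mono member_le_sum) auto
        finally show ?thesis .
      qed
      have "\<bar>\<Phi> x - \<Phi> y\<bar> \<le> (\<Sum>j\<in>{1..m}. C j) * norm (x - y)" if "norm x \<le> r" "norm y \<le> r" for x y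
        using le[OF that] le[OF that(2,1)] by (simp add: abs_le_iff norm_minus_commute)
      then show ?thesis by blast
    qed
    show "Vr x 0 = \<Phi> x" for x by (simp add: Vr_def V0)
    show "Vr (X t) t \<le> integral {0..t} (\<lambda>s. 1/2 * (norm (Q *v v s))\<^sup>2 + F (X s)) + \<Phi> (X 0)"
      if "0 < t" "ac_curve t X v" for t X v
      using upper[OF that] V_real[of t "X t"] that(1) unfolding cost_def by simp
    show "\<exists>X v. X t = x \<and> (\<forall>s. (X has_vector_derivative v s) (at s)) \<and> continuous_on UNIV v \<and>
      Vr x t = integral {0..t} (\<lambda>s. 1/2 * (norm (Q *v v s))\<^sup>2 + F (X s)) + \<Phi> (X 0)" if t: "0 < t" for t x
    proof -
      obtain r where "r \<in> {1..m}" "V_Psi P u0 a b (\<Phi>s r) x t = V x t" using V_ex by blast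
      from attained[OF t this] obtain X v where "X t = x" "\<forall>s. (X has_vector_derivative v s) (at s)"
        "continuous_on UNIV v" "V x t = ereal (cost t X v)" by blast
      then show ?thesis using V_real[of t x] t unfolding cost_def by (intro exI[of _ X] exI[of _ v]) simp
    qed
  qed (rule ab)
  have ham: "(\<lambda>x q. 1/2 * (matrix_norm M q)^2 + U x) = vf.ham"
    unfolding M matrix_norm_PPT vf.ham_def by (simp add: F_def fun_eq_iff)
  have Vr: "(\<lambda>x t. real_of_ereal (V x t)) = Vr" by (simp add: Vr_def fun_eq_iff)
  have unique: "W x t = Vr x t"
    if W: "W \<in> class_G" "viscosity_solution_ivp vf.ham \<Phi> W" and t: "0 \<le> t" for W x t
  proof (rule antisym)
    have cW: "continuous_on (UNIV \<times> {0..}) (\<lambda>(x, t). W x t)" and sub: "viscosity_subsolution vf.ham W"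
      and sup: "viscosity_supersolution vf.ham W" and W0: "\<And>x. W x 0 = \<Phi> x"
      using W(2) unfolding viscosity_solution_ivp_def by auto
    show "W x t \<le> Vr x t" by (rule vf.subsolution_le_value[OF cW sub _ t]) (simp add: W0)
    obtain \<alpha>' where \<alpha>': "\<And>T. 0 < T \<Longrightarrow> \<exists>C. \<forall>x. \<forall>t\<in>{0..T}. C \<le> W x t - \<alpha>' \<bullet> x"
      using W(1) unfolding class_G_def by blast
    show "Vr x t \<le> W x t"
    proof (cases "t = 0")
      case True
      then show ?thesis by (simp add: W0 vf.V_0)
    next
      case False
      then have t: "0 < t" using t by simp
      show ?thesis
      proof (rule field_le_epsilon)
        fix e :: real assume e: "0 < e"
        \<comment> \<open>All m certificates are taken for the same (x, t). Up to e each reaches the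
          value for its own j, hence at least V, so their minimum does as well.\<close>
        note certs = smooth_certificate[OF a_pos b_pos t Phi_convex e, of _ P u0 x, folded Q_def]
        obtain u u' d where u: "\<And>j s. j \<in> {1..m} \<Longrightarrow> (u j has_vector_derivative u' j s) (at s)"
          "\<And>j. j \<in> {1..m} \<Longrightarrow> continuous_on UNIV (u' j)"
          "\<And>j s i. j \<in> {1..m} \<Longrightarrow> - b $ i \<le> u' j s $ i \<and> u' j s $ i \<le> a $ i"
          "\<And>j z. j \<in> {1..m} \<Longrightarrow> u j 0 \<bullet> z - d j \<le> Psi_tilde P u0 (\<Phi>s j) z"
          "\<And>j. j \<in> {1..m} \<Longrightarrow> V_Psi P u0 a b (\<Phi>s j) x t \<le>
             ereal (u j t \<bullet> (Q *v (x - u0)) - 1/2 * integral {0..t} (\<lambda>s. (norm (u j s))\<^sup>2) - d j + e)"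
          using certs by metis
        \<comment> \<open>The certificate in the original coordinates: the gradient is pulled back
          by the transpose of Q, and the shift by u0 goes into the constant term.\<close>
        define g where "g j s = transpose Q *v u j s" for j s
        define g' where "g' j s = transpose Q *v u' j s" for j s
        define h where "h j s = - (u j s \<bullet> (Q *v u0)) - 1/2 * integral {0..s} (\<lambda>s. (norm (u j s))\<^sup>2) - d j" for j s
        define h' where "h' j s = - (u' j s \<bullet> (Q *v u0)) - 1/2 * (norm (u j s))\<^sup>2" for j s
        have tQ: "(transpose Q *v p) \<bullet> z = p \<bullet> (Q *v z)" for p z
          by (simp add: transpose_matrix_vector dot_lmul_matrix)
        have Rg: "transpose P *v (g j s) = u j s" for j s
          unfolding g_def Q_def matrix_vector_mul_assoc matrix_transpose_mul[symmetric] matrix_inv_mult(2)[OF P_inv] by simp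
        have cu: "continuous_on S (u j)" if "j \<in> {1..m}" for j S
          using u(1)[OF that] by (auto intro: has_vector_derivative_continuous continuous_at_imp_continuous_on)
        have cn: "continuous_on S (\<lambda>s. (norm (u j s))\<^sup>2)" if "j \<in> {1..m}" for j S
          by (intro continuous_intros cu[OF that])
        have val: "g j s \<bullet> z + h j s = u j s \<bullet> (Q *v (z - u0)) - 1/2 * integral {0..s} (\<lambda>s. (norm (u j s))\<^sup>2) - d j" for j s z
          unfolding g_def h_def tQ by (simp add: matrix_vector_mult_diff_distrib inner_diff_right)
        have "Vr x t - e \<le> W x t"
        proof (rule vf.dual_certificate_le[OF cW sup \<alpha>' fin, where g = g and g' = g' and c = h and c' = h'])
          fix j assume j: "j \<in> {1..m}"
          show "(g j has_vector_derivative g' j s) (at s)" for s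
            using bounded_linear.has_vector_derivative[OF matrix_vector_mul_bounded_linear[of "transpose Q"] u(1)[OF j]]
            unfolding g_def g'_def .
          show "continuous_on UNIV (g' j)"
            unfolding g'_def by (rule bounded_linear.continuous_on[OF matrix_vector_mul_bounded_linear u(2)[OF j]])
          show "(h j has_real_derivative h' j s) (at s)" if "0 < s" for s
          proof -
            have "((\<lambda>s. u j s \<bullet> (Q *v u0)) has_real_derivative u' j s \<bullet> (Q *v u0)) (at s)"
              using bounded_linear.has_vector_derivative[OF bounded_linear_inner_left u(1)[OF j]]
              by (simp add: has_real_derivative_iff_has_vector_derivative)
            from DERIV_diff[OF DERIV_diff[OF DERIV_minus[OF this]
                DERIV_cmult[OF has_derivative_integral_from_0[OF cn[OF j] that], of "1/2"]] DERIV_const[of "d j"]]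
            show ?thesis unfolding h_def h'_def by simp
          qed
          show "continuous_on {0<..} (h' j)"
            unfolding h'_def by (intro continuous_intros cu[OF j] continuous_on_subset[OF u(2)[OF j]]) auto
          show "continuous_on {0..} (h j)"
            unfolding h_def by (intro continuous_intros cu[OF j] continuous_on_integral_from_0 cn[OF j])
          show "g' j s \<bullet> z + h' j s + vf.ham z (g j s) \<le> 0" for s z
          proof -
            \<comment> \<open>The kinetic terms cancel exactly because the transpose of P maps
              \<open>g\<close> back to \<open>u\<close>. What remains is the subgradient inequality
              for the gauge, which holds since u' has its coordinates in [-b, a].\<close>
            have "u' j s \<bullet> y \<le> Gcost a b y" for y
              unfolding inner_vec_def Gcost_def using u(3)[OF j] by (intro sum_mono) (simp add: gcost_ge)
            from this[of "Q *v (z - u0)"] show ?thesis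
              unfolding vf.ham_def Rg F g'_def h'_def tQ by (simp add: matrix_vector_mult_diff_distrib inner_diff_right)
          qed
          have "ereal (Vr x t) \<le> ereal (g j t \<bullet> x + h j t + e)"
            using order_trans[OF V_le[OF j] u(5)[OF j]] V_real[of t x] t unfolding val by simp
          then show "Vr x t - e \<le> g j t \<bullet> x + h j t" by simp
        next
          fix z
          \<comment> \<open>Only the index active for \<Phi> at z is known to lie below W there,
            which is all that the soft minimum requires.\<close>
          obtain j where j: "j \<in> {1..m}" "\<Phi>s j z = \<Phi> z" using Phi_ex by blast
          have "g j 0 \<bullet> z + h j 0 \<le> W z 0"
            unfolding val using u(4)[OF j(1), of "Q *v (z - u0)"] by (simp add: Psi_tilde_def PQ j(2) W0)
          then show "\<exists>j\<in>{1..m}. g j 0 \<bullet> z + h j 0 \<le> W z 0" using j(1) by blast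
        qed (assumption, rule less_imp_le[OF t])
        then show "Vr x t \<le> W x t + e" by simp
      qed
    qed
  qed
  have control: "control_cost M U \<Phi> t X = cost t X v" if "0 < t" "ac_curve t X v" for t X v
    using control_cost_eq[OF that(2,1), of M Q U \<Phi>] matrix_norm_PPT_inv[OF P_inv]
    unfolding M Q_def[symmetric] cost_def F_def by simp
  have lower: "V x t \<le> optimal_value M U \<Phi> x t" if t: "0 < t" for x t
    unfolding optimal_value_def
  proof (rule INF_greatest)
    fix X assume "X \<in> admissible x t"
    then obtain L where L: "L-lipschitz_on {0..t} X" and Xt: "X t = x" unfolding admissible_def by blast
    obtain v where v: "ac_curve t X v" using lipschitz_imp_ac_curve[OF L] t by auto
    show "V x t \<le> ereal (control_cost M U \<Phi> t X)"
      using upper[OF t v] unfolding control[OF t v] Xt .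
  qed
  have optimal: "optimal_trajectory M U \<Phi> x t (\<lambda>s. gamma_Psi P u0 a b (\<Phi>s r) s x t) \<and> optimal_value M U \<Phi> x t = V x t"
    if t: "0 < t" and r: "r \<in> {1..m}" "V_Psi P u0 a b (\<Phi>s r) x t = V x t" for x t r
  proof -
    obtain X v where X: "X t = x" "\<And>s. (X has_vector_derivative v s) (at s)" "continuous_on UNIV v"
      "\<And>s. gamma_Psi P u0 a b (\<Phi>s r) s x t = X s" "V x t = ereal (cost t X v)"
      using attained[OF t r] by blast
    have ac: "ac_curve t X v" by (rule C1_imp_ac_curve[OF X(2) continuous_on_subset[OF X(3) subset_UNIV]])
    then have adm: "X \<in> admissible x t" unfolding admissible_def ac_curve_def using X(1) by blast
    have c: "ereal (control_cost M U \<Phi> t X) = V x t" unfolding control[OF t ac] X(5) ..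
    have "optimal_value M U \<Phi> x t \<le> V x t"
      unfolding optimal_value_def c[symmetric] by (rule INF_lower[OF adm])
    then have "optimal_value M U \<Phi> x t = V x t" using lower[OF t] by (rule antisym)
    then show ?thesis unfolding optimal_trajectory_def X(4) using adm c by simp
  qed
  show ?thesis
    unfolding ham Vr
  proof (intro conjI allI impI ballI)
    show "\<bar>V x t\<bar> \<noteq> \<infinity>" if "0 \<le> t" for x t using V_real[OF that, of x] by simp
    show "Vr \<in> class_G" by (rule vf.value_in_class_G)
    show "viscosity_solution_ivp vf.ham \<Phi> Vr" by (rule vf.value_viscosity_solution)
    show "W x t = real_of_ereal (V x t)" if "W \<in> class_G" "viscosity_solution_ivp vf.ham \<Phi> W" "0 \<le> t" for W x t
      using unique[OF that] by (simp add: Vr_def)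
    show "optimal_trajectory M U \<Phi> x t (\<lambda>s. gamma_Psi P u0 a b (\<Phi>s r) s x t)"
      if "0 < t" "r \<in> {1..m}" "V_Psi P u0 a b (\<Phi>s r) x t = V x t" for x t r
      using optimal[OF that] by blast
    show "optimal_value M U \<Phi> x t = V x t" if "0 < t" for x t
      using optimal[OF that] V_ex[of x t] by blast
  qed
qed

end
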